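(* Let $d,p\in\mathbb{N}$ and consider $d$-dimensional VAR($p$) processes $S$ with instantaneous effects such that $\varepsilon_t\overset{\text{i.i.d.}}{\sim}\mathcal{N}(0,\Gamma)$ with $\Gamma=\mathrm{diag}(\sigma_1^2,\ldots,\sigma_d^2)$ diagonal, with components ordered according to the topological order of the instantaneous effects, so that $A_0$ is lower triangular with zero diagonal. Let $\mathcal{G}_{full}$ denote the full-time DAG of the process. Define $$\mathcal{D}:=\{(\mathrm{vech}(A_0),\mathrm{vec}(A_1|\ldots|A_p))\in\mathbb{R}^{pd^2+d(d-1)/2}:\ \det((I_d-A_0)\lambda^p-A_1\lambda^{p-1}-\ldots-A_p)=0\Rightarrow|\lambda|<1\}$$ and let $\overset{\circ}{\mathcal{D}}$ be its interior. Assume that $(\mathrm{vech}(A_0),\mathrm{vec}(A_1|\ldots|A_p),\sigma_1^2,\ldots,\sigma_d^2)$ is sampled from a probability distribution $\mathbb{P}$ on $\overset{\circ}{\mathcal{D}}\times(0,\infty)^d$ which is absolutely continuous with respect to Lebesgue measure. Then the distribution of the process is $\mathbb{P}$-almost surely faithful to $\mathcal{G}_{full}$. More precisely, the set of coefficients and variances for which there exist finite pairwise disjoint sets of nodes $A,B,C$ of $\mathcal{G}_{full}$ such that $A\perp\!\!\!\perp C\mid B$ (under the distribution of the process) but $A$ and $C$ are not $d$-separated by $B$ in $\mathcal{G}_{full}$ has $\mathbb{P}$-probability zero.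
   Context: VAR process with instantaneous effects. $S=(S_t)_{t\in\mathbb{Z}}$ satisfies, for all $t\in\mathbb{Z}$, $S_t=A_0S_t+A_1S_{t-1}+\ldots+A_pS_{t-p}+\varepsilon_t$ with $A_0,\ldots,A_p\in\mathbb{R}^{d\times d}$, $\mathrm{diag}(A_0)=0$, where $\det((I_d-A_0)\lambda^p-A_1\lambda^{p-1}-\ldots-A_p)=0$ implies $|\lambda|<1$ and $(\varepsilon_t)$ is i.i.d. with finite second moments and jointly independent components. $S$ is understood to be the stationary solution, and the distribution of the process is its stationary distribution (given the coefficients and variances). Here $\sigma_i^2$ is the variance of $\varepsilon_t^i$. Full-time DAG. It is the infinite directed graph with nodes $\{S_t^i: i\in\{1,\ldots,d\},t\in\mathbb{Z}\}$ with an edge $S_{t-k}^j\to S_t^i$, for $t\in\mathbb{Z}$, $k\in\{0,\ldots,p\}$, if and only if $(A_k)_{i,j}\neq0$ (so it depends on the sampled coefficients); it is acyclic because $A_0$ is strictly lower triangular. Notation. $\mathrm{vec}(M)$ stacks the columns of $M$ into a vector; $\mathrm{vech}(M)$, for an $n\times n$ matrix $M$, is the vector in $\mathbb{R}^{n(n-1)/2}$ obtained by stacking column-wise the elements strictly below the diagonal; $(A_1|\ldots|A_p)$ is horizontal concatenation. Faithfulness. A distribution over the nodes of a graph is faithful to the graph if for all finite pairwise disjoint sets of nodes $A,B,C$, $A\perp\!\!\!\perp C\mid B$ implies that $A$ and $C$ are separated (here $d$-separated) by $B$. $d$-separation. Paths have distinct vertices, edges may be traversed in either direction; $v$ is a collider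 in a path if the path has the form $\to v\leftarrow$ there. $DE(v)$ is the set of descendants of $v$, including $v$. A path between $v$ and $w$ is blocked by $B\subset V\setminus\{v,w\}$ if some non-collider of the path other than its endpoints is in $B$, or some collider $u$ in it has $DE(u)\cap B=\emptyset$. $A$ and $C$ are $d$-separated by $B$ if every path from a node of $A$ to a node of $C$ is blocked by $B$. *)

theory Defs
  imports "HOL-Probability.Probability" "Jordan_Normal_Form.Determinant"
begin

section \<open>Graphs and \<open>d\<close>-separation\<close>

text \<open>
  A directed acyclic graph is given by its edge relation. Since opposite edges and parallel edges
  do not occur in such a graph, a path is determined by the list of its vertices.
\<close>

definition descendants :: "('v \<times> 'v) set \<Rightarrow> 'v \<Rightarrow> 'v set" where
  "descendants E v = {w. (v, w) \<in> E\<^sup>*}"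

definition path_between :: "('v \<times> 'v) set \<Rightarrow> 'v \<Rightarrow> 'v list \<Rightarrow> 'v \<Rightarrow> bool" where
  "path_between E v vs w \<longleftrightarrow>
     vs \<noteq> [] \<and> hd vs = v \<and> last vs = w \<and> distinct vs \<and>
     (\<forall>i. Suc i < length vs \<longrightarrow> (vs ! i, vs ! Suc i) \<in> E \<or> (vs ! Suc i, vs ! i) \<in> E)"

definition collider_at :: "('v \<times> 'v) set \<Rightarrow> 'v list \<Rightarrow> nat \<Rightarrow> bool" where
  "collider_at E vs i \<longleftrightarrow> (vs ! (i - 1), vs ! i) \<in> E \<and> (vs ! Suc i, vs ! i) \<in> E"

definition blocked :: "('v \<times> 'v) set \<Rightarrow> 'v set \<Rightarrow> 'v list \<Rightarrow> bool" where
  "blocked E B vs \<longleftrightarrow>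
     (\<exists>i. 0 < i \<and> Suc i < length vs \<and>
        (if collider_at E vs i then descendants E (vs ! i) \<inter> B = {} else vs ! i \<in> B))"

definition d_separated :: "('v \<times> 'v) set \<Rightarrow> 'v set \<Rightarrow> 'v set \<Rightarrow> 'v set \<Rightarrow> bool" where
  "d_separated E A C B \<longleftrightarrow>
     (\<forall>v\<in>A. \<forall>w\<in>C. \<forall>vs. path_between E v vs w \<longrightarrow> blocked E B vs)"


section \<open>Conditional independence and faithfulness\<close>

text \<open>The \<open>\<sigma>\<close>-algebra generated by the coordinates in \<open>U\<close> of a law on a real product space.\<close>

definition coord_algebra :: "('v \<Rightarrow> real) measure \<Rightarrow> 'v set \<Rightarrow> ('v \<Rightarrow> real) measure" where
  "coord_algebra \<mu> U = vimage_algebra (space \<mu>) (\<lambda>x. restrict x U) (Pi\<^sub>M U (\<lambda>_. borel))"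

definition cond_indep :: "('v \<Rightarrow> real) measure \<Rightarrow> 'v set \<Rightarrow> 'v set \<Rightarrow> 'v set \<Rightarrow> bool" where
  "cond_indep \<mu> A C B \<longleftrightarrow>
     (\<forall>E\<in>sets (coord_algebra \<mu> A). \<forall>F\<in>sets (coord_algebra \<mu> C).
        AE x in \<mu>. real_cond_exp \<mu> (coord_algebra \<mu> B) (indicat_real (E \<inter> F)) x =
          real_cond_exp \<mu> (coord_algebra \<mu> B) (indicat_real E) x *
          real_cond_exp \<mu> (coord_algebra \<mu> B) (indicat_real F) x)"

definition faithful :: "'v set \<Rightarrow> ('v \<times> 'v) set \<Rightarrow> ('v \<Rightarrow> real) measure \<Rightarrow> bool" where
  "faithful V E \<mu> \<longleftrightarrow>
     (\<forall>A B C. A \<subseteq> V \<and> B \<subseteq> V \<and> C \<subseteq> V \<and> finite A \<and> finite B \<and> finite C \<and>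
        A \<inter> B = {} \<and> A \<inter> C = {} \<and> B \<inter> C = {} \<and> cond_indep \<mu> A C B
        \<longrightarrow> d_separated E A C B)"


section \<open>VAR processes with instantaneous effects\<close>

text \<open>
  Components are indexed by \<open>i < d\<close> and the pair \<open>(i, t)\<close> stands for the node \<open>S\<^sub>t\<^sup>i\<close>. Vectors in
  \<open>\<real>\<^sup>d\<close> are the extensional functions on \<open>{..<d}\<close>. Of a coefficient family \<open>A\<close> only
  \<open>A 0, \<dots>, A p\<close> matter.
\<close>

definition nodes :: "nat \<Rightarrow> (nat \<times> int) set" where
  "nodes d = {..<d} \<times> UNIV"

definition full_time_edges ::
    "nat \<Rightarrow> nat \<Rightarrow> (nat \<Rightarrow> real mat) \<Rightarrow> ((nat \<times> int) \<times> (nat \<times> int)) set" where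
  "full_time_edges d p A =
     {((j, t - int k), (i, t)) | i j k t. i < d \<and> j < d \<and> k \<le> p \<and> A k $$ (i, j) \<noteq> 0}"

definition process_law ::
    "nat \<Rightarrow> 'w measure \<Rightarrow> (int \<Rightarrow> 'w \<Rightarrow> nat \<Rightarrow> real) \<Rightarrow> (nat \<times> int \<Rightarrow> real) measure" where
  "process_law d M S =
     distr M (Pi\<^sub>M (nodes d) (\<lambda>_. borel)) (\<lambda>\<omega>. \<lambda>v\<in>nodes d. S (snd v) \<omega> (fst v))"

text \<open>The centred normal distribution on \<open>\<real>\<^sup>d\<close> with diagonal covariance matrix.\<close>

definition diag_normal :: "nat \<Rightarrow> (nat \<Rightarrow> real) \<Rightarrow> (nat \<Rightarrow> real) measure" where
  "diag_normal d \<sigma>2 = Pi\<^sub>M {..<d} (\<lambda>i. density lborel (normal_density 0 (sqrt (\<sigma>2 i))))"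

text \<open>
  \<open>S\<close> is a (strictly) stationary solution of
  \<open>S\<^sub>t = A\<^sub>0 S\<^sub>t + A\<^sub>1 S\<^sub>t\<^sub>-\<^sub>1 + \<dots> + A\<^sub>p S\<^sub>t\<^sub>-\<^sub>p + \<epsilon>\<^sub>t\<close> with i.i.d. innovations
  \<open>\<epsilon>\<^sub>t \<sim> N(0, diag(\<sigma>\<^sub>1\<^sup>2, \<dots>, \<sigma>\<^sub>d\<^sup>2))\<close>.
\<close>

definition stationary_var_process ::
    "nat \<Rightarrow> nat \<Rightarrow> (nat \<Rightarrow> real mat) \<Rightarrow> (nat \<Rightarrow> real) \<Rightarrow> 'w measure \<Rightarrow>
     (int \<Rightarrow> 'w \<Rightarrow> nat \<Rightarrow> real) \<Rightarrow> (int \<Rightarrow> 'w \<Rightarrow> nat \<Rightarrow> real) \<Rightarrow> bool" where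
  "stationary_var_process d p A \<sigma>2 M S \<epsilon> \<longleftrightarrow>
     prob_space M \<and>
     (\<forall>t. S t \<in> M \<rightarrow>\<^sub>M Pi\<^sub>M {..<d} (\<lambda>_. borel)) \<and>
     prob_space.indep_vars M (\<lambda>_. Pi\<^sub>M {..<d} (\<lambda>_. borel)) \<epsilon> UNIV \<and>
     (\<forall>t. distr M (Pi\<^sub>M {..<d} (\<lambda>_. borel)) (\<epsilon> t) = diag_normal d \<sigma>2) \<and>
     (\<forall>t. AE \<omega> in M. \<forall>i<d.
        S t \<omega> i = (\<Sum>k\<le>p. \<Sum>j<d. A k $$ (i, j) * S (t - int k) \<omega> j) + \<epsilon> t \<omega> i) \<and>
     (\<forall>h. process_law d M (\<lambda>t. S (t + h)) = process_law d M S)"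


section \<open>The parameter space\<close>

definition vech :: "'a mat \<Rightarrow> 'a list" where
  "vech A = concat (map (\<lambda>j. map (\<lambda>i. A $$ (i, j)) [Suc j..<dim_row A]) [0..<dim_col A])"

definition vec_stack :: "'a mat \<Rightarrow> 'a list" where
  "vec_stack A = concat (map (\<lambda>j. map (\<lambda>i. A $$ (i, j)) [0..<dim_row A]) [0..<dim_col A])"

definition hconcat :: "nat \<Rightarrow> nat \<Rightarrow> (nat \<Rightarrow> 'a mat) \<Rightarrow> 'a mat" where
  "hconcat d p A = mat d (p * d) (\<lambda>(i, c). A (Suc (c div d)) $$ (i, c mod d))"

definition n_coeffs :: "nat \<Rightarrow> nat \<Rightarrow> nat" where
  "n_coeffs d p = p * d\<^sup>2 + d * (d - 1) div 2"

text \<open>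
  A parameter vector \<open>\<theta> = (vech A\<^sub>0, vec (A\<^sub>1|\<dots>|A\<^sub>p), \<sigma>\<^sub>1\<^sup>2, \<dots>, \<sigma>\<^sub>d\<^sup>2)\<close> is a function on
  \<open>{..<n_coeffs d p + d}\<close>. The following functions read off its components; lemma
  \<open>vech_vec_coeff_mat\<close> below confirms the positions.
\<close>

definition coeff_mat :: "nat \<Rightarrow> (nat \<Rightarrow> real) \<Rightarrow> nat \<Rightarrow> real mat" where
  "coeff_mat d \<theta> k = mat d d (\<lambda>(i, j).
     if k = 0 then (if j < i then \<theta> ((\<Sum>l<j. d - Suc l) + (i - Suc j)) else 0)
     else \<theta> (d * (d - 1) div 2 + ((k - 1) * d + j) * d + i))"

definition noise_var :: "nat \<Rightarrow> nat \<Rightarrow> (nat \<Rightarrow> real) \<Rightarrow> nat \<Rightarrow> real" where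
  "noise_var d p \<theta> i = \<theta> (n_coeffs d p + i)"

definition var_char_mat :: "nat \<Rightarrow> nat \<Rightarrow> (nat \<Rightarrow> real mat) \<Rightarrow> complex \<Rightarrow> complex mat" where
  "var_char_mat d p A z = mat d d (\<lambda>(i, j).
     ((if i = j then 1 else 0) - complex_of_real (A 0 $$ (i, j))) * z ^ p -
     (\<Sum>k=1..p. complex_of_real (A k $$ (i, j)) * z ^ (p - k)))"

definition coeff_dom :: "nat \<Rightarrow> nat \<Rightarrow> (nat \<Rightarrow> real) set" where
  "coeff_dom d p =
     {\<theta> \<in> {..<n_coeffs d p} \<rightarrow>\<^sub>E UNIV.
        \<forall>z. Determinant.det (var_char_mat d p (coeff_mat d \<theta>) z) = 0 \<longrightarrow> cmod z < 1}"

definition param_dom :: "nat \<Rightarrow> nat \<Rightarrow> (nat \<Rightarrow> real) set" where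
  "param_dom d p =
     {\<theta> \<in> {..<n_coeffs d p + d} \<rightarrow>\<^sub>E UNIV.
        restrict \<theta> {..<n_coeffs d p} \<in> powertop_real {..<n_coeffs d p} interior_of coeff_dom d p \<and>
        (\<forall>i<d. 0 < noise_var d p \<theta> i)}"

definition lebesgue_on_params :: "nat \<Rightarrow> nat \<Rightarrow> (nat \<Rightarrow> real) measure" where
  "lebesgue_on_params d p = Pi\<^sub>M {..<n_coeffs d p + d} (\<lambda>_. lborel)"

lemma sum_diff_Suc: "(\<Sum>l<d. d - Suc l) = d * (d - 1) div (2::nat)"
proof -
  have "(\<Sum>l<d. d - Suc l) = \<Sum>{..<d}"
    by (rule sum.nat_diff_reindex)
  then show ?thesis
    by (metis Sum_Ico_nat atLeast0LessThan diff_zero mult_zero_left minus_nat.diff_0)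
qed

lemma upt_blocks:
  "concat (map (\<lambda>j. map (\<lambda>i. (\<Sum>l<j. f l) + i) [0..<f j]) [0..<n]) = [0..<(\<Sum>l<n. f l)]"
proof (induction n)
  case (Suc n)
  have "map (\<lambda>i. s + i) [0..<m] = [s..<s + m]" for s m :: nat
    by (rule nth_equalityI) auto
  moreover have "[0..<s] @ [s..<s + m] = [0..<s + m]" for s m :: nat
    by (rule upt_add_eq_append[symmetric]) simp
  ultimately show ?case
    using Suc by simp
qed simp

lemma vech_vec_coeff_mat:
  "vech (coeff_mat d \<theta> 0) @ vec_stack (hconcat d p (coeff_mat d \<theta>)) = map \<theta> [0..<n_coeffs d p]"
proof -
  let ?m = "d * (d - 1) div 2" and ?q = "p * d * d"
  have col: "map (\<lambda>i. coeff_mat d \<theta> 0 $$ (i, j)) [Suc j..<d]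
      = map (\<lambda>i. \<theta> ((\<Sum>l<j. d - Suc l) + i)) [0..<d - Suc j]" for j
    by (rule nth_equalityI) (auto simp: coeff_mat_def simp del: upt_Suc)
  have "vech (coeff_mat d \<theta> 0)
      = concat (map (\<lambda>j. map (\<lambda>i. \<theta> ((\<Sum>l<j. d - Suc l) + i)) [0..<d - Suc j]) [0..<d])"
    using col by (simp add: vech_def coeff_mat_def)
  also have "\<dots> = map \<theta> [0..<?m]"
    using arg_cong[OF upt_blocks[of "\<lambda>l. d - Suc l" d], of "map \<theta>"]
    by (simp add: map_concat o_def sum_diff_Suc)
  finally have 1: "vech (coeff_mat d \<theta> 0) = map \<theta> [0..<?m]" .
  have "hconcat d p (coeff_mat d \<theta>) $$ (i, c) = \<theta> (?m + (c * d + i))"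
    if "c < p * d" "i < d" for i c
    using that by (simp add: hconcat_def coeff_mat_def add.assoc)
  then have "vec_stack (hconcat d p (coeff_mat d \<theta>))
      = concat (map (\<lambda>c. map (\<lambda>i. \<theta> (?m + (c * d + i))) [0..<d]) [0..<p * d])"
    unfolding vec_stack_def
    by (intro arg_cong[where f = concat] map_cong) (auto simp: hconcat_def)
  also have "\<dots> = map (\<lambda>i. \<theta> (?m + i)) [0..<?q]"
    using arg_cong[OF upt_blocks[of "\<lambda>_. d" "p * d"], of "map (\<lambda>i. \<theta> (?m + i))"]
    by (simp add: map_concat o_def)
  also have "\<dots> = map \<theta> [?m..<?m + ?q]"
    by (rule nth_equalityI) auto
  finally have 2: "vec_stack (hconcat d p (coeff_mat d \<theta>)) = map \<theta> [?m..<?m + ?q]" .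
  have "[0..<?m] @ [?m..<?m + ?q] = [0..<?m + ?q]"
    by (rule upt_add_eq_append[symmetric]) simp
  moreover have "n_coeffs d p = ?m + ?q"
    by (simp only: n_coeffs_def power2_eq_square mult.assoc add.commute)
  ultimately show ?thesis
    unfolding 1 2 by (simp only: flip: map_append)
qed

end

theory Submission
  imports Defs "HOL-Real_Asymp.Real_Asymp" "Jordan_Normal_Form.Spectral_Radius"
begin

text \<open>
  Every full-time DAG is contained in the DAG with all lags up to \<open>p\<close>, which has no unshielded
  collider; so a path not blocked by \<open>B\<close> yields a walk avoiding \<open>B\<close> in the skeleton of the latter.
  For the stationary Gaussian law, conditional independence of \<open>a\<close> and \<open>c\<close> given \<open>B\<close> forces the
  residual covariance of \<open>a\<close> and \<open>c\<close> given \<open>B\<close> to vanish. By Cramer's rule, applied to the Lyapunov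
  equation of the companion form, this covariance is a rational function of the parameters. Its
  numerator does not vanish identically: if all coefficients equal a small \<open>\<delta> > 0\<close>, then the precision
  operator \<open>(I - A)\<^sup>T (I - A)\<close> is an M-matrix whose graph is the skeleton, and the maximum principle
  makes the residual covariance positive whenever a walk avoiding \<open>B\<close> exists. Zero sets of non-zero
  polynomials are null, and there are only countably many triples \<open>(B, a, c)\<close>.
\<close>

section \<open>Polynomial functions and their zero sets\<close>

text \<open>The graph is itself random, since it depends on which sampled coefficients vanish.
  Passing to the skeleton of one fixed supergraph removes this: the exceptional sets are indexed by
  triples that do not mention the parameters, and no case distinction on vanishing coefficients is
  made. The node set is infinite, so the precision operator has no determinant and a bounded
  function need not attain its minimum. The maximum principle is therefore obtained by iterating a
  contraction with factor 1/2, started from a bound on the autocovariances that is uniform in both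
  times. The condition 4 \<delta> (p+1) d \<le> 1 produces this factor, as a node has at most 2
  (p+1) d neighbours. A stationary solution comes without moment assumptions. Its law is found by
  unrolling the recursion and passing to the limit in characteristic functions; stationarity keeps
  the random factors of the far-past remainder from growing. A Gaussian family is likewise described
  by characteristic functions, so moments and orthogonality to events have to be extracted from
  them.\<close>

inductive_set polyfuns :: "(('i \<Rightarrow> real) \<Rightarrow> real) set" where
  polyfuns_const: "(\<lambda>_. c) \<in> polyfuns"
| polyfuns_coord: "(\<lambda>x. x i) \<in> polyfuns"
| polyfuns_add: "f \<in> polyfuns \<Longrightarrow> g \<in> polyfuns \<Longrightarrow> (\<lambda>x. f x + g x) \<in> polyfuns"
| polyfuns_mult: "f \<in> polyfuns \<Longrightarrow> g \<in> polyfuns \<Longrightarrow> (\<lambda>x. f x * g x) \<in> polyfuns"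

lemma polyfuns_minus: "f \<in> polyfuns \<Longrightarrow> (\<lambda>x. - f x) \<in> polyfuns"
  using polyfuns_mult[OF polyfuns_const[of "-1"], of f] by simp

lemma polyfuns_diff: "f \<in> polyfuns \<Longrightarrow> g \<in> polyfuns \<Longrightarrow> (\<lambda>x. f x - g x) \<in> polyfuns"
  using polyfuns_add[OF _ polyfuns_minus, of f g] by simp

lemma polyfuns_sum: "(\<And>i. i \<in> A \<Longrightarrow> f i \<in> polyfuns) \<Longrightarrow> (\<lambda>x. \<Sum>i\<in>A. f i x) \<in> polyfuns"
  by (induction A rule: infinite_finite_induct) (auto intro: polyfuns.intros)

lemma polyfuns_prod: "(\<And>i. i \<in> A \<Longrightarrow> f i \<in> polyfuns) \<Longrightarrow> (\<lambda>x. \<Prod>i\<in>A. f i x) \<in> polyfuns"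
  by (induction A rule: infinite_finite_induct) (auto intro: polyfuns.intros)

lemma polyfuns_det:
  assumes "\<And>i j. i < n \<Longrightarrow> j < n \<Longrightarrow> (\<lambda>x. m x i j) \<in> polyfuns"
  shows "(\<lambda>x. Determinant.det (mat n n (\<lambda>(i, j). m x i j))) \<in> polyfuns"
proof -
  have "Determinant.det (mat n n (\<lambda>(i, j). m x i j))
      = (\<Sum>p\<in>{p. p permutes {0..<n}}. signof p * (\<Prod>i=0..<n. m x i (p i)))" for x
  proof -
    have "p i < n" if "p permutes {0..<n}" "i < n" for p i
      using permutes_in_image[OF that(1), of i] that(2) by simp
    then show ?thesis
      by (auto simp: det_def'[OF mat_carrier] intro!: sum.cong prod.cong arg_cong2[where f = "(*)"])
  qed
  moreover have "(\<lambda>x. \<Sum>p\<in>{p. p permutes {0..<n}}. signof p * (\<Prod>i=0..<n. m x i (p i))) \<in> polyfuns"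
    by (intro polyfuns_sum polyfuns_mult polyfuns_const polyfuns_prod assms)
       (auto dest: permutes_in_image)
  ultimately show ?thesis by simp
qed

lemma polyfuns_adj:
  assumes "\<And>i j. i < n \<Longrightarrow> j < n \<Longrightarrow> (\<lambda>x. m x i j) \<in> polyfuns" and "i < n" "j < n"
  shows "(\<lambda>x. adj_mat (mat n n (\<lambda>(i, j). m x i j)) $$ (i, j)) \<in> polyfuns"
proof -
  have "mat_delete (mat n n (\<lambda>(i, j). m x i j)) j i = mat (n - 1) (n - 1) (\<lambda>(i', j').
      m x (if i' < j then i' else Suc i') (if j' < i then j' else Suc j'))" for x
    unfolding mat_delete_def by (rule eq_matI) auto
  then have "adj_mat (mat n n (\<lambda>(i, j). m x i j)) $$ (i, j)
      = (-1) ^ (j + i) * Determinant.det (mat (n - 1) (n - 1) (\<lambda>(i', j').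
        m x (if i' < j then i' else Suc i') (if j' < i then j' else Suc j')))" for x
    using assms(2,3) by (simp add: adj_mat_def cofactor_def)
  then show ?thesis
    by (simp, intro polyfuns_mult polyfuns_const polyfuns_det assms(1)) (use assms(2,3) in auto)
qed

lemma polyfuns_line: "f \<in> polyfuns \<Longrightarrow> \<exists>p. \<forall>t. f (x(i := t)) = poly p t"
proof (induction rule: polyfuns.induct)
  case (polyfuns_const c)
  show ?case by (rule exI[of _ "[:c:]"]) simp
next
  case (polyfuns_coord j)
  show ?case by (rule exI[of _ "if j = i then [:0, 1:] else [:x j:]"]) simp
next
  case (polyfuns_add f g)
  then show ?case by (metis poly_add)
next
  case (polyfuns_mult f g)
  then show ?case by (metis poly_mult)
qed

lemma polyfuns_measurable:
  assumes "f \<in> polyfuns" and u: "\<And>i. (\<lambda>y. u y i) \<in> borel_measurable M"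
  shows "(\<lambda>y. f (u y)) \<in> borel_measurable M"
  using assms(1) by induction (use u in auto)

text \<open>Fubini, one coordinate at a time: outside finitely many values of the new coordinate
  \<open>f\<close> stays nonzero at the modified base point, to which the induction hypothesis
  applies. Coordinates outside \<open>I\<close> may occur in \<open>f\<close>; they are frozen at
  \<open>\<theta>\<close>, which is therefore generalised in the induction.\<close>

lemma polyfuns_AE_nonzero_override:
  assumes "finite I" "f \<in> polyfuns" "f \<theta> \<noteq> 0"
  shows "AE x in Pi\<^sub>M I (\<lambda>_. lborel). f (override_on \<theta> x I) \<noteq> 0"
  using assms(1,3)
proof (induction I arbitrary: \<theta> rule: finite_induct)
  case empty
  then show ?case by simp
next
  case (insert i I)
  interpret product_sigma_finite "\<lambda>_. lborel :: real measure"
    by standard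
  have meas: "(\<lambda>x. f (override_on \<theta> x J)) \<in> borel_measurable (Pi\<^sub>M J (\<lambda>_. lborel))" for \<theta> J
    using assms(2)
  proof (rule polyfuns_measurable)
    show "(\<lambda>x. override_on \<theta> x J i) \<in> borel_measurable (Pi\<^sub>M J (\<lambda>_. lborel))" for i
      by (cases "i \<in> J") simp_all
  qed
  have nonzero: "AE y in lborel. f (\<theta>(i := y)) \<noteq> 0"
  proof -
    obtain p where p: "\<And>t. f (\<theta>(i := t)) = poly p t"
      using polyfuns_line[OF assms(2)] by metis
    \<comment> \<open>The value of the base point at \<open>i\<close> is not a root.\<close>
    have "p \<noteq> 0"
      using insert.prems p[of "\<theta> i"] by auto
    then have "finite {t. poly p t = 0}"
      by (rule poly_roots_finite)
    then have "{t. poly p t = 0} \<in> null_sets lborel"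
      by (rule finite_imp_null_set_lborel)
    then show ?thesis
      by (rule AE_I') (auto simp: p)
  qed
  let ?Z = "\<lambda>x. f (override_on \<theta> x (insert i I)) = 0"
  have Z: "{x \<in> space (Pi\<^sub>M (insert i I) (\<lambda>_. lborel)). ?Z x} \<in> sets (Pi\<^sub>M (insert i I) (\<lambda>_. lborel))"
    by (rule borel_measurable_eq[OF meas]) simp
  have slice: "(\<integral>\<^sup>+x. indicator {x \<in> space (Pi\<^sub>M (insert i I) (\<lambda>_. lborel)). ?Z x} (x(i := y))
      \<partial>Pi\<^sub>M I (\<lambda>_. lborel)) = 0" if y: "f (\<theta>(i := y)) \<noteq> 0" for y
  proof -
    have "AE x in Pi\<^sub>M I (\<lambda>_. lborel). f (override_on (\<theta>(i := y)) x I) \<noteq> 0"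
      using insert.IH[OF y] .
    \<comment> \<open>Since \<open>i\<close> is not in \<open>I\<close>, the value \<open>y\<close>
      may be moved from the integration variable to the base point.\<close>
    moreover have "override_on \<theta> (x(i := y)) (insert i I) = override_on (\<theta>(i := y)) x I" for x
      using insert.hyps by (auto simp: override_on_def fun_eq_iff)
    ultimately have "AE x in Pi\<^sub>M I (\<lambda>_. lborel).
        (indicator {x \<in> space (Pi\<^sub>M (insert i I) (\<lambda>_. lborel)). ?Z x} (x(i := y)) :: ennreal) = 0"
      by (auto elim!: eventually_mono)
    then show ?thesis
      by (subst nn_integral_cong_AE) auto
  qed
  have "emeasure (Pi\<^sub>M (insert i I) (\<lambda>_. lborel)) {x \<in> space (Pi\<^sub>M (insert i I) (\<lambda>_. lborel)). ?Z x}
      = (\<integral>\<^sup>+y. (\<integral>\<^sup>+x. indicator {x \<in> space (Pi\<^sub>M (insert i I) (\<lambda>_. lborel)). ?Z x} (x(i := y))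
          \<partial>Pi\<^sub>M I (\<lambda>_. lborel)) \<partial>lborel)"
    using insert.hyps Z
    by (subst product_nn_integral_insert_rev[symmetric]) (auto simp: nn_integral_indicator)
  also have "\<dots> = (\<integral>\<^sup>+y. 0 \<partial>(lborel :: real measure))"
    by (rule nn_integral_cong_AE) (use nonzero slice in \<open>auto elim!: eventually_mono\<close>)
  finally have "{x \<in> space (Pi\<^sub>M (insert i I) (\<lambda>_. lborel)). ?Z x} \<in> null_sets (Pi\<^sub>M (insert i I) (\<lambda>_. lborel))"
    using Z by (auto intro: null_setsI)
  then show ?case
    by (rule AE_I') auto
qed

lemma polyfuns_AE_nonzero:
  assumes "finite I" "f \<in> polyfuns" "f \<theta> \<noteq> 0" "\<theta> \<in> extensional I"
  shows "AE x in Pi\<^sub>M I (\<lambda>_. lborel). f x \<noteq> 0"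
proof -
  have "override_on \<theta> x I = x" if "x \<in> space (Pi\<^sub>M I (\<lambda>_. lborel))" for x
    using that assms(4)
    by (auto simp: space_PiM PiE_def extensional_def override_on_def fun_eq_iff)
  with polyfuns_AE_nonzero_override[OF assms(1-3)] show ?thesis
    by (subst (asm) AE_cong) auto
qed

text \<open>Cramer's rule, with \<open>D\<close> the determinant and \<open>N\<close> the adjugate
  applied to the right-hand side, both chosen before a parameter is fixed. The clauses serve two
  uses: identifying a solution that is known to exist (state covariances) and producing one as
  \<open>N / D\<close> (regression coefficients). The last clause gives
  \<open>D \<theta> \<noteq> 0\<close> from a trivial kernel.\<close>

lemma linear_system_polyfuns:
  fixes m :: "('i \<Rightarrow> real) \<Rightarrow> 'j \<Rightarrow> 'j \<Rightarrow> real"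
  assumes J: "finite J"
    and m: "\<And>i j. i \<in> J \<Longrightarrow> j \<in> J \<Longrightarrow> (\<lambda>\<theta>. m \<theta> i j) \<in> polyfuns"
    and q: "\<And>i. i \<in> J \<Longrightarrow> (\<lambda>\<theta>. q \<theta> i) \<in> polyfuns"
  shows "\<exists>D N. D \<in> polyfuns \<and> (\<forall>j\<in>J. N j \<in> polyfuns)
    \<and> (\<forall>\<theta> y. (\<forall>i\<in>J. (\<Sum>j\<in>J. m \<theta> i j * y j) = q \<theta> i) \<longrightarrow> (\<forall>j\<in>J. D \<theta> * y j = N j \<theta>))
    \<and> (\<forall>\<theta>. \<forall>i\<in>J. (\<Sum>j\<in>J. m \<theta> i j * N j \<theta>) = D \<theta> * q \<theta> i)
    \<and> (\<forall>\<theta>. (\<forall>y. (\<forall>i\<in>J. (\<Sum>j\<in>J. m \<theta> i j * y j) = 0) \<longrightarrow> (\<forall>j\<in>J. y j = 0)) \<longrightarrow> D \<theta> \<noteq> 0)"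
proof -
  define n where "n = card J"
  \<comment> \<open>Matrices are indexed by initial segments; \<open>e\<close> numbers the unknowns
    and \<open>r\<close> below undoes this.\<close>
  obtain e where e: "bij_betw e {0..<n} J"
    using ex_bij_betw_nat_finite[OF J] by (auto simp: n_def)
  define A where "A \<theta> = mat n n (\<lambda>(i, j). m \<theta> (e i) (e j))" for \<theta>
  define D where "D \<theta> = Determinant.det (A \<theta>)" for \<theta>
  define adj where "adj \<theta> i j = adj_mat (A \<theta>) $$ (i, j)" for \<theta> i j
  define r where "r = inv_into {0..<n} e"
  define N where "N j \<theta> = (\<Sum>i=0..<n. adj \<theta> (r j) i * q \<theta> (e i))" for j \<theta>
  have A: "A \<theta> \<in> carrier_mat n n" for \<theta>
    by (simp add: A_def)
  have e_in: "e i \<in> J" if "i < n" for i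
    using e that by (auto simp: bij_betw_def)
  have r: "r j < n" "e (r j) = j" if "j \<in> J" for j
    using e that inv_into_into[of j e "{0..<n}"] f_inv_into_f[of j e "{0..<n}"]
    by (auto simp: bij_betw_def r_def)
  have re: "r (e i) = i" if "i < n" for i
    using e that by (auto simp: bij_betw_def r_def)
  have sum_J: "(\<Sum>j\<in>J. f j) = (\<Sum>i=0..<n. f (e i))" for f :: "'j \<Rightarrow> real"
    using sum.reindex_bij_betw[OF e] by metis
  have entry: "(\<Sum>k=0..<n. A \<theta> $$ (i, k) * adj \<theta> k j) = (if i = j then D \<theta> else 0)"
    if "i < n" "j < n" for \<theta> i j
    using arg_cong[OF adj_mat(2)[OF A[of \<theta>]], of "\<lambda>B. B $$ (i, j)"] that A[of \<theta>] adj_mat(1)[OF A[of \<theta>]]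
    by (auto simp: scalar_prod_def adj_def D_def)
  have entry': "(\<Sum>k=0..<n. adj \<theta> i k * A \<theta> $$ (k, j)) = (if i = j then D \<theta> else 0)"
    if "i < n" "j < n" for \<theta> i j
    using arg_cong[OF adj_mat(3)[OF A[of \<theta>]], of "\<lambda>B. B $$ (i, j)"] that A[of \<theta>] adj_mat(1)[OF A[of \<theta>]]
    by (auto simp: scalar_prod_def adj_def D_def)
  have adj_poly: "(\<lambda>\<theta>. adj \<theta> i j) \<in> polyfuns" if "i < n" "j < n" for i j
    unfolding adj_def A_def using that by (intro polyfuns_adj m e_in)
  have 1: "D \<in> polyfuns"
    unfolding D_def A_def by (intro polyfuns_det m e_in)
  have 2: "N j \<in> polyfuns" if "j \<in> J" for j
    unfolding N_def by (intro polyfuns_sum polyfuns_mult adj_poly q e_in r that) auto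
  have 3: "D \<theta> * y j = N j \<theta>"
    if y: "\<And>i. i \<in> J \<Longrightarrow> (\<Sum>j\<in>J. m \<theta> i j * y j) = q \<theta> i" and j: "j \<in> J" for \<theta> y j
  proof -
    have "N j \<theta> = (\<Sum>i=0..<n. adj \<theta> (r j) i * (\<Sum>k=0..<n. m \<theta> (e i) (e k) * y (e k)))"
      unfolding N_def by (intro sum.cong refl arg_cong2[where f = "(*)"]) (simp add: y[symmetric] e_in sum_J)
    also have "\<dots> = (\<Sum>k=0..<n. (\<Sum>i=0..<n. adj \<theta> (r j) i * A \<theta> $$ (i, k)) * y (e k))"
      unfolding sum_distrib_left sum_distrib_right
      by (subst sum.swap) (auto intro!: sum.cong simp: A_def)
    also have "\<dots> = (\<Sum>k=0..<n. if r j = k then D \<theta> * y (e k) else 0)"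
      by (intro sum.cong refl) (simp add: entry' r j)
    also have "\<dots> = D \<theta> * y j"
      using r[OF j] by simp
    finally show ?thesis by simp
  qed
  have 4: "(\<Sum>j\<in>J. m \<theta> i j * N j \<theta>) = D \<theta> * q \<theta> i" if i: "i \<in> J" for \<theta> i
  proof -
    have "(\<Sum>j\<in>J. m \<theta> i j * N j \<theta>) = (\<Sum>k=0..<n. m \<theta> i (e k) * (\<Sum>l=0..<n. adj \<theta> k l * q \<theta> (e l)))"
      unfolding sum_J N_def by (intro sum.cong refl) (simp add: re)
    also have "\<dots> = (\<Sum>l=0..<n. (\<Sum>k=0..<n. A \<theta> $$ (r i, k) * adj \<theta> k l) * q \<theta> (e l))"
      unfolding sum_distrib_left sum_distrib_right
      by (subst sum.swap) (auto intro!: sum.cong simp: A_def r i)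
    also have "\<dots> = (\<Sum>l=0..<n. if r i = l then D \<theta> * q \<theta> (e l) else 0)"
      by (intro sum.cong refl) (simp add: entry r i)
    also have "\<dots> = D \<theta> * q \<theta> i"
      using r[OF i] by simp
    finally show ?thesis .
  qed
  have 5: "D \<theta> \<noteq> 0"
    if inj: "\<And>y. (\<And>i. i \<in> J \<Longrightarrow> (\<Sum>j\<in>J. m \<theta> i j * y j) = 0) \<Longrightarrow> \<forall>j\<in>J. y j = 0" for \<theta>
  proof
    assume "D \<theta> = 0"
    then obtain v where v: "v \<in> carrier_vec n" "v \<noteq> 0\<^sub>v n" "A \<theta> *\<^sub>v v = 0\<^sub>v n"
      using det_0_iff_vec_prod_zero[OF A] unfolding D_def by blast
    have "(\<Sum>j\<in>J. m \<theta> i j * (vec_index v (r j))) = 0" if i: "i \<in> J" for i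
    proof -
      have "(\<Sum>j\<in>J. m \<theta> i j * (vec_index v (r j))) = (\<Sum>k=0..<n. m \<theta> i (e k) * (vec_index v k))"
        unfolding sum_J by (intro sum.cong refl) (simp add: re)
      also have "\<dots> = vec_index (A \<theta> *\<^sub>v v) (r i)"
        using v(1) r[OF i] by (auto simp: scalar_prod_def A_def intro!: sum.cong)
      finally show ?thesis
        using v(3) r[OF i] by simp
    qed
    then have "\<forall>j\<in>J. vec_index v (r j) = 0"
      by (rule inj)
    then have "v = 0\<^sub>v n"
      using v(1) e_in re by (intro eq_vecI) force+
    with v(2) show False by simp
  qed
  show ?thesis
  proof (intro exI[of _ D] exI[of _ N] conjI ballI allI impI)
    fix \<theta>
    assume "\<forall>y. (\<forall>i\<in>J. (\<Sum>j\<in>J. m \<theta> i j * y j) = 0) \<longrightarrow> (\<forall>j\<in>J. y j = 0)"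
    then show "D \<theta> \<noteq> 0" by (intro 5) simp
  qed (simp_all add: 1 2 3 4)
qed


section \<open>Skeletons without unshielded colliders\<close>

definition adjacent :: "('v \<times> 'v) set \<Rightarrow> 'v \<Rightarrow> 'v \<Rightarrow> bool" where
  "adjacent E u v \<longleftrightarrow> (u, v) \<in> E \<or> (v, u) \<in> E"

text \<open>Inner non-colliders of an unblocked path lie outside \<open>B\<close>, and colliders can
  be cut out: the two path neighbours of a collider share a child, hence are adjacent in
  \<open>E0\<close>, and consecutive vertices are never both colliders. Colliders are those of the
  path in \<open>E\<close>, adjacency is taken in \<open>E0\<close>.\<close>

lemma unblocked_path_imp_skeleton_walk:
  assumes sub: "E \<subseteq> E0"
    and asym: "\<And>u v. (u, v) \<in> E0 \<Longrightarrow> (v, u) \<notin> E0"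
    and shielded: "\<And>u v w. (u, w) \<in> E0 \<Longrightarrow> (v, w) \<in> E0 \<Longrightarrow> u \<noteq> v \<Longrightarrow> adjacent E0 u v"
    and path: "path_between E a vs c" and unblocked: "\<not> blocked E B vs"
    and ends: "a \<notin> B" "c \<notin> B"
  shows "(\<lambda>u v. adjacent E0 u v \<and> v \<notin> B)\<^sup>*\<^sup>* a c"
proof -
  let ?n = "length vs"
  have vs: "vs \<noteq> []" "vs ! 0 = a" "vs ! (?n - 1) = c" "distinct vs"
    and edge: "\<And>i. Suc i < ?n \<Longrightarrow> adjacent E (vs ! i) (vs ! Suc i)"
    using path by (auto simp: path_between_def adjacent_def hd_conv_nth last_conv_nth)
  have collider_edges: "(vs ! i, vs ! Suc i) \<in> E0" "(vs ! Suc (Suc i), vs ! Suc i) \<in> E0"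
    if "collider_at E vs (Suc i)" for i
    using that sub by (auto simp: collider_at_def)
  \<comment> \<open>Strong induction over the positions that survive the shortcuts, namely endpoints
    and non-colliders.\<close>
  have walk: "(\<lambda>u v. adjacent E0 u v \<and> v \<notin> B)\<^sup>*\<^sup>* a (vs ! i)"
    if "i < ?n" "i = 0 \<or> Suc i = ?n \<or> \<not> collider_at E vs i" for i
    using that
  proof (induction i rule: less_induct)
    case (less i)
    show ?case
    proof (cases i)
      case 0
      then show ?thesis using vs by simp
    next
      case (Suc j)
      have notB: "vs ! i \<notin> B"
      proof (cases "Suc i = ?n")
        case True
        then have "vs ! i = c" using vs(3) by (metis diff_Suc_1)
        then show ?thesis using ends by simp
      next
        case False
        then show ?thesis
          using less.prems Suc unblocked unfolding blocked_def by (metis Suc_lessI zero_less_Suc nat.simps(3))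
      qed
      show ?thesis
      proof (cases "j = 0 \<or> \<not> collider_at E vs j")
        case True
        then have "(\<lambda>u v. adjacent E0 u v \<and> v \<notin> B)\<^sup>*\<^sup>* a (vs ! j)"
          using less.IH[of j] less.prems Suc by auto
        moreover have "adjacent E0 (vs ! j) (vs ! i)"
          using edge[of j] less.prems Suc sub by (auto simp: adjacent_def)
        ultimately show ?thesis
          using notB by (metis (mono_tags, lifting) rtranclp.rtrancl_into_rtrancl)
      next
        case False
        then obtain k where k: "j = Suc k" "collider_at E vs (Suc k)"
          by (cases j) auto
        \<comment> \<open>The edge between positions \<open>k\<close> and \<open>Suc k\<close>
          points forward, so by asymmetry \<open>k\<close> is no collider and the induction
          hypothesis applies two positions back.\<close>
        have "k = 0 \<or> \<not> collider_at E vs k"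
          using collider_edges(1)[OF k(2)] collider_edges(2)[of "k - 1"] asym
          by (cases k) auto
        then have "(\<lambda>u v. adjacent E0 u v \<and> v \<notin> B)\<^sup>*\<^sup>* a (vs ! k)"
          using less.IH[of k] less.prems Suc k(1) by auto
        moreover have "vs ! k \<noteq> vs ! i"
          using vs(4) less.prems Suc k(1) by (auto simp: nth_eq_iff_index_eq)
        then have "adjacent E0 (vs ! k) (vs ! i)"
          using shielded[OF collider_edges[OF k(2)]] Suc k(1) by simp
        ultimately show ?thesis
          using notB by (metis (mono_tags, lifting) rtranclp.rtrancl_into_rtrancl)
      qed
    qed
  qed
  show ?thesis
    using walk[of "?n - 1"] vs by simp
qed

section \<open>The supergraph with all admissible edges\<close>

definition lag_edges :: "nat \<Rightarrow> nat \<Rightarrow> ((nat \<times> int) \<times> (nat \<times> int)) set" where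
  "lag_edges d p = {((j, t - int k), (i, t)) | i j k t. i < d \<and> j < d \<and> k \<le> p \<and> (k = 0 \<longrightarrow> j < i)}"

lemma lag_edges_asym: "(u, v) \<in> lag_edges d p \<Longrightarrow> (v, u) \<notin> lag_edges d p"
  by (auto simp: lag_edges_def)

text \<open>The parents of a node lie in a window of p + 1 consecutive times, and any two nodes of
  such a window are joined: the edge points to the later one or, at equal times, to the larger
  component.\<close>

lemma lag_edges_shielded:
  assumes "(u, w) \<in> lag_edges d p" "(v, w) \<in> lag_edges d p" "u \<noteq> v"
  shows "adjacent (lag_edges d p) u v"
proof -
  have *: "((j, t - int k), (j', t - int k')) \<in> lag_edges d p"
    if "j < d" "j' < d" "k \<le> p" "k' < k \<or> k' = k \<and> j < j'" for j j' k k' and t :: int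
    unfolding lag_edges_def mem_Collect_eq
    by (intro exI[of _ j'] exI[of _ j] exI[of _ "k - k'"] exI[of _ "t - int k'"])
      (use that in auto)
  obtain i j k j' k' t where w: "w = (i, t)" and u: "u = (j, t - int k)" "j < d" "k \<le> p"
    and v: "v = (j', t - int k')" "j' < d" "k' \<le> p"
    using assms(1,2) by (auto simp: lag_edges_def)
  then have "(k' < k \<or> k' = k \<and> j < j') \<or> (k < k' \<or> k = k' \<and> j' < j)"
    using assms(3) by auto
  then show ?thesis
    using *[of j j' k k' t] *[of j' j k' k t] u v by (auto simp: adjacent_def)
qed

lemma full_time_edges_subset_lag_edges:
  "full_time_edges d p (coeff_mat d \<theta>) \<subseteq> lag_edges d p"
proof -
  have "j < i" if "i < d" "j < d" "coeff_mat d \<theta> 0 $$ (i, j) \<noteq> 0" for i j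
    using that by (auto simp: coeff_mat_def split: if_splits)
  then show ?thesis
    unfolding full_time_edges_def lag_edges_def by blast
qed


section \<open>Gaussian families and conditional independence\<close>

lemma Euler_scaleR:
  "a *\<^sub>R iexp y = complex_of_real (a * cos y) + \<i> * complex_of_real (a * sin y)" for a y :: real
  by (simp add: exp_Euler scaleR_conv_of_real algebra_simps flip: cos_of_real sin_of_real)

lemma integral_Euler:
  fixes u v :: "'a \<Rightarrow> real"
  assumes "integrable M u" "integrable M v"
  shows "(\<integral>x. complex_of_real (u x) + \<i> * complex_of_real (v x) \<partial>M)
    = complex_of_real (\<integral>x. u x \<partial>M) + \<i> * complex_of_real (\<integral>x. v x \<partial>M)"
  using assms by (subst Bochner_Integration.integral_add) auto

lemma integrable_mult_bounded:
  fixes f g :: "'a \<Rightarrow> real"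
  assumes "integrable M f" "g \<in> borel_measurable M" "\<And>x. \<bar>g x\<bar> \<le> 1"
  shows "integrable M (\<lambda>x. f x * g x)"
  using assms by (intro Bochner_Integration.integrable_bound[OF assms(1)])
    (auto simp: abs_mult intro!: AE_I2 mult_left_le)

text \<open>Levy's uniqueness theorem for a weight of changing sign: the positive and negative parts
  of \<open>W\<close> have equal mass (the case \<open>r = 0\<close> of the cosine condition), and
  after normalisation their images under \<open>X\<close> are probability measures with the same
  characteristic function.\<close>

lemma signed_char_unique:
  fixes W X :: "'a \<Rightarrow> real"
  assumes W: "integrable M W" and X[measurable]: "X \<in> borel_measurable M"
    and cos0: "\<And>r. (\<integral>x. W x * cos (r * X x) \<partial>M) = 0"
    and sin0: "\<And>r. (\<integral>x. W x * sin (r * X x) \<partial>M) = 0"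
    and G[measurable]: "G \<in> sets borel"
  shows "(\<integral>x. W x * indicator G (X x) \<partial>M) = 0"
proof -
  define Wp Wn where "Wp x = max 0 (W x)" and "Wn x = max 0 (- W x)" for x
  have W_eq: "W x = Wp x - Wn x" for x
    by (auto simp: Wp_def Wn_def)
  have [measurable]: "W \<in> borel_measurable M"
    using W by auto
  have int: "integrable M Wp" "integrable M Wn"
    unfolding Wp_def Wn_def using W by auto
  have nonneg: "0 \<le> Wp x" "0 \<le> Wn x" for x
    by (auto simp: Wp_def Wn_def)
  define m where "m = (\<integral>x. Wp x \<partial>M)"
  have "(\<integral>x. W x \<partial>M) = 0"
    using cos0[of 0] by simp
  then have m': "(\<integral>x. Wn x \<partial>M) = m"
    using int by (simp add: W_eq m_def)
  have "0 \<le> m"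
    unfolding m_def using nonneg by simp
  show ?thesis
  \<comment> \<open>Normalisation divides by \<open>m\<close>; if the mass vanishes, so does
    \<open>W\<close> almost everywhere.\<close>
  proof (cases "m = 0")
    case True
    then have "AE x in M. Wp x = 0" "AE x in M. Wn x = 0"
      using integral_nonneg_eq_0_iff_AE[OF int(1)] integral_nonneg_eq_0_iff_AE[OF int(2)] nonneg m'
      by (auto simp: m_def)
    then have "AE x in M. W x * indicator G (X x) = 0"
      by eventually_elim (simp add: W_eq)
    then show ?thesis
      by (rule integral_eq_zero_AE)
  next
    case False
    then have m: "0 < m" using \<open>0 \<le> m\<close> by simp
    define N where "N f = distr (density M (\<lambda>x. ennreal (f x / m))) borel X" for f :: "'a \<Rightarrow> real"
    have N_int: "(\<integral>y. k y \<partial>N f) = (\<integral>x. (f x / m) *\<^sub>R k (X x) \<partial>M)"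
      if "integrable M f" "\<And>x. 0 \<le> f x" "k \<in> borel_measurable borel"
      for f and k :: "real \<Rightarrow> 'b :: {banach, second_countable_topology}"
    proof -
      have [measurable]: "f \<in> borel_measurable M" using that by auto
      show ?thesis
        unfolding N_def using that m
        by (subst integral_distr) (auto simp: integral_density)
    qed
    have N_dist: "real_distribution (N f)"
      if "integrable M f" "\<And>x. 0 \<le> f x" "(\<integral>x. f x \<partial>M) = m" for f
    proof -
      have [measurable]: "f \<in> borel_measurable M" using that by auto
      have "(\<integral>\<^sup>+x. ennreal (f x / m) \<partial>M) = ennreal (\<integral>x. f x / m \<partial>M)"
        using that m by (intro nn_integral_eq_integral) auto
      then have "emeasure (density M (\<lambda>x. ennreal (f x / m))) (space M) = 1"
        using that m by (simp add: emeasure_density cong: nn_integral_cong)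
      then have "prob_space (density M (\<lambda>x. ennreal (f x / m)))"
        by (intro prob_spaceI) simp
      then have "prob_space (N f)"
        unfolding N_def by (rule prob_space.prob_space_distr) simp
      then show ?thesis
        by (auto simp: real_distribution_def real_distribution_axioms_def N_def)
    qed
    have char_N: "char (N f) t = complex_of_real (\<integral>x. f x / m * cos (t * X x) \<partial>M)
        + \<i> * complex_of_real (\<integral>x. f x / m * sin (t * X x) \<partial>M)"
      if f: "integrable M f" "\<And>x. 0 \<le> f x" for f t
    proof -
      have int: "integrable M (\<lambda>x. f x / m * cos (t * X x))" "integrable M (\<lambda>x. f x / m * sin (t * X x))"
        using f by (auto intro!: integrable_mult_bounded)
      have "char (N f) t = (\<integral>x. (f x / m) *\<^sub>R iexp (t * X x) \<partial>M)"
        unfolding char_def using f by (subst N_int) auto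
      then show ?thesis
        by (simp only: Euler_scaleR integral_Euler[OF int])
    qed
    have "char (N Wp) t = char (N Wn) t" for t
    proof -
      have "(\<integral>x. Wp x / m * g (t * X x) \<partial>M) - (\<integral>x. Wn x / m * g (t * X x) \<partial>M)
          = (\<integral>x. W x * g (t * X x) \<partial>M) / m" if "g = cos \<or> g = sin" for g :: "real \<Rightarrow> real"
      proof -
        have "integrable M (\<lambda>x. f x / m * g (t * X x))" if "integrable M f" for f
          using that \<open>g = cos \<or> g = sin\<close> by (auto intro!: integrable_mult_bounded)
        then have "(\<integral>x. Wp x / m * g (t * X x) \<partial>M) - (\<integral>x. Wn x / m * g (t * X x) \<partial>M)
            = (\<integral>x. Wp x / m * g (t * X x) - Wn x / m * g (t * X x) \<partial>M)"
          using int by simp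
        also have "\<dots> = (\<integral>x. W x * g (t * X x) / m \<partial>M)"
          by (intro Bochner_Integration.integral_cong refl) (simp add: W_eq field_simps diff_divide_distrib)
        finally show ?thesis by simp
      qed
      from this[of cos] this[of sin] show ?thesis
        using int nonneg m by (auto simp: char_N cos0 sin0)
    qed
    then have "N Wp = N Wn"
      using int nonneg m' by (intro Levy_uniqueness N_dist) (auto simp: m_def)
    then have "(\<integral>y. indicator G y \<partial>N Wp) = (\<integral>y. indicator G y \<partial>N Wn :: real)"
      by simp
    then have "(\<integral>x. Wp x / m * indicator G (X x) \<partial>M) = (\<integral>x. Wn x / m * indicator G (X x) \<partial>M)"
      using N_int[OF int(1) nonneg(1), of "indicator G :: real \<Rightarrow> real"]
        N_int[OF int(2) nonneg(2), of "indicator G :: real \<Rightarrow> real"] by simp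
    moreover have "integrable M (\<lambda>x. f x / m * indicator G (X x))" if "integrable M f" for f
      using that by (intro integrable_mult_bounded) (auto simp: indicator_def)
    ultimately have "(\<integral>x. (Wp x / m * indicator G (X x) - Wn x / m * indicator G (X x)) \<partial>M) = 0"
      using int by simp
    moreover have "Wp x / m * indicator G (X x) - Wn x / m * indicator G (X x) = W x * indicator G (X x) / m" for x
      by (simp add: W_eq diff_divide_distrib left_diff_distrib)
    ultimately show ?thesis
      using m by simp
  qed
qed

text \<open>Induction on the coordinates. The indicator of one coordinate is absorbed into the
  weight, which is why weights of changing sign are needed. The product-to-sum formula splits off a
  coordinate from the cosine, and the free phase \<open>\<phi>\<close> covers the sines.\<close>

lemma signed_char_unique_rect:
  fixes X :: "'b \<Rightarrow> 'a \<Rightarrow> real"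
  assumes "finite B" "\<And>b. b \<in> B \<Longrightarrow> X b \<in> borel_measurable M"
    and "\<And>b. b \<in> B \<Longrightarrow> G b \<in> sets borel"
    and "integrable M Z"
    and "\<And>s \<phi>. (\<integral>x. Z x * cos ((\<Sum>b\<in>B. s b * X b x) + \<phi>) \<partial>M) = 0"
  shows "(\<integral>x. Z x * (\<Prod>b\<in>B. indicator (G b) (X b x)) \<partial>M) = 0"
  using assms
proof (induction B arbitrary: Z rule: finite_induct)
  case empty
  then show ?case using empty(4)[of _ 0] by simp
next
  case (insert b B)
  have [measurable]: "X b \<in> borel_measurable M" "\<And>b'. b' \<in> B \<Longrightarrow> X b' \<in> borel_measurable M"
    "G b \<in> sets borel"
    using insert.prems by auto
  have [measurable]: "Z \<in> borel_measurable M"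
    using insert.prems by auto
  note bdd = integrable_mult_bounded[OF insert.prems(3)]
  have int: "integrable M (\<lambda>x. Z x * cos ((\<Sum>b\<in>insert b B. s b * X b x) + \<phi>))" for s \<phi>
    using insert.hyps by (intro bdd) auto
  \<comment> \<open>Sum and difference of the two arguments are again of the assumed form, with
    coefficient \<open>r\<close> or \<open>- r\<close> at \<open>b\<close>.\<close>
  have zero: "(\<integral>x. Z x * (cos ((\<Sum>b\<in>B. s b * X b x) + \<phi> + (r * X b x + \<psi>))
      + cos ((\<Sum>b\<in>B. s b * X b x) + \<phi> - (r * X b x + \<psi>))) \<partial>M) = 0" for s \<phi> r \<psi>
  proof -
    have *: "(\<Sum>b'\<in>insert b B. (s(b := r)) b' * X b' x) = (\<Sum>b\<in>B. s b * X b x) + r * X b x" for r x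
      using insert.hyps by (auto intro!: sum.cong)
    have "(\<Sum>b\<in>B. s b * X b x) + \<phi> + (r * X b x + \<psi>)
        = (\<Sum>b'\<in>insert b B. (s(b := r)) b' * X b' x) + (\<phi> + \<psi>)"
      "(\<Sum>b\<in>B. s b * X b x) + \<phi> - (r * X b x + \<psi>)
        = (\<Sum>b'\<in>insert b B. (s(b := - r)) b' * X b' x) + (\<phi> - \<psi>)" for x
      unfolding * by simp_all
    then show ?thesis
      using int[of "s(b := r)" "\<phi> + \<psi>"] int[of "s(b := - r)" "\<phi> - \<psi>"]
        insert.prems(4)[of "s(b := r)" "\<phi> + \<psi>"] insert.prems(4)[of "s(b := - r)" "\<phi> - \<psi>"]
      by (simp only: distrib_left Bochner_Integration.integral_add)
  qed
  have half: "(\<integral>x. Z x * cos ((\<Sum>b\<in>B. s b * X b x) + \<phi>) * cos (r * X b x + \<psi>) \<partial>M) = 0" for s \<phi> r \<psi>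
  proof -
    have "Z x * cos ((\<Sum>b\<in>B. s b * X b x) + \<phi>) * cos (r * X b x + \<psi>)
      = Z x * (cos ((\<Sum>b\<in>B. s b * X b x) + \<phi> + (r * X b x + \<psi>))
      + cos ((\<Sum>b\<in>B. s b * X b x) + \<phi> - (r * X b x + \<psi>))) / 2" for x
      by (simp add: cos_add[of "(\<Sum>b\<in>B. s b * X b x) + \<phi>"] cos_diff[of "(\<Sum>b\<in>B. s b * X b x) + \<phi>"])
    then show ?thesis
      by (simp only: integral_divide_zero zero div_0)
  qed
  define Z' where "Z' x = Z x * indicator (G b) (X b x)" for x
  have "(\<integral>x. Z' x * (\<Prod>b\<in>B. indicator (G b) (X b x)) \<partial>M) = 0"
  proof (rule insert.IH)
    show "integrable M Z'"
      unfolding Z'_def by (rule bdd) (auto simp: indicator_def)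
    show "(\<integral>x. Z' x * cos ((\<Sum>b\<in>B. s b * X b x) + \<phi>) \<partial>M) = 0" for s \<phi>
    proof -
      \<comment> \<open>The phase -\<pi>/2 turns the cosine identity \<open>half\<close> into the
        sine identity.\<close>
      have sin_cos: "cos (y + - (pi / 2)) = sin y" for y :: real
        by (simp add: cos_diff)
      have "(\<integral>x. (Z x * cos ((\<Sum>b\<in>B. s b * X b x) + \<phi>)) * indicator (G b) (X b x) \<partial>M) = 0"
      proof (rule signed_char_unique)
        show "integrable M (\<lambda>x. Z x * cos ((\<Sum>b\<in>B. s b * X b x) + \<phi>))"
          by (rule bdd) auto
        show "(\<integral>x. Z x * cos ((\<Sum>b\<in>B. s b * X b x) + \<phi>) * cos (r * X b x) \<partial>M) = 0" for r
          using half[of s \<phi> r 0] by simp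
        show "(\<integral>x. Z x * cos ((\<Sum>b\<in>B. s b * X b x) + \<phi>) * sin (r * X b x) \<partial>M) = 0" for r
          using half[of s \<phi> r "- (pi / 2)"] by (simp only: sin_cos)
      qed auto
      then show ?thesis
        by (simp add: Z'_def mult_ac)
    qed
  qed (use insert.prems in auto)
  then show ?case
    using insert.hyps by (simp add: Z'_def mult_ac)
qed

text \<open>Rectangles are an intersection-stable generator, so the finite image measures of the
  positive and negative parts of \<open>Z\<close> coincide once they agree on rectangles.\<close>

lemma signed_char_unique_PiM:
  fixes X :: "'b \<Rightarrow> 'a \<Rightarrow> real"
  assumes B: "finite B" and X: "\<And>b. b \<in> B \<Longrightarrow> X b \<in> borel_measurable M"
    and Z: "integrable M Z"
    and char0: "\<And>s \<phi>. (\<integral>x. Z x * cos ((\<Sum>b\<in>B. s b * X b x) + \<phi>) \<partial>M) = 0"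
    and F: "F \<in> sets (Pi\<^sub>M B (\<lambda>_. borel))"
  shows "(\<integral>x. Z x * indicator F (\<lambda>b\<in>B. X b x) \<partial>M) = 0"
proof -
  let ?X = "\<lambda>x. \<lambda>b\<in>B. X b x"
  have X': "?X \<in> measurable M (Pi\<^sub>M B (\<lambda>_. borel))"
    using X by (intro measurable_restrict)
  have [measurable]: "Z \<in> borel_measurable M"
    using Z by auto
  define N where "N f = distr (density M (\<lambda>x. ennreal (f x))) (Pi\<^sub>M B (\<lambda>_. borel)) ?X" for f :: "'a \<Rightarrow> real"
  have emeasure_N: "emeasure (N f) F = ennreal (\<integral>x. f x * indicator F (?X x) \<partial>M)"
    and int_N: "integrable M (\<lambda>x. f x * indicator F (?X x))"
    if f: "integrable M f" "\<And>x. 0 \<le> f x" and F[measurable]: "F \<in> sets (Pi\<^sub>M B (\<lambda>_. borel))" for f F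
  proof -
    have [measurable]: "f \<in> borel_measurable M" using f by auto
    have ind: "(\<lambda>x. indicator F (?X x) :: real) \<in> borel_measurable M"
      using measurable_compose[OF X' borel_measurable_indicator[OF F]] .
    show int: "integrable M (\<lambda>x. f x * indicator F (?X x))"
      using f ind by (intro Bochner_Integration.integrable_bound[OF f(1)]) (auto simp: indicator_def)
    have "emeasure (N f) F = (\<integral>\<^sup>+x. ennreal (f x) * indicator (?X -` F \<inter> space M) x \<partial>M)"
      unfolding N_def using X' F
      by (subst emeasure_distr) (auto simp: emeasure_density measurable_sets)
    also have "\<dots> = (\<integral>\<^sup>+x. ennreal (f x * indicator F (?X x)) \<partial>M)"
      by (intro nn_integral_cong) (auto simp: indicator_def)
    also have "\<dots> = ennreal (\<integral>x. f x * indicator F (?X x) \<partial>M)"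
      using f int by (intro nn_integral_eq_integral) auto
    finally show "emeasure (N f) F = ennreal (\<integral>x. f x * indicator F (?X x) \<partial>M)" .
  qed
  define Zp Zn where "Zp x = max 0 (Z x)" and "Zn x = max 0 (- Z x)" for x
  have Z_eq: "Z x = Zp x - Zn x" for x
    by (auto simp: Zp_def Zn_def)
  have int: "integrable M Zp" "integrable M Zn"
    unfolding Zp_def Zn_def using Z by auto
  have nonneg: "0 \<le> Zp x" "0 \<le> Zn x" for x
    by (auto simp: Zp_def Zn_def)
  have split: "(\<integral>x. Z x * indicator F (?X x) \<partial>M)
      = (\<integral>x. Zp x * indicator F (?X x) \<partial>M) - (\<integral>x. Zn x * indicator F (?X x) \<partial>M)"
    if "F \<in> sets (Pi\<^sub>M B (\<lambda>_. borel))" for F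
    unfolding Z_eq left_diff_distrib using int_N[OF int(1) nonneg(1) that] int_N[OF int(2) nonneg(2) that]
    by (rule Bochner_Integration.integral_diff)
  have "N Zp = N Zn"
  proof (rule measure_eqI_PiM_finite[OF B])
    show "sets (N Zp) = sets (Pi\<^sub>M B (\<lambda>_. borel))" "sets (N Zn) = sets (Pi\<^sub>M B (\<lambda>_. borel))"
      by (auto simp: N_def)
    show "emeasure (N Zp) (Pi\<^sub>E B G) = emeasure (N Zn) (Pi\<^sub>E B G)" if G: "\<And>i. i \<in> B \<Longrightarrow> G i \<in> sets borel" for G
    proof -
      have F: "Pi\<^sub>E B G \<in> sets (Pi\<^sub>M B (\<lambda>_. borel))"
        using B G by (rule sets_PiM_I_finite)
      have "indicator (Pi\<^sub>E B G) (?X x) = (\<Prod>b\<in>B. indicator (G b) (X b x) :: real)" for x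
        using B by (auto simp: indicator_def PiE_iff prod.neutral intro!: prod_zero[symmetric])
      then have "(\<integral>x. Z x * indicator (Pi\<^sub>E B G) (?X x) \<partial>M) = 0"
        using signed_char_unique_rect[OF B X G Z char0] by simp
      then show ?thesis
        using F int nonneg by (simp add: emeasure_N split)
    qed
    show "range (\<lambda>_. space (Pi\<^sub>M B (\<lambda>_. borel))) \<subseteq> prod_algebra B (\<lambda>_. borel :: real measure)"
      using prod_algebraI_finite[OF B, of "\<lambda>_. UNIV" "\<lambda>_. borel :: real measure"] by (auto simp: space_PiM)
    show "emeasure (N Zp) (space (Pi\<^sub>M B (\<lambda>_. borel))) \<noteq> \<infinity>"
      using emeasure_N[OF int(1) nonneg(1) sets.top] by simp
  qed auto
  then have "emeasure (N Zp) F = emeasure (N Zn) F" by simp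
  then have "(\<integral>x. Zp x * indicator F (?X x) \<partial>M) = (\<integral>x. Zn x * indicator F (?X x) \<partial>M)"
    using int nonneg F
    by (simp add: emeasure_N ennreal_inj integral_nonneg_AE)
  then show ?thesis
    using split[OF F] by simp
qed


section \<open>Moments and orthogonality from Gaussian characteristic functions\<close>

lemma sin_cos_limits:
  "(\<lambda>n. 2 * (1 - cos (y / real (Suc n))) * (real (Suc n))\<^sup>2) \<longlonglongrightarrow> y\<^sup>2"
  "(\<lambda>n. real (Suc n) * sin (y / real (Suc n))) \<longlonglongrightarrow> y"
  "(\<lambda>n. 2 * (1 - exp (- (q / (real (Suc n))\<^sup>2) / 2)) * (real (Suc n))\<^sup>2) \<longlonglongrightarrow> q"
proof -
  have "(\<lambda>n. 2 * (1 - cos (y / real (Suc n))) * (real (Suc n))\<^sup>2) \<longlonglongrightarrow> y * y"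
    by real_asymp
  then show "(\<lambda>n. 2 * (1 - cos (y / real (Suc n))) * (real (Suc n))\<^sup>2) \<longlonglongrightarrow> y\<^sup>2"
    by (simp add: power2_eq_square)
  show "(\<lambda>n. real (Suc n) * sin (y / real (Suc n))) \<longlonglongrightarrow> y"
    by real_asymp
  show "(\<lambda>n. 2 * (1 - exp (- (q / (real (Suc n))\<^sup>2) / 2)) * (real (Suc n))\<^sup>2) \<longlonglongrightarrow> q"
    by real_asymp
qed

lemma one_minus_cos_le: "2 * (1 - cos (z :: real)) \<le> z\<^sup>2"
proof -
  have "2 * (1 - cos z) = (2 * sin (z / 2))\<^sup>2"
    using cos_double_sin[of "z / 2"] by (simp add: power2_eq_square)
  also have "\<dots> \<le> z\<^sup>2"
    using abs_sin_x_le_abs_x[of "z / 2"] by (intro abs_le_square_iff[THEN iffD1]) (auto simp: abs_mult)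
  finally show ?thesis .
qed

context prob_space
begin

text \<open>The functions 2 n^2 (1 - cos (Y/n)) lie between 0 and Y^2 and tend to Y^2, and their
  integrals are read off from the characteristic function. Fatou's lemma gives integrability,
  dominated convergence then gives the value.\<close>

lemma gaussian_char_second_moment:
  fixes Y :: "'a \<Rightarrow> real"
  assumes Y[measurable]: "Y \<in> borel_measurable M"
    and char: "\<And>r. (\<integral>x. cos (r * Y x) \<partial>M) = exp (- (q * r\<^sup>2) / 2)"
  shows "integrable M (\<lambda>x. (Y x)\<^sup>2)" and "(\<integral>x. (Y x)\<^sup>2 \<partial>M) = q"
proof -
  define f where "f n x = 2 * (1 - cos (Y x / real (Suc n))) * (real (Suc n))\<^sup>2" for n x
  have f_meas[measurable]: "f n \<in> borel_measurable M" for n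
    unfolding f_def by measurable
  have f_lim: "(\<lambda>n. f n x) \<longlonglongrightarrow> (Y x)\<^sup>2" for x
    unfolding f_def by (rule sin_cos_limits)
  have f_nonneg: "0 \<le> f n x" for n x
    unfolding f_def by (intro mult_nonneg_nonneg) auto
  have f_le: "f n x \<le> (Y x)\<^sup>2" for n x
  proof -
    have "f n x \<le> (Y x / real (Suc n))\<^sup>2 * (real (Suc n))\<^sup>2"
      unfolding f_def by (intro mult_right_mono one_minus_cos_le) auto
    then show ?thesis by (simp add: power_divide)
  qed
  have int_cos: "integrable M (\<lambda>x. cos (Y x / real (Suc n)))" for n
    by (intro integrable_const_bound[of _ 1]) auto
  have f_int: "integrable M (f n)" for n
    unfolding f_def using int_cos[of n] by auto
  have f_val: "(\<integral>x. f n x \<partial>M) = 2 * (1 - exp (- (q / (real (Suc n))\<^sup>2) / 2)) * (real (Suc n))\<^sup>2" for n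
  proof -
    have "(\<integral>x. cos (Y x / real (Suc n)) \<partial>M) = exp (- (q / (real (Suc n))\<^sup>2) / 2)"
      using char[of "1 / real (Suc n)"] by (simp add: power_divide del: of_nat_Suc)
    then show ?thesis
      unfolding f_def using int_cos[of n] by (simp add: prob_space del: of_nat_Suc)
  qed
  have f_val_le: "(\<integral>x. f n x \<partial>M) \<le> q" for n
  proof -
    have "1 - exp (- (q / (real (Suc n))\<^sup>2) / 2) \<le> q / (real (Suc n))\<^sup>2 / 2"
      using exp_ge_add_one_self[of "- (q / (real (Suc n))\<^sup>2) / 2"] by simp
    then have "2 * (1 - exp (- (q / (real (Suc n))\<^sup>2) / 2)) * (real (Suc n))\<^sup>2
        \<le> 2 * (q / (real (Suc n))\<^sup>2 / 2) * (real (Suc n))\<^sup>2"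
      by (intro mult_right_mono mult_left_mono) auto
    also have "\<dots> = q"
      by (simp del: of_nat_Suc)
    finally show ?thesis
      by (simp only: f_val)
  qed
  have "(\<integral>\<^sup>+x. ennreal ((Y x)\<^sup>2) \<partial>M) = (\<integral>\<^sup>+x. liminf (\<lambda>n. ennreal (f n x)) \<partial>M)"
    using f_lim by (intro nn_integral_cong lim_imp_Liminf[symmetric] tendsto_ennrealI) auto
  also have "\<dots> \<le> liminf (\<lambda>n. \<integral>\<^sup>+x. ennreal (f n x) \<partial>M)"
    by (intro nn_integral_liminf) auto
  also have "\<dots> \<le> liminf (\<lambda>n. ennreal q)"
    using f_int f_nonneg f_val_le
    by (intro Liminf_mono) (auto simp: nn_integral_eq_integral intro!: always_eventually ennreal_leI)
  also have "\<dots> < \<infinity>"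
    by (simp add: Liminf_const)
  finally show int: "integrable M (\<lambda>x. (Y x)\<^sup>2)"
    by (intro integrableI_nonneg) auto
  have "(\<lambda>n. \<integral>x. f n x \<partial>M) \<longlonglongrightarrow> (\<integral>x. (Y x)\<^sup>2 \<partial>M)"
    using int f_lim f_le f_nonneg by (intro integral_dominated_convergence[of _ _ _ "\<lambda>x. (Y x)\<^sup>2"]) auto
  moreover have "(\<lambda>n. \<integral>x. f n x \<partial>M) \<longlonglongrightarrow> q"
    unfolding f_val by (rule sin_cos_limits)
  ultimately show "(\<integral>x. (Y x)\<^sup>2 \<partial>M) = q"
    by (rule LIMSEQ_unique)
qed

lemma integrable_mult_square:
  fixes f g :: "'a \<Rightarrow> real"
  assumes "f \<in> borel_measurable M" "g \<in> borel_measurable M"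
    and "integrable M (\<lambda>x. (f x)\<^sup>2)" "integrable M (\<lambda>x. (g x)\<^sup>2)"
  shows "integrable M (\<lambda>x. f x * g x)"
proof (rule Bochner_Integration.integrable_bound)
  show "integrable M (\<lambda>x. (f x)\<^sup>2 + (g x)\<^sup>2)"
    using assms by auto
  show "AE x in M. norm (f x * g x) \<le> norm ((f x)\<^sup>2 + (g x)\<^sup>2)"
  proof (rule AE_I2)
    fix x
    have "0 \<le> (\<bar>f x\<bar> - \<bar>g x\<bar>)\<^sup>2" by simp
    then have "2 * (\<bar>f x\<bar> * \<bar>g x\<bar>) \<le> (f x)\<^sup>2 + (g x)\<^sup>2"
      by (simp add: power2_diff)
    moreover have "0 \<le> \<bar>f x\<bar> * \<bar>g x\<bar>" by simp
    ultimately show "norm (f x * g x) \<le> norm ((f x)\<^sup>2 + (g x)\<^sup>2)"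
      unfolding real_norm_def abs_mult by linarith
  qed
qed (use assms in auto)

end

text \<open>The law is encoded by the real and imaginary parts of its characteristic function, which
  remains meaningful for degenerate families. That \<open>\<Gamma>\<close> is the covariance is
  derived from this.\<close>

locale gaussian_family = prob_space +
  fixes V :: "'v set" and X :: "'v \<Rightarrow> 'a \<Rightarrow> real" and \<Gamma> :: "'v \<Rightarrow> 'v \<Rightarrow> real"
  assumes X_meas[measurable]: "v \<in> V \<Longrightarrow> X v \<in> borel_measurable M"
    and \<Gamma>_sym: "\<Gamma> u v = \<Gamma> v u"
    and char_cos: "finite U \<Longrightarrow> U \<subseteq> V \<Longrightarrow>
      (\<integral>x. cos (\<Sum>v\<in>U. s v * X v x) \<partial>M) = exp (- (\<Sum>u\<in>U. \<Sum>v\<in>U. s u * s v * \<Gamma> u v) / 2)"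
    and char_sin: "finite U \<Longrightarrow> U \<subseteq> V \<Longrightarrow> (\<integral>x. sin (\<Sum>v\<in>U. s v * X v x) \<partial>M) = 0"
begin

lemma char_sin_phase:
  assumes "finite U" "U \<subseteq> V"
  shows "(\<integral>x. sin ((\<Sum>v\<in>U. s v * X v x) + \<phi>) \<partial>M)
    = sin \<phi> * exp (- (\<Sum>u\<in>U. \<Sum>v\<in>U. s u * s v * \<Gamma> u v) / 2)"
proof -
  have [measurable]: "\<And>v. v \<in> U \<Longrightarrow> X v \<in> borel_measurable M"
    using assms by auto
  have "integrable M (\<lambda>x. sin (\<Sum>v\<in>U. s v * X v x))" "integrable M (\<lambda>x. cos (\<Sum>v\<in>U. s v * X v x))"
    by (auto intro!: integrable_const_bound[of _ 1])
  then show ?thesis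
    using assms by (simp add: sin_add char_cos char_sin)
qed

lemma square_integrable: "v \<in> V \<Longrightarrow> integrable M (\<lambda>x. (X v x)\<^sup>2)"
  and second_moment: "v \<in> V \<Longrightarrow> (\<integral>x. (X v x)\<^sup>2 \<partial>M) = \<Gamma> v v"
proof -
  assume v: "v \<in> V"
  have "(\<integral>x. cos (r * X v x) \<partial>M) = exp (- (\<Gamma> v v * r\<^sup>2) / 2)" for r
    using char_cos[of "{v}" "\<lambda>_. r"] v by (simp add: power2_eq_square mult_ac)
  from gaussian_char_second_moment[OF X_meas[OF v] this]
  show "integrable M (\<lambda>x. (X v x)\<^sup>2)" "(\<integral>x. (X v x)\<^sup>2 \<partial>M) = \<Gamma> v v" .
qed

lemma integrable_X: "v \<in> V \<Longrightarrow> integrable M (X v)"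
  using square_integrable_imp_integrable[OF X_meas square_integrable] .

lemma integrable_XX: "u \<in> V \<Longrightarrow> v \<in> V \<Longrightarrow> integrable M (\<lambda>x. X u x * X v x)"
  by (intro integrable_mult_square square_integrable X_meas)

text \<open>Polarisation: the sum of two members is again centred Gaussian, with known
  variance.\<close>

lemma covariance:
  assumes uv: "u \<in> V" "v \<in> V"
  shows "(\<integral>x. X u x * X v x \<partial>M) = \<Gamma> u v"
proof (cases "u = v")
  case True
  then show ?thesis using second_moment[OF uv(1)] by (simp add: power2_eq_square)
next
  case False
  have "(\<integral>x. cos (r * (X u x + X v x)) \<partial>M) = exp (- ((\<Gamma> u u + 2 * \<Gamma> u v + \<Gamma> v v) * r\<^sup>2) / 2)" for r
    using char_cos[of "{u, v}" "\<lambda>_. r"] uv False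
    by (simp add: power2_eq_square \<Gamma>_sym[of v u] algebra_simps)
  then have "(\<integral>x. (X u x + X v x)\<^sup>2 \<partial>M) = \<Gamma> u u + 2 * \<Gamma> u v + \<Gamma> v v"
    using uv by (intro gaussian_char_second_moment(2)) auto
  moreover have "(\<integral>x. (X u x + X v x)\<^sup>2 \<partial>M)
      = (\<integral>x. (X u x)\<^sup>2 \<partial>M) + 2 * (\<integral>x. X u x * X v x \<partial>M) + (\<integral>x. (X v x)\<^sup>2 \<partial>M)"
    unfolding power2_sum using uv square_integrable integrable_XX by (simp add: mult.assoc)
  ultimately show ?thesis
    using second_moment uv by simp
qed

text \<open>The normal equations remove the cross terms between the residual \<open>Z\<close> and
  the \<open>X b\<close> from the quadratic form in the exponent. This makes every
  \<open>sin (r * Z x)\<close> orthogonal to all events of the \<open>X b\<close>, and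
  \<open>Z\<close> is the dominated limit of n sin (Z/n).\<close>

lemma residual_orthogonal:
  assumes B: "finite B" "B \<subseteq> V" and c: "c \<in> V" "c \<notin> B"
    and h: "\<And>b. b \<in> B \<Longrightarrow> (\<Sum>b'\<in>B. \<Gamma> b b' * h b') = \<Gamma> b c"
    and F: "F \<in> sets (Pi\<^sub>M B (\<lambda>_. borel))"
  shows "(\<integral>x. (X c x - (\<Sum>b\<in>B. h b * X b x)) * indicator F (\<lambda>b\<in>B. X b x) \<partial>M) = 0"
proof -
  define Z where "Z x = X c x - (\<Sum>b\<in>B. h b * X b x)" for x
  have XB[measurable]: "\<And>b. b \<in> B \<Longrightarrow> X b \<in> borel_measurable M"
    using B by auto
  have [measurable]: "X c \<in> borel_measurable M"
    using c by simp
  have Z_meas[measurable]: "Z \<in> borel_measurable M"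
    unfolding Z_def by measurable
  let ?U = "insert c B"
  \<comment> \<open>\<open>k\<close> is the coefficient vector of the residual \<open>Z\<close> on
    \<open>insert c B\<close>.\<close>
  define k where "k v = (if v = c then 1 else - h v)" for v
  have U: "finite ?U" "?U \<subseteq> V" using B c by auto
  have sin_sum: "(\<integral>x. sin (r * Z x + (\<Sum>b\<in>B. s b * X b x) + \<phi>) \<partial>M) = sin \<phi> *
      exp (- (r\<^sup>2 * (\<Sum>u\<in>?U. \<Sum>v\<in>?U. k u * k v * \<Gamma> u v) + (\<Sum>u\<in>B. \<Sum>v\<in>B. s u * s v * \<Gamma> u v)) / 2)"
    for r s \<phi>
  proof -
    define s' where "s' v = (if v = c then 0 else s v)" for v
    define w where "w v = r * k v + s' v" for v
    have "r * Z x + (\<Sum>b\<in>B. s b * X b x) = (\<Sum>v\<in>?U. w v * X v x)" for x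
    proof -
      have "(\<Sum>v\<in>B. w v * X v x) = (\<Sum>b\<in>B. s b * X b x - r * (h b * X b x))"
        using c by (intro sum.cong) (auto simp: w_def k_def s'_def algebra_simps)
      then show ?thesis
        using B c by (simp add: Z_def w_def k_def s'_def sum_subtractf right_diff_distrib flip: sum_distrib_left)
    qed
    then have "(\<integral>x. sin (r * Z x + (\<Sum>b\<in>B. s b * X b x) + \<phi>) \<partial>M)
        = sin \<phi> * exp (- (\<Sum>u\<in>?U. \<Sum>v\<in>?U. w u * w v * \<Gamma> u v) / 2)"
      using char_sin_phase[OF U] by simp
    moreover have "(\<Sum>u\<in>?U. \<Sum>v\<in>?U. w u * w v * \<Gamma> u v)
        = r\<^sup>2 * (\<Sum>u\<in>?U. \<Sum>v\<in>?U. k u * k v * \<Gamma> u v) + (\<Sum>u\<in>B. \<Sum>v\<in>B. s u * s v * \<Gamma> u v)"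
    proof -
      \<comment> \<open>Here the normal equations enter: the vector \<open>\<Gamma>\<close> applied
        to \<open>k\<close> vanishes on \<open>B\<close>, and \<open>s'\<close> vanishes at
        \<open>c\<close>.\<close>
      have cross: "(\<Sum>u\<in>?U. \<Sum>v\<in>?U. k u * s' v * \<Gamma> u v) = 0"
      proof -
        have inner: "(\<Sum>u\<in>?U. k u * \<Gamma> u v) = 0" if v: "v \<in> B" for v
        proof -
          have "(\<Sum>u\<in>B. k u * \<Gamma> u v) = - (\<Sum>u\<in>B. \<Gamma> v u * h u)"
            using c unfolding sum_negf[symmetric]
            by (intro sum.cong) (auto simp: k_def \<Gamma>_sym)
          then show ?thesis
            using h[OF v] B c by (simp add: k_def \<Gamma>_sym)
        qed
        have "(\<Sum>u\<in>?U. \<Sum>v\<in>?U. k u * s' v * \<Gamma> u v) = (\<Sum>v\<in>?U. s' v * (\<Sum>u\<in>?U. k u * \<Gamma> u v))"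
          unfolding sum_distrib_left by (subst sum.swap) (simp add: mult_ac)
        also have "\<dots> = 0"
          by (rule sum.neutral) (use inner in \<open>auto simp: s'_def simp del: sum.insert\<close>)
        finally show ?thesis .
      qed
      have cross': "(\<Sum>u\<in>?U. \<Sum>v\<in>?U. s' u * k v * \<Gamma> u v) = 0"
        by (subst sum.swap) (use cross in \<open>simp add: \<Gamma>_sym mult_ac del: sum.insert\<close>)
      have "w u * w v * \<Gamma> u v = r\<^sup>2 * (k u * k v * \<Gamma> u v) + r * (k u * s' v * \<Gamma> u v)
          + r * (s' u * k v * \<Gamma> u v) + s' u * s' v * \<Gamma> u v" for u v
        by (simp add: w_def algebra_simps power2_eq_square)
      then have "(\<Sum>u\<in>?U. \<Sum>v\<in>?U. w u * w v * \<Gamma> u v)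
          = r\<^sup>2 * (\<Sum>u\<in>?U. \<Sum>v\<in>?U. k u * k v * \<Gamma> u v) + r * (\<Sum>u\<in>?U. \<Sum>v\<in>?U. k u * s' v * \<Gamma> u v)
          + r * (\<Sum>u\<in>?U. \<Sum>v\<in>?U. s' u * k v * \<Gamma> u v) + (\<Sum>u\<in>?U. \<Sum>v\<in>?U. s' u * s' v * \<Gamma> u v)"
        by (simp only: sum.distrib sum_distrib_left)
      moreover have "(\<Sum>u\<in>?U. \<Sum>v\<in>?U. s' u * s' v * \<Gamma> u v) = (\<Sum>u\<in>B. \<Sum>v\<in>B. s u * s v * \<Gamma> u v)"
      proof -
        have "(\<Sum>u\<in>B. \<Sum>v\<in>B. s' u * s' v * \<Gamma> u v) = (\<Sum>u\<in>B. \<Sum>v\<in>B. s u * s v * \<Gamma> u v)"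
          using c by (intro sum.cong) (auto simp: s'_def)
        moreover have "s' c = 0" by (simp add: s'_def)
        ultimately show ?thesis
          using B c by simp
      qed
      ultimately show ?thesis
        using cross cross' by simp
    qed
    ultimately show ?thesis by simp
  qed
  have int_sin: "integrable M (\<lambda>x. sin (r * Z x))" for r
    by (intro integrable_const_bound[of _ 1]) auto
  have sin_zero: "(\<integral>x. sin (r * Z x) * indicator F (\<lambda>b\<in>B. X b x) \<partial>M) = 0" for r
  proof (rule signed_char_unique_PiM[OF B(1) XB int_sin _ F])
    fix s \<phi>
    have int: "integrable M (\<lambda>x. sin (r * Z x + (\<Sum>b\<in>B. s b * X b x) + \<phi>))" for r s \<phi>
      by (intro integrable_const_bound[of _ 1]) auto
    \<comment> \<open>The phases of the two terms are opposite and their quadratic forms agree, so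
      the contributions of sin \<phi> and sin (- \<phi>) cancel.\<close>
    have "sin (r * Z x) * cos ((\<Sum>b\<in>B. s b * X b x) + \<phi>)
        = (sin (r * Z x + (\<Sum>b\<in>B. s b * X b x) + \<phi>) + sin (r * Z x + (\<Sum>b\<in>B. - s b * X b x) + - \<phi>)) / 2" for x
      using sin_add[of "r * Z x" "(\<Sum>b\<in>B. s b * X b x) + \<phi>"] sin_diff[of "r * Z x" "(\<Sum>b\<in>B. s b * X b x) + \<phi>"]
      by (simp add: sum_negf algebra_simps)
    then have "(\<integral>x. sin (r * Z x) * cos ((\<Sum>b\<in>B. s b * X b x) + \<phi>) \<partial>M)
        = ((\<integral>x. sin (r * Z x + (\<Sum>b\<in>B. s b * X b x) + \<phi>) \<partial>M)
          + (\<integral>x. sin (r * Z x + (\<Sum>b\<in>B. - s b * X b x) + - \<phi>) \<partial>M)) / 2"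
      using int[of r s \<phi>] int[of r "\<lambda>b. - s b" "- \<phi>"]
      by (simp only: integral_divide_zero Bochner_Integration.integral_add)
    also have "\<dots> = 0"
      unfolding sin_sum by simp
    finally show "(\<integral>x. sin (r * Z x) * cos ((\<Sum>b\<in>B. s b * X b x) + \<phi>) \<partial>M) = 0" .
  qed
  have ind: "(\<lambda>x. indicator F (\<lambda>b\<in>B. X b x) :: real) \<in> borel_measurable M"
  proof -
    have "(\<lambda>x. \<lambda>b\<in>B. X b x) \<in> measurable M (Pi\<^sub>M B (\<lambda>_. borel))"
      by (intro measurable_restrict) auto
    then show ?thesis
      using F by (intro measurable_compose[OF _ borel_measurable_indicator])
  qed
  have int_Z: "integrable M Z"
    unfolding Z_def using B c
    by (intro Bochner_Integration.integrable_diff Bochner_Integration.integrable_sum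
        integrable_mult_right integrable_X) auto
  have "(\<lambda>n. \<integral>x. real (Suc n) * sin (Z x / real (Suc n)) * indicator F (\<lambda>b\<in>B. X b x) \<partial>M)
      \<longlonglongrightarrow> (\<integral>x. Z x * indicator F (\<lambda>b\<in>B. X b x) \<partial>M)"
  proof (rule integral_dominated_convergence[of _ _ _ "\<lambda>x. \<bar>Z x\<bar>"])
    show "AE x in M. (\<lambda>n. real (Suc n) * sin (Z x / real (Suc n)) * indicator F (\<lambda>b\<in>B. X b x))
        \<longlonglongrightarrow> Z x * indicator F (\<lambda>b\<in>B. X b x)"
      by (intro AE_I2 tendsto_mult sin_cos_limits tendsto_const)
    show "AE x in M. norm (real (Suc n) * sin (Z x / real (Suc n)) * indicator F (\<lambda>b\<in>B. X b x)) \<le> \<bar>Z x\<bar>" for n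
    proof (rule AE_I2)
      fix x
      have "\<bar>real (Suc n) * sin (Z x / real (Suc n))\<bar> \<le> real (Suc n) * \<bar>Z x / real (Suc n)\<bar>"
        unfolding abs_mult by (intro mult_mono abs_sin_x_le_abs_x) auto
      also have "\<dots> = \<bar>Z x\<bar>" by (simp del: of_nat_Suc)
      finally show "norm (real (Suc n) * sin (Z x / real (Suc n)) * indicator F (\<lambda>b\<in>B. X b x)) \<le> \<bar>Z x\<bar>"
        by (simp add: indicator_def del: of_nat_Suc)
    qed
  qed (use int_Z ind in auto)
  moreover have "(\<integral>x. real (Suc n) * sin (Z x / real (Suc n)) * indicator F (\<lambda>b\<in>B. X b x) \<partial>M) = 0" for n
    using sin_zero[of "1 / real (Suc n)"] by (simp add: mult.assoc del: of_nat_Suc)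
  ultimately have "(\<integral>x. Z x * indicator F (\<lambda>b\<in>B. X b x) \<partial>M) = 0"
    by (simp add: LIMSEQ_const_iff)
  then show ?thesis by (simp add: Z_def)
qed

end


section \<open>Conditional expectations given finitely or infinitely many coordinates\<close>

lemma sets_coord_algebra:
  assumes "(\<lambda>x. restrict x U) \<in> measurable \<mu> (Pi\<^sub>M U (\<lambda>_. borel))"
  shows "sets (coord_algebra \<mu> U) = {(\<lambda>x. restrict x U) -` F \<inter> space \<mu> | F. F \<in> sets (Pi\<^sub>M U (\<lambda>_. borel))}"
  using assms unfolding coord_algebra_def by (intro sets_vimage_algebra2) (simp add: measurable_def)

lemma space_coord_algebra: "space (coord_algebra \<mu> U) = space \<mu>"
  by (simp add: coord_algebra_def)

lemma subalgebra_coord_algebra: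
  assumes "(\<lambda>x. restrict x U) \<in> measurable \<mu> (Pi\<^sub>M U (\<lambda>_. borel))"
  shows "subalgebra \<mu> (coord_algebra \<mu> U)"
  unfolding subalgebra_def space_coord_algebra
  using assms by (auto simp: sets_coord_algebra intro: measurable_sets)

locale gaussian_coords = gaussian_family \<mu> V "\<lambda>v x. x v" \<Gamma>
  for \<mu> :: "('v \<Rightarrow> real) measure" and V \<Gamma>
begin

lemma restrict_measurable: "U \<subseteq> V \<Longrightarrow> (\<lambda>x. restrict x U) \<in> measurable \<mu> (Pi\<^sub>M U (\<lambda>_. borel))"
  by (intro measurable_restrict X_meas) auto

lemma coord_algebra_sets:
  assumes "U \<subseteq> V" "E \<in> sets (coord_algebra \<mu> U)"
  obtains F where "F \<in> sets (Pi\<^sub>M U (\<lambda>_. borel))" "\<And>x. x \<in> space \<mu> \<Longrightarrow> x \<in> E \<longleftrightarrow> restrict x U \<in> F"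
  using assms(2) by (auto simp: sets_coord_algebra[OF restrict_measurable[OF assms(1)]])

lemma coord_measurable:
  assumes "U \<subseteq> V" "v \<in> U"
  shows "(\<lambda>x. x v) \<in> borel_measurable (coord_algebra \<mu> U)"
proof -
  have "(\<lambda>x. restrict x U) \<in> measurable (coord_algebra \<mu> U) (Pi\<^sub>M U (\<lambda>_. borel))"
    unfolding coord_algebra_def
    by (rule measurable_vimage_algebra1) (use restrict_measurable[OF assms(1)] in \<open>simp add: measurable_def\<close>)
  then have "(\<lambda>x. restrict x U v) \<in> borel_measurable (coord_algebra \<mu> U)"
    by (rule measurable_compose) (rule measurable_component_singleton[OF assms(2)])
  then show ?thesis using assms(2) by simp
qed

lemma coord_algebra_mono:
  assumes "T \<subseteq> U" "U \<subseteq> V"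
  shows "sets (coord_algebra \<mu> T) \<subseteq> sets (coord_algebra \<mu> U)"
proof
  fix E assume "E \<in> sets (coord_algebra \<mu> T)"
  then obtain F where F: "F \<in> sets (Pi\<^sub>M T (\<lambda>_. borel))" and E: "E = (\<lambda>x. restrict x T) -` F \<inter> space \<mu>"
    using assms by (auto simp: sets_coord_algebra[OF restrict_measurable])
  have "(\<lambda>x. restrict x T) \<in> measurable (coord_algebra \<mu> U) (Pi\<^sub>M T (\<lambda>_. borel))"
    by (intro measurable_restrict coord_measurable) (use assms in auto)
  from measurable_sets[OF this F] show "E \<in> sets (coord_algebra \<mu> U)"
    by (simp add: E space_coord_algebra)
qed

lemma sigma_finite_coord_algebra:
  assumes "U \<subseteq> V"
  shows "sigma_finite_subalgebra \<mu> (coord_algebra \<mu> U)"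
  using subalgebra_coord_algebra[OF restrict_measurable[OF assms]]
  by (intro finite_measure_subalgebra_is_sigma_finite finite_measure_subalgebra.intro
      finite_measure_subalgebra_axioms.intro finite_measure_axioms)

lemma cond_exp_zero:
  assumes U: "U \<subseteq> V" and f: "integrable \<mu> f"
    and zero: "\<And>E. E \<in> sets (coord_algebra \<mu> U) \<Longrightarrow> (\<integral>x. f x * indicator E x \<partial>\<mu>) = 0"
  shows "AE x in \<mu>. real_cond_exp \<mu> (coord_algebra \<mu> U) f x = 0"
proof -
  interpret S: sigma_finite_subalgebra \<mu> "coord_algebra \<mu> U"
    using sigma_finite_coord_algebra[OF U] .
  show ?thesis
    by (rule S.real_cond_exp_charact)
      (use f zero in \<open>auto simp: set_lebesgue_integral_def mult.commute\<close>)
qed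

text \<open>The two conditional expectations are eliminated one after the other: first the one of the
  indicator of an event of \<open>X a\<close> against \<open>X c\<close>, then that of \<open>X c\<close>, which is linear in \<open>X B\<close>.\<close>

lemma cond_indep_imp_residual_uncorrelated:
  assumes B: "finite B" "B \<subseteq> V" and A: "A \<subseteq> V" "a \<in> A" and C: "C \<subseteq> V" "c \<in> C" and cB: "c \<notin> B"
    and h: "\<And>b. b \<in> B \<Longrightarrow> (\<Sum>b'\<in>B. \<Gamma> b b' * h b') = \<Gamma> b c"
    and indep: "cond_indep \<mu> A C B"
  shows "(\<Sum>b\<in>B. \<Gamma> a b * h b) = \<Gamma> a c"
proof -
  let ?B = "coord_algebra \<mu> B"
  interpret SB: sigma_finite_subalgebra \<mu> ?B
    by (rule sigma_finite_coord_algebra[OF B(2)])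
  interpret SA: sigma_finite_subalgebra \<mu> "coord_algebra \<mu> A"
    by (rule sigma_finite_coord_algebra[OF A(1)])
  have cV: "c \<in> V" and aV: "a \<in> V" using A C by auto
  have c1: "{c} \<subseteq> V" using cV by auto
  interpret Sc: sigma_finite_subalgebra \<mu> "coord_algebra \<mu> {c}"
    by (rule sigma_finite_coord_algebra[OF c1])
  have sub: "E \<in> sets \<mu>" if "E \<in> sets (coord_algebra \<mu> U)" "U \<subseteq> V" for E U
    using subalgebra_coord_algebra[OF restrict_measurable[OF that(2)]] that(1)
    by (auto simp: subalgebra_def)
  have Xc[measurable]: "(\<lambda>x. x c) \<in> borel_measurable \<mu>" and Xa[measurable]: "(\<lambda>x. x a) \<in> borel_measurable \<mu>"
    and XB[measurable]: "\<And>b. b \<in> B \<Longrightarrow> (\<lambda>x. x b) \<in> borel_measurable \<mu>"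
    using cV aV B by auto
  define L where "L x = (\<Sum>b\<in>B. h b * x b)" for x :: "'v \<Rightarrow> real"
  define Z where "Z x = x c - L x" for x :: "'v \<Rightarrow> real"
  have L_meas: "L \<in> borel_measurable ?B"
    unfolding L_def using B by (auto intro!: borel_measurable_sum borel_measurable_times coord_measurable)
  have int_c: "integrable \<mu> (\<lambda>x. x c)"
    by (rule integrable_X[OF cV])
  have int_L: "integrable \<mu> L"
    unfolding L_def using B by (auto intro!: Bochner_Integration.integrable_sum integrable_mult_right integrable_X)
  have int_Z: "integrable \<mu> Z"
    unfolding Z_def using int_c int_L by auto
  have bounded_mult: "integrable \<mu> (\<lambda>x. f x * g x)"
    if "integrable \<mu> f" "g \<in> borel_measurable \<mu>" "AE x in \<mu>. \<bar>g x\<bar> \<le> 1" for f g :: "_ \<Rightarrow> real"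
    using that by (intro Bochner_Integration.integrable_bound[OF that(1)])
      (auto simp: abs_mult elim!: eventually_mono intro!: mult_left_le)
  have Z_zero: "AE x in \<mu>. real_cond_exp \<mu> ?B Z x = 0"
  proof (rule cond_exp_zero[OF B(2) int_Z])
    fix E assume "E \<in> sets ?B"
    then obtain F where F: "F \<in> sets (Pi\<^sub>M B (\<lambda>_. borel))" "\<And>x. x \<in> space \<mu> \<Longrightarrow> x \<in> E \<longleftrightarrow> restrict x B \<in> F"
      using coord_algebra_sets[OF B(2)] by metis
    have "(\<integral>x. Z x * indicator E x \<partial>\<mu>) = (\<integral>x. Z x * indicator F (\<lambda>b\<in>B. x b) \<partial>\<mu>)"
      using F(2) by (intro Bochner_Integration.integral_cong refl) (auto simp: indicator_def)
    then show "(\<integral>x. Z x * indicator E x \<partial>\<mu>) = 0"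
      using residual_orthogonal[OF B cV cB h F(1)] by (simp add: Z_def L_def)
  qed
  \<comment> \<open>Against \<open>Z\<close>, the indicator of \<open>E\<close> is exchanged in
    three moves: by conditional independence it is replaced by its conditional expectation
    \<open>P\<close>, then \<open>x c\<close> is replaced by its regression \<open>L\<close>, and
    finally \<open>P\<close> is turned back into the indicator.\<close>
  have Z_A: "(\<integral>x. Z x * indicator E x \<partial>\<mu>) = 0" if E: "E \<in> sets (coord_algebra \<mu> A)" for E
  proof -
    have E'[measurable]: "E \<in> sets \<mu>" using sub[OF E A(1)] .
    define P where "P = real_cond_exp \<mu> ?B (indicat_real E)"
    have P_meas[measurable]: "P \<in> borel_measurable ?B" "P \<in> borel_measurable \<mu>"
      unfolding P_def by auto
    have int_E: "integrable \<mu> (indicat_real E)"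
      by (intro integrable_const_bound[of _ 1]) auto
    have P_bound: "AE x in \<mu>. \<bar>P x\<bar> \<le> 1"
    proof -
      have "AE x in \<mu>. 0 \<le> P x"
        unfolding P_def by (rule SB.real_cond_exp_pos) auto
      moreover have "AE x in \<mu>. P x \<le> 1"
        unfolding P_def by (rule SB.real_cond_exp_le_c) (use int_E in \<open>auto simp: indicator_def\<close>)
      ultimately show ?thesis by eventually_elim simp
    qed
    have E_bound: "AE x in \<mu>. \<bar>indicat_real E x\<bar> \<le> 1"
      by (auto simp: indicator_def)
    have int_P: "integrable \<mu> P"
      using SB.real_cond_exp_int(1)[OF int_E] by (simp add: P_def)
    define W where "W x = indicat_real E x - P x" for x
    have int_W: "integrable \<mu> W"
      unfolding W_def using int_E int_P by auto
    \<comment> \<open>Conditional independence turns the integral over \<open>E \<inter> F\<close>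
      into the integral of \<open>P\<close> over \<open>F\<close>; so the indicator of
      \<open>E\<close> and \<open>P\<close> agree against every event of the coordinate
      \<open>c\<close>.\<close>
    have W_zero: "AE x in \<mu>. real_cond_exp \<mu> (coord_algebra \<mu> {c}) W x = 0"
    proof (rule cond_exp_zero[OF c1 int_W])
      fix F assume "F \<in> sets (coord_algebra \<mu> {c})"
      then have F: "F \<in> sets (coord_algebra \<mu> C)"
        using coord_algebra_mono[of "{c}" C] C by auto
      have F'[measurable]: "F \<in> sets \<mu>" using sub[OF F C(1)] .
      have F_bound: "AE x in \<mu>. \<bar>indicat_real F x\<bar> \<le> 1"
        by (auto simp: indicator_def)
      have int_F: "integrable \<mu> (indicat_real F)" "integrable \<mu> (indicat_real (E \<inter> F))"
        by (intro integrable_const_bound[of _ 1]; auto)+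
      have PF: "integrable \<mu> (\<lambda>x. P x * indicat_real F x)"
        by (rule bounded_mult[OF int_P _ F_bound]) auto
      have "(\<integral>x. indicat_real E x * indicat_real F x \<partial>\<mu>) = (\<integral>x. indicat_real (E \<inter> F) x \<partial>\<mu>)"
        by (simp only: indicator_inter_arith)
      also have "\<dots> = (\<integral>x. real_cond_exp \<mu> ?B (indicat_real (E \<inter> F)) x \<partial>\<mu>)"
        using SB.real_cond_exp_int(2)[OF int_F(2)] by simp
      also have "\<dots> = (\<integral>x. P x * real_cond_exp \<mu> ?B (indicat_real F) x \<partial>\<mu>)"
        using indep E F unfolding cond_indep_def P_def
        by (intro integral_cong_AE) auto
      also have "\<dots> = (\<integral>x. P x * indicat_real F x \<partial>\<mu>)"
        by (rule SB.real_cond_exp_intg(2)[OF PF]) auto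
      finally have "(\<integral>x. indicat_real E x * indicat_real F x - P x * indicat_real F x \<partial>\<mu>) = 0"
        using PF bounded_mult[OF int_E _ F_bound] by simp
      then show "(\<integral>x. W x * indicator F x \<partial>\<mu>) = 0"
        by (simp add: W_def left_diff_distrib)
    qed
    have int_cE: "integrable \<mu> (\<lambda>x. x c * indicator E x)" and int_cP: "integrable \<mu> (\<lambda>x. x c * P x)"
      and int_LE: "integrable \<mu> (\<lambda>x. L x * indicat_real E x)" and int_LP: "integrable \<mu> (\<lambda>x. L x * P x)"
      and int_ZP: "integrable \<mu> (\<lambda>x. Z x * P x)"
      by (intro bounded_mult int_c int_L int_Z E_bound P_bound; auto)+
    have "(\<integral>x. x c * W x \<partial>\<mu>) = (\<integral>x. x c * real_cond_exp \<mu> (coord_algebra \<mu> {c}) W x \<partial>\<mu>)"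
      using int_cE int_cP int_W coord_measurable[OF c1]
      by (intro Sc.real_cond_exp_intg(2)[symmetric]) (auto simp: W_def right_diff_distrib)
    also have "\<dots> = 0"
      using W_zero by (intro integral_eq_zero_AE) (auto elim!: eventually_mono)
    finally have 1: "(\<integral>x. x c * indicator E x \<partial>\<mu>) = (\<integral>x. x c * P x \<partial>\<mu>)"
      using int_cE int_cP by (simp add: W_def right_diff_distrib)
    \<comment> \<open>\<open>P\<close> is measurable over the coordinates in \<open>B\<close>, given
      which \<open>Z\<close> has conditional expectation zero.\<close>
    have "(\<integral>x. P x * Z x \<partial>\<mu>) = (\<integral>x. P x * real_cond_exp \<mu> ?B Z x \<partial>\<mu>)"
      using int_ZP int_Z by (intro SB.real_cond_exp_intg(2)[symmetric]) (auto simp: mult.commute)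
    also have "\<dots> = 0"
      using Z_zero by (intro integral_eq_zero_AE) (auto elim!: eventually_mono)
    finally have 2: "(\<integral>x. x c * P x \<partial>\<mu>) = (\<integral>x. L x * P x \<partial>\<mu>)"
      using int_cP int_LP by (simp add: Z_def right_diff_distrib mult.commute)
    have 3: "(\<integral>x. L x * P x \<partial>\<mu>) = (\<integral>x. L x * indicat_real E x \<partial>\<mu>)"
      unfolding P_def using int_LE L_meas by (intro SB.real_cond_exp_intg(2)) auto
    show ?thesis
      using 1 2 3 int_cE int_LE by (simp add: Z_def left_diff_distrib)
  qed
  \<comment> \<open>Orthogonality to the events of \<open>A\<close> extends to the unbounded
    coordinate \<open>x a\<close> through the conditional expectation given
    \<open>A\<close>.\<close>
  have "AE x in \<mu>. real_cond_exp \<mu> (coord_algebra \<mu> A) Z x = 0"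
    by (rule cond_exp_zero[OF A(1) int_Z Z_A])
  moreover have int_ac: "integrable \<mu> (\<lambda>x. x a * x c)" and int_aB: "\<And>b. b \<in> B \<Longrightarrow> integrable \<mu> (\<lambda>x. x a * x b)"
    using integrable_XX aV cV B by auto
  moreover have aZ: "x a * Z x = x a * x c - (\<Sum>b\<in>B. h b * (x a * x b))" for x
    by (simp add: Z_def L_def right_diff_distrib sum_distrib_left mult_ac)
  have int_aZ: "integrable \<mu> (\<lambda>x. x a * Z x)"
    unfolding aZ using int_ac int_aB by auto
  have "(\<integral>x. x a * Z x \<partial>\<mu>) = (\<integral>x. x a * real_cond_exp \<mu> (coord_algebra \<mu> A) Z x \<partial>\<mu>)"
    using int_aZ int_Z coord_measurable[OF A] by (intro SA.real_cond_exp_intg(2)[symmetric]) auto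
  ultimately have "(\<integral>x. x a * Z x \<partial>\<mu>) = 0"
    by (auto intro!: integral_eq_zero_AE elim!: eventually_mono)
  then have "\<Gamma> a c - (\<Sum>b\<in>B. h b * \<Gamma> a b) = 0"
    unfolding aZ using int_ac int_aB covariance[OF aV cV] covariance[OF aV] B by (simp add: subset_iff)
  then show ?thesis by (simp add: mult.commute)
qed

end


section \<open>Moving-average representation of stable VAR coefficients\<close>

primrec fpow :: "'j set \<Rightarrow> ('j \<Rightarrow> 'j \<Rightarrow> real) \<Rightarrow> nat \<Rightarrow> 'j \<Rightarrow> 'j \<Rightarrow> real" where
  "fpow J F 0 i j = (if i = j then 1 else 0)"
| "fpow J F (Suc k) i j = (\<Sum>l\<in>J. fpow J F k i l * F l j)"

lemma fpow_Suc_left: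
  assumes J: "finite J" and "i \<in> J" "j \<in> J"
  shows "fpow J F (Suc k) i j = (\<Sum>l\<in>J. F i l * fpow J F k l j)"
  using assms(3)
proof (induction k arbitrary: j)
  case 0
  have "(\<Sum>l\<in>J. (if i = l then 1 else 0) * F l j) = (\<Sum>l\<in>J. if l = i then F l j else 0)"
    "(\<Sum>l\<in>J. F i l * (if l = j then 1 else 0)) = (\<Sum>l\<in>J. if l = j then F i l else 0)"
    by (auto intro!: sum.cong)
  then show ?case using assms(1,2) 0 by simp
next
  case (Suc k)
  have "fpow J F (Suc (Suc k)) i j = (\<Sum>l\<in>J. (\<Sum>m\<in>J. F i m * fpow J F k m l) * F l j)"
    using Suc.IH by (simp del: fpow.simps(2) add: fpow.simps(2)[of J F "Suc k"])
  also have "\<dots> = (\<Sum>m\<in>J. F i m * (\<Sum>l\<in>J. fpow J F k m l * F l j))"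
    unfolding sum_distrib_left sum_distrib_right by (subst sum.swap) (simp add: mult_ac)
  finally show ?case by simp
qed

text \<open>For \<open>r\<close> strictly between the spectral radius and 1, the matrix divided by
  \<open>r\<close> still has spectral radius below 1, hence bounded powers by its Jordan normal
  form; rescaling yields the factor \<open>r ^ k\<close>. The eigenvalue condition is phrased with
  functions on \<open>J\<close>, so that it can be checked on the companion form without
  renumbering.\<close>

lemma fpow_decay:
  fixes F :: "'j \<Rightarrow> 'j \<Rightarrow> real"
  assumes J: "finite J"
    and eigen: "\<And>\<mu> y j. j \<in> J \<Longrightarrow> y j \<noteq> 0 \<Longrightarrow>
      (\<And>i. i \<in> J \<Longrightarrow> (\<Sum>j\<in>J. complex_of_real (F i j) * y j) = \<mu> * y i) \<Longrightarrow> cmod \<mu> < 1"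
  obtains C r where "0 \<le> C" "0 < r" "r < 1" "\<And>k i j. i \<in> J \<Longrightarrow> j \<in> J \<Longrightarrow> \<bar>fpow J F k i j\<bar> \<le> C * r ^ k"
proof (cases "J = {}")
  case True
  then show ?thesis by (intro that[of 0 "1/2"]) auto
next
  case False
  define n where "n = card J"
  have n: "n > 0" using J False by (simp add: n_def card_gt_0_iff)
  obtain e where e: "bij_betw e {0..<n} J"
    using ex_bij_betw_nat_finite[OF J] by (auto simp: n_def)
  define h where "h = inv_into {0..<n} e"
  have e_in: "e i \<in> J" if "i < n" for i
    using e that by (auto simp: bij_betw_def)
  have h: "h j < n" "e (h j) = j" if "j \<in> J" for j
    using e that inv_into_into[of j e "{0..<n}"] f_inv_into_f[of j e "{0..<n}"]
    by (auto simp: bij_betw_def h_def)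
  have he: "h (e i) = i" if "i < n" for i
    using e that by (auto simp: bij_betw_def h_def)
  have sum_J: "(\<Sum>j\<in>J. f j) = (\<Sum>i=0..<n. f (e i))" for f :: "'j \<Rightarrow> 'b :: comm_monoid_add"
    using sum.reindex_bij_betw[OF e] by metis
  define A where "A = mat n n (\<lambda>(i, j). complex_of_real (F (e i) (e j)))"
  have A: "A \<in> carrier_mat n n" by (simp add: A_def)
  have eig_lt: "cmod \<mu> < 1" if \<mu>: "\<mu> \<in> spectrum A" for \<mu>
  proof -
    obtain v where v: "v \<in> carrier_vec n" "v \<noteq> 0\<^sub>v n" "A *\<^sub>v v = \<mu> \<cdot>\<^sub>v v"
      using \<mu> A by (auto simp: spectrum_def eigenvalue_def eigenvector_def)
    obtain i where i: "i < n" "vec_index v i \<noteq> 0"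
      using v(1,2) by (metis carrier_vecD eq_vecI index_zero_vec)
    show ?thesis
    proof (rule eigen[of "e i" "\<lambda>j. vec_index v (h j)"])
      show "(\<Sum>j\<in>J. complex_of_real (F k j) * vec_index v (h j)) = \<mu> * vec_index v (h k)" if k: "k \<in> J" for k
      proof -
        have "(\<Sum>j\<in>J. complex_of_real (F k j) * vec_index v (h j))
            = (\<Sum>j=0..<n. complex_of_real (F k (e j)) * vec_index v j)"
          unfolding sum_J by (intro sum.cong refl) (simp add: he)
        also have "\<dots> = vec_index (A *\<^sub>v v) (h k)"
          using v(1) h[OF k] by (auto simp: scalar_prod_def A_def intro!: sum.cong)
        also have "\<dots> = \<mu> * vec_index v (h k)"
          using v h[OF k] by simp
        finally show ?thesis .
      qed
    qed (use i e_in he in auto)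
  qed
  define r0 where "r0 = spectral_radius A"
  have r0: "0 \<le> r0" "r0 < 1"
    using spectral_radius_mem_max(1)[OF A n] eig_lt by (auto simp: r0_def)
  \<comment> \<open>The midpoint is positive even if the spectral radius is 0.\<close>
  define r where "r = (1 + r0) / 2"
  have r: "0 < r" "r < 1" "r0 < r"
    using r0 by (auto simp: r_def)
  define A' where "A' = complex_of_real (1 / r) \<cdot>\<^sub>m A"
  have A': "A' \<in> carrier_mat n n" by (simp add: A'_def A)
  have "spectral_radius A' < 1"
  proof -
    obtain \<nu> where \<nu>: "\<nu> \<in> spectrum A'" "spectral_radius A' = cmod \<nu>"
      using spectral_radius_mem_max(1)[OF A' n] by auto
    then obtain v where v: "v \<in> carrier_vec n" "v \<noteq> 0\<^sub>v n" "A' *\<^sub>v v = \<nu> \<cdot>\<^sub>v v"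
      using A' by (auto simp: spectrum_def eigenvalue_def eigenvector_def)
    have "A *\<^sub>v v = complex_of_real r \<cdot>\<^sub>v (A' *\<^sub>v v)"
      using r v(1) A unfolding A'_def
      by (intro eq_vecI) (auto simp: scalar_prod_def sum_distrib_left intro!: sum.cong)
    also have "\<dots> = (complex_of_real r * \<nu>) \<cdot>\<^sub>v v"
      unfolding v(3) by (simp add: smult_smult_assoc)
    finally have "complex_of_real r * \<nu> \<in> spectrum A"
      using v A by (auto simp: spectrum_def eigenvalue_def eigenvector_def)
    then have "cmod (complex_of_real r * \<nu>) \<le> r0"
      unfolding r0_def by (intro spectral_radius_mem_max(2)[OF A n]) auto
    then have "r * cmod \<nu> \<le> r0"
      using r by (simp add: norm_mult)
    then have "r * cmod \<nu> < r * 1"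
      using r by linarith
    then show ?thesis
      using r \<nu>(2) by simp
  qed
  moreover have "\<exists>n_as. jordan_nf A' n_as"
    using jordan_nf_exists[OF A'] char_poly_factorized[OF A'] by blast
  ultimately obtain c where c: "\<And>k. norm_bound (A' ^\<^sub>m k) c"
    using spectral_radius_jnf_norm_bound_less_1[OF A'] by blast
  have pow: "(A' ^\<^sub>m k) $$ (i, j) = complex_of_real (fpow J F k (e i) (e j) / r ^ k)"
    if "i < n" "j < n" for k i j
    using that(2)
  proof (induction k arbitrary: j)
    case 0
    then show ?case
      using that(1) he A' by (auto simp: A'_def A_def) metis
  next
    case (Suc k)
    have "(A' ^\<^sub>m Suc k) $$ (i, j) = (\<Sum>l=0..<n. (A' ^\<^sub>m k) $$ (i, l) * A' $$ (l, j))"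
      using that(1) Suc.prems A' pow_carrier_mat[OF A', of k] by (simp add: scalar_prod_def)
    also have "\<dots> = (\<Sum>l=0..<n. complex_of_real (fpow J F k (e i) (e l) * F (e l) (e j) / r ^ Suc k))"
      using Suc.prems by (intro sum.cong refl) (simp add: Suc.IH, simp add: A'_def A_def)
    also have "\<dots> = complex_of_real (fpow J F (Suc k) (e i) (e j) / r ^ Suc k)"
      unfolding of_real_sum[symmetric] sum_divide_distrib[symmetric] fpow.simps sum_J ..
    finally show ?case .
  qed
  have bound: "\<bar>fpow J F k i j\<bar> \<le> c * r ^ k" if ij: "i \<in> J" "j \<in> J" for k i j
  proof -
    have "cmod ((A' ^\<^sub>m k) $$ (h i, h j)) \<le> c"
      using c[of k] h ij A' by (auto simp: norm_bound_def)
    then show ?thesis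
      using pow[of "h i" "h j" k] h ij r by (simp add: norm_divide norm_power field_simps)
  qed
  have "0 \<le> c"
    using bound[of "e 0" "e 0" 0] e_in n by simp
  then show ?thesis
    using that r(1,2) bound by blast
qed


section \<open>Companion form and impulse responses\<close>

definition inst_mat :: "nat \<Rightarrow> (nat \<Rightarrow> real mat) \<Rightarrow> real mat" where
  "inst_mat d A = mat d d (\<lambda>(i, j). (if i = j then 1 else 0) - A 0 $$ (i, j))"

text \<open>The adjugate is the inverse here, as a unit lower triangular matrix has determinant 1.
  In this form the entries are visibly polynomials in the coefficients.\<close>

definition inst_inv :: "nat \<Rightarrow> (nat \<Rightarrow> real mat) \<Rightarrow> nat \<Rightarrow> nat \<Rightarrow> real" where
  "inst_inv d A i j = adj_mat (inst_mat d A) $$ (i, j)"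

definition states :: "nat \<Rightarrow> nat \<Rightarrow> (nat \<times> nat) set" where
  "states d p = {..p} \<times> {..<d}"

text \<open>The companion form of the recursion: the state \<open>(l, i)\<close> at time \<open>t\<close> holds \<open>S\<^sub>t\<^sub>-\<^sub>l\<^sup>i\<close>. One lag
  more than necessary is kept, so that the state space is non-trivial for \<open>p = 0\<close> too.\<close>

definition companion :: "nat \<Rightarrow> nat \<Rightarrow> (nat \<Rightarrow> real mat) \<Rightarrow> nat \<times> nat \<Rightarrow> nat \<times> nat \<Rightarrow> real" where
  "companion d p A a b = (case (a, b) of ((l, i), (l', j)) \<Rightarrow>
     if l = 0 then (if l' < p then \<Sum>m<d. inst_inv d A i m * A (Suc l') $$ (m, j) else 0)
     else if l = Suc l' \<and> i = j then 1 else 0)"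

text \<open>Innovations enter only the block of lag 0, after the instantaneous effects have been
  solved for.\<close>

definition noise_load :: "nat \<Rightarrow> (nat \<Rightarrow> real mat) \<Rightarrow> nat \<times> nat \<Rightarrow> nat \<Rightarrow> real" where
  "noise_load d A a j = (if fst a = 0 then inst_inv d A (snd a) j else 0)"

text \<open>The entry of F^m G: the effect on state \<open>a\<close> of a unit innovation in
  component \<open>j\<close> that occurred \<open>m\<close> steps earlier.\<close>

definition impulse :: "nat \<Rightarrow> nat \<Rightarrow> (nat \<Rightarrow> real mat) \<Rightarrow> nat \<Rightarrow> nat \<times> nat \<Rightarrow> nat \<Rightarrow> real" where
  "impulse d p A m a j =
     (\<Sum>c\<in>states d p. fpow (states d p) (companion d p A) m a c * noise_load d A c j)"

text \<open>The kernel of the causal inverse of I - A on the infinite node set, where A carries the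
  coefficients along the edges; innovations later than \<open>u\<close> have weight 0.\<close>

definition ma_coeff :: "nat \<Rightarrow> nat \<Rightarrow> (nat \<Rightarrow> real mat) \<Rightarrow> nat \<times> int \<Rightarrow> nat \<times> int \<Rightarrow> real" where
  "ma_coeff d p A u w =
     (if snd w \<le> snd u then impulse d p A (nat (snd u - snd w)) (0, fst u) (fst w) else 0)"

definition stable_coeffs :: "nat \<Rightarrow> nat \<Rightarrow> (nat \<Rightarrow> real mat) \<Rightarrow> bool" where
  "stable_coeffs d p A \<longleftrightarrow> (\<forall>z. Determinant.det (var_char_mat d p A z) = 0 \<longrightarrow> cmod z < 1)"

lemma finite_states: "finite (states d p)"
  by (simp add: states_def)

lemma sum_states: "(\<Sum>a\<in>states d p. f a) = (\<Sum>l\<le>p. \<Sum>i<d. f (l, i))"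
  by (simp add: states_def sum.cartesian_product)

lemma sum_mult_swap:
  fixes f :: "'a \<Rightarrow> 'c :: comm_semiring_0"
  shows "(\<Sum>a\<in>S. f a * (\<Sum>b\<in>T. g a b * h b)) = (\<Sum>b\<in>T. (\<Sum>a\<in>S. f a * g a b) * h b)"
  unfolding sum_distrib_left sum_distrib_right by (subst sum.swap) (simp add: mult.assoc)

locale var_coeffs =
  fixes d p :: nat and A :: "nat \<Rightarrow> real mat"
  assumes lower: "\<And>i j. i \<le> j \<Longrightarrow> j < d \<Longrightarrow> A 0 $$ (i, j) = 0"
begin

abbreviation "J \<equiv> states d p"
abbreviation "F \<equiv> companion d p A"
abbreviation "L \<equiv> inst_inv d A"
abbreviation "G \<equiv> noise_load d A"
abbreviation "H \<equiv> impulse d p A"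
abbreviation "\<psi> \<equiv> ma_coeff d p A"

lemma inst_mat_carrier: "inst_mat d A \<in> carrier_mat d d"
  by (simp add: inst_mat_def)

lemma det_inst_mat: "Determinant.det (inst_mat d A) = 1"
proof -
  have "Determinant.det (inst_mat d A) = prod_list (diag_mat (inst_mat d A))"
    using lower by (intro det_lower_triangular[OF _ inst_mat_carrier]) (auto simp: inst_mat_def)
  also have "diag_mat (inst_mat d A) = replicate d 1"
    using lower by (intro nth_equalityI) (auto simp: diag_mat_def inst_mat_def)
  finally show ?thesis by simp
qed

lemma inst_inv_right:
  assumes "i < d" "j < d"
  shows "(\<Sum>m<d. ((if i = m then 1 else 0) - A 0 $$ (i, m)) * L m j) = (if i = j then 1 else 0)"
  using arg_cong[OF adj_mat(2)[OF inst_mat_carrier], of "\<lambda>B. B $$ (i, j)"] assms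
    adj_mat(1)[OF inst_mat_carrier] inst_mat_carrier
  by (auto simp: det_inst_mat[unfolded inst_mat_def] scalar_prod_def inst_inv_def inst_mat_def atLeast0LessThan
      intro!: trans[OF sum.cong[OF refl]])

lemma inst_inv_left:
  assumes "i < d" "j < d"
  shows "(\<Sum>m<d. L i m * ((if m = j then 1 else 0) - A 0 $$ (m, j))) = (if i = j then 1 else 0)"
  using arg_cong[OF adj_mat(3)[OF inst_mat_carrier], of "\<lambda>B. B $$ (i, j)"] assms
    adj_mat(1)[OF inst_mat_carrier] inst_mat_carrier
  by (auto simp: det_inst_mat[unfolded inst_mat_def] scalar_prod_def inst_inv_def inst_mat_def atLeast0LessThan
      intro!: trans[OF sum.cong[OF refl]])

lemma inst_inv_solve:
  fixes x y :: "nat \<Rightarrow> real"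
  assumes "\<And>i. i < d \<Longrightarrow> x i = (\<Sum>m<d. A 0 $$ (i, m) * x m) + y i" and i: "i < d"
  shows "x i = (\<Sum>m<d. L i m * y m)"
proof -
  have "(\<Sum>m<d. L i m * y m) = (\<Sum>m<d. L i m * (\<Sum>j<d. ((if m = j then 1 else 0) - A 0 $$ (m, j)) * x j))"
  proof (intro sum.cong refl)
    fix m assume m: "m \<in> {..<d}"
    have "(\<Sum>j<d. ((if m = j then 1 else 0) - A 0 $$ (m, j)) * x j)
        = (\<Sum>j<d. (if m = j then x j else 0)) - (\<Sum>j<d. A 0 $$ (m, j) * x j)"
      unfolding sum_subtractf[symmetric] by (intro sum.cong) (auto simp: algebra_simps)
    also have "\<dots> = y m"
      using m assms(1)[of m] by simp
    finally show "L i m * y m = L i m * (\<Sum>j<d. ((if m = j then 1 else 0) - A 0 $$ (m, j)) * x j)" by simp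
  qed
  also have "\<dots> = (\<Sum>j<d. (\<Sum>m<d. L i m * ((if m = j then 1 else 0) - A 0 $$ (m, j))) * x j)"
    by (rule sum_mult_swap)
  also have "\<dots> = (\<Sum>j<d. if i = j then x j else 0)"
    using i by (intro sum.cong refl) (simp add: inst_inv_left)
  also have "\<dots> = x i" using i by simp
  finally show ?thesis by simp
qed

lemma companion_apply:
  assumes "l \<le> p"
  shows "(\<Sum>b\<in>J. F (l, i) b * y b) = (if l = 0 then \<Sum>k<p. \<Sum>j<d. (\<Sum>m<d. L i m * A (Suc k) $$ (m, j)) * y (k, j)
    else if i < d then y (l - 1, i) else 0)"
proof (cases l)
  case 0
  have "(\<Sum>k\<le>p. \<Sum>j<d. (if k < p then (\<Sum>m<d. L i m * A (Suc k) $$ (m, j)) else 0) * y (k, j))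
      = (\<Sum>k<p. \<Sum>j<d. (\<Sum>m<d. L i m * A (Suc k) $$ (m, j)) * y (k, j))"
    by (rule sum.mono_neutral_cong_right) auto
  then show ?thesis
    using 0 by (simp add: sum_states companion_def)
next
  case (Suc l')
  have "(\<Sum>b\<in>J. F (l, i) b * y b) = (\<Sum>b\<in>J. if b = (l', i) then y b else 0)"
    using Suc by (intro sum.cong) (auto simp: companion_def split: if_splits)
  also have "\<dots> = (if i < d then y (l', i) else 0)"
    using Suc assms by (auto simp: finite_states) (auto simp: states_def)
  finally show ?thesis using Suc by simp
qed

lemma impulse_0: "a \<in> J \<Longrightarrow> H 0 a j = G a j"
proof -
  assume a: "a \<in> J"
  have "H 0 a j = (\<Sum>c\<in>J. if c = a then G c j else 0)"
    unfolding impulse_def by (intro sum.cong) auto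
  then show ?thesis using a finite_states by simp
qed

lemma impulse_Suc: "a \<in> J \<Longrightarrow> H (Suc m) a j = (\<Sum>b\<in>J. F a b * H m b j)"
  unfolding impulse_def sum_mult_swap
  by (rule sum.cong[OF refl]) (simp add: fpow_Suc_left[OF finite_states] del: fpow.simps)

lemma impulse_add: "a \<in> J \<Longrightarrow> H (m + k) a j = (\<Sum>b\<in>J. fpow J F k a b * H m b j)"
proof (induction k arbitrary: m)
  case 0
  then have "(\<Sum>b\<in>J. fpow J F 0 a b * H m b j) = (\<Sum>b\<in>J. if b = a then H m b j else 0)"
    by (intro sum.cong) auto
  then show ?case using 0 finite_states by simp
next
  case (Suc k)
  have "H (m + Suc k) a j = (\<Sum>b\<in>J. fpow J F k a b * H (Suc m) b j)"
    using Suc.IH[of "Suc m"] Suc.prems by simp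
  also have "\<dots> = (\<Sum>b\<in>J. fpow J F k a b * (\<Sum>c\<in>J. F b c * H m c j))"
    by (intro sum.cong refl) (simp add: impulse_Suc)
  also have "\<dots> = (\<Sum>c\<in>J. fpow J F (Suc k) a c * H m c j)"
    unfolding fpow.simps by (rule sum_mult_swap)
  finally show ?case .
qed

lemma impulse_shift:
  assumes "l \<le> p" "i < d"
  shows "H m (l, i) j = (if l \<le> m then H (m - l) (0, i) j else 0)"
  using assms
proof (induction l arbitrary: m)
  case 0
  then show ?case by simp
next
  case (Suc l)
  show ?case
  proof (cases m)
    case 0
    then show ?thesis using Suc.prems by (simp add: impulse_0 noise_load_def states_def)
  next
    case (Suc m')
    then have "H m (Suc l, i) j = H m' (l, i) j"
      using Suc.prems companion_apply[of "Suc l" i "\<lambda>b. H m' b j"] by (simp add: impulse_Suc states_def)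
    then show ?thesis
      using Suc.IH[of m'] Suc.prems Suc by simp
  qed
qed

text \<open>Multiplying the companion recursion by I - A_0 restores the form with instantaneous
  effects. The auxiliary \<open>y\<close> collects all terms except the instantaneous ones, so the
  companion form says H = L y.\<close>

lemma impulse_top:
  assumes i: "i < d" and j: "j < d"
  shows "H m (0, i) j = (\<Sum>i'<d. A 0 $$ (i, i') * H m (0, i') j)
    + (\<Sum>k<p. \<Sum>i'<d. A (Suc k) $$ (i, i') * (if Suc k \<le> m then H (m - Suc k) (0, i') j else 0))
    + (if m = 0 \<and> i = j then 1 else 0)"
proof -
  define y where "y i = (\<Sum>k<p. \<Sum>i'<d. A (Suc k) $$ (i, i') * (if Suc k \<le> m then H (m - Suc k) (0, i') j else 0))
    + (if m = 0 \<and> i = j then 1 else 0)" for i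
  have H_y: "H m (0, i) j = (\<Sum>n<d. L i n * y n)" if i: "i < d" for i
  proof (cases m)
    case 0
    have "(\<Sum>n<d. L i n * y n) = (\<Sum>n<d. if n = j then L i n else 0)"
      using 0 by (intro sum.cong) (auto simp: y_def)
    then show ?thesis
      using 0 i j by (simp add: impulse_0 noise_load_def states_def)
  next
    case (Suc m')
    have "H m (0, i) j = (\<Sum>k<p. \<Sum>i'<d. (\<Sum>n<d. L i n * A (Suc k) $$ (n, i')) * H m' (k, i') j)"
      using Suc i companion_apply[of 0 i "\<lambda>b. H m' b j"] by (simp add: impulse_Suc states_def)
    also have "\<dots> = (\<Sum>k<p. \<Sum>n<d. \<Sum>i'<d. L i n * (A (Suc k) $$ (n, i') * H m' (k, i') j))"
      unfolding sum_distrib_right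
      by (rule sum.cong[OF refl], subst sum.swap) (simp add: mult.assoc)
    also have "\<dots> = (\<Sum>n<d. L i n * (\<Sum>k<p. \<Sum>i'<d. A (Suc k) $$ (n, i') * H m' (k, i') j))"
      unfolding sum_distrib_left by (subst sum.swap) simp
    also have "\<dots> = (\<Sum>n<d. L i n * y n)"
    proof (rule sum.cong[OF refl])
      fix n assume "n \<in> {..<d}"
      have "(\<Sum>k<p. \<Sum>i'<d. A (Suc k) $$ (n, i') * H m' (k, i') j) = y n"
      proof -
        have "H m' (k, i') j = (if Suc k \<le> m then H (m - Suc k) (0, i') j else 0)" if "k < p" "i' < d" for k i'
          using impulse_shift[of k i' m'] that Suc by simp
        then show ?thesis
          unfolding y_def using Suc by simp
      qed
      then show "L i n * (\<Sum>k<p. \<Sum>i'<d. A (Suc k) $$ (n, i') * H m' (k, i') j) = L i n * y n"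
        by simp
    qed
    finally show ?thesis .
  qed
  have "(\<Sum>i'<d. A 0 $$ (i, i') * H m (0, i') j) + y i = H m (0, i) j"
  proof -
    have "H m (0, i) j - (\<Sum>i'<d. A 0 $$ (i, i') * H m (0, i') j)
        = (\<Sum>i'<d. (if i = i' then H m (0, i') j else 0)) - (\<Sum>i'<d. A 0 $$ (i, i') * H m (0, i') j)"
      using i by simp
    also have "\<dots> = (\<Sum>i'<d. ((if i = i' then 1 else 0) - A 0 $$ (i, i')) * H m (0, i') j)"
      unfolding sum_subtractf[symmetric] by (intro sum.cong) (auto simp: algebra_simps)
    also have "\<dots> = (\<Sum>i'<d. ((if i = i' then 1 else 0) - A 0 $$ (i, i')) * (\<Sum>n<d. L i' n * y n))"
      by (intro sum.cong refl) (simp add: H_y)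
    also have "\<dots> = (\<Sum>n<d. (\<Sum>i'<d. ((if i = i' then 1 else 0) - A 0 $$ (i, i')) * L i' n) * y n)"
      by (rule sum_mult_swap)
    also have "\<dots> = (\<Sum>n<d. if i = n then y n else 0)"
      using i by (intro sum.cong refl) (simp add: inst_inv_right)
    also have "\<dots> = y i" using i by simp
    finally show ?thesis by simp
  qed
  then show ?thesis by (simp add: y_def)
qed

text \<open>\<open>\<psi>\<close> is a right inverse of I - A: it solves the recursion of the
  process in its first argument.\<close>

lemma ma_coeff_rec:
  assumes "i < d" "j < d"
  shows "\<psi> (i, t) (j, s) = (if i = j \<and> t = s then 1 else 0)
    + (\<Sum>k\<le>p. \<Sum>i'<d. A k $$ (i, i') * \<psi> (i', t - int k) (j, s))"
proof (cases "s \<le> t")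
  case False
  then show ?thesis by (auto simp: ma_coeff_def intro!: sum.neutral[symmetric])
next
  case True
  define m where "m = nat (t - s)"
  have t: "t = s + int m" using True by (simp add: m_def)
  have "\<psi> (i', t - int (Suc k)) (j, s) = (if Suc k \<le> m then H (m - Suc k) (0, i') j else 0)" for i' k
    by (auto simp: ma_coeff_def t nat_diff_distrib' intro!: arg_cong[where f = "\<lambda>n. H n _ _"])
  moreover have "\<psi> (i', t) (j, s) = H m (0, i') j" for i'
    by (simp add: ma_coeff_def t)
  ultimately show ?thesis
    using impulse_top[OF assms, of m] t
    by (simp add: sum.atMost_shift del: of_nat_Suc)
qed

text \<open>\<open>\<psi>\<close> is also a left inverse of I - A, which on an infinite node set
  needs its own proof. The claim for the parents of (i, t) is substituted into
  \<open>ma_coeff_rec\<close>, by induction along the causal order.\<close>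

lemma ma_coeff_corec:
  assumes "i < d" "j < d"
  shows "\<psi> (i, t) (j, s) = (if i = j \<and> t = s then 1 else 0)
    + (\<Sum>k\<le>p. \<Sum>i'<d. \<psi> (i, t) (i', s + int k) * A k $$ (i', j))"
  using assms(1)
\<comment> \<open>The measure is lexicographic in time and component: a lagged parent loses at least
  \<open>d\<close>, more than its component can regain, and an instantaneous parent has a smaller
  component. The summand 1 keeps the decrease strict at \<open>t = s\<close>, where
  \<open>nat\<close> sends all earlier times to 0.\<close>
proof (induction "nat (t - s + 1) * d + i" arbitrary: i t rule: less_induct)
  case less
  show ?case
  proof (cases "s \<le> t")
    case False
    then show ?thesis by (auto simp: ma_coeff_def intro!: sum.neutral[symmetric])
  next
    case True
    have IH: "A k $$ (i, i') * \<psi> (i', t - int k) (j, s) = A k $$ (i, i') * ((if i' = j \<and> t - int k = s then 1 else 0)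
        + (\<Sum>k'\<le>p. \<Sum>i''<d. \<psi> (i', t - int k) (i'', s + int k') * A k' $$ (i'', j)))"
      if i': "i' < d" for k i'
    proof (cases "A k $$ (i, i') = 0")
      case False
      have "nat (t - int k - s + 1) * d + i' < nat (t - s + 1) * d + i"
      proof (cases k)
        case 0
        then have "i' < i" using lower[of i i'] False i' by (meson not_le)
        then show ?thesis using 0 by simp
      next
        case (Suc k')
        have "Suc (nat (t - int k - s + 1)) \<le> nat (t - s + 1)"
          using True Suc by auto
        then have "Suc (nat (t - int k - s + 1)) * d \<le> nat (t - s + 1) * d"
          by (rule mult_le_mono1)
        then show ?thesis using i' by simp
      qed
      from less.hyps[OF this i'] show ?thesis by simp
    qed simp
    have delta: "(\<Sum>k\<le>p. \<Sum>i'<d. A k $$ (i, i') * (if i' = j \<and> t - int k = s then 1 else 0))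
        = (\<Sum>k\<le>p. \<Sum>i''<d. (if i = i'' \<and> t = s + int k then 1 else 0) * A k $$ (i'', j))"
    proof (rule sum.cong[OF refl])
      fix k assume "k \<in> {..p}"
      have "(\<Sum>i'<d. A k $$ (i, i') * (if i' = j \<and> t - int k = s then 1 else 0))
          = (\<Sum>i'<d. if i' = j then (if t - int k = s then A k $$ (i, j) else 0) else 0)"
        by (rule sum.cong) auto
      also have "\<dots> = (if t - int k = s then A k $$ (i, j) else 0)"
        using assms(2) by simp
      also have "\<dots> = (\<Sum>i''<d. if i'' = i then (if t - int k = s then A k $$ (i, j) else 0) else 0)"
        using less.prems by simp
      also have "\<dots> = (\<Sum>i''<d. (if i = i'' \<and> t = s + int k then 1 else 0) * A k $$ (i'', j))"
        by (rule sum.cong) auto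
      finally show "(\<Sum>i'<d. A k $$ (i, i') * (if i' = j \<and> t - int k = s then 1 else 0))
          = (\<Sum>i''<d. (if i = i'' \<and> t = s + int k then 1 else 0) * A k $$ (i'', j))" .
    qed
    have swap: "(\<Sum>k\<le>p. \<Sum>i'<d. A k $$ (i, i') * (\<Sum>k'\<le>p. \<Sum>i''<d. \<psi> (i', t - int k) (i'', s + int k') * A k' $$ (i'', j)))
        = (\<Sum>k'\<le>p. \<Sum>i''<d. (\<Sum>k\<le>p. \<Sum>i'<d. A k $$ (i, i') * \<psi> (i', t - int k) (i'', s + int k')) * A k' $$ (i'', j))"
    proof -
      from sum_mult_swap[of "\<lambda>(k, i'). A k $$ (i, i')" "\<lambda>(k, i') (k', i''). \<psi> (i', t - int k) (i'', s + int k')"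
          "\<lambda>(k', i''). A k' $$ (i'', j)" J J]
      show ?thesis by (simp add: sum_states)
    qed
    have "\<psi> (i, t) (j, s) = (if i = j \<and> t = s then 1 else 0)
        + (\<Sum>k\<le>p. \<Sum>i'<d. A k $$ (i, i') * (if i' = j \<and> t - int k = s then 1 else 0))
        + (\<Sum>k\<le>p. \<Sum>i'<d. A k $$ (i, i') * (\<Sum>k'\<le>p. \<Sum>i''<d. \<psi> (i', t - int k) (i'', s + int k') * A k' $$ (i'', j)))"
    proof -
      have "(\<Sum>k\<le>p. \<Sum>i'<d. A k $$ (i, i') * \<psi> (i', t - int k) (j, s))
          = (\<Sum>k\<le>p. \<Sum>i'<d. A k $$ (i, i') * ((if i' = j \<and> t - int k = s then 1 else 0)
            + (\<Sum>k'\<le>p. \<Sum>i''<d. \<psi> (i', t - int k) (i'', s + int k') * A k' $$ (i'', j))))"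
        by (rule sum.cong[OF refl], rule sum.cong[OF refl], rule IH) simp
      then show ?thesis
        unfolding ma_coeff_rec[OF less.prems assms(2), of t s] by (simp only: distrib_left sum.distrib add.assoc)
    qed
    also have "\<dots> = (if i = j \<and> t = s then 1 else 0)
        + (\<Sum>k\<le>p. \<Sum>i''<d. ((if i = i'' \<and> t = s + int k then 1 else 0)
          + (\<Sum>k'\<le>p. \<Sum>i'<d. A k' $$ (i, i') * \<psi> (i', t - int k') (i'', s + int k))) * A k $$ (i'', j))"
      unfolding delta swap by (simp add: sum.distrib distrib_right)
    also have "\<dots> = (if i = j \<and> t = s then 1 else 0)
        + (\<Sum>k\<le>p. \<Sum>i''<d. \<psi> (i, t) (i'', s + int k) * A k $$ (i'', j))"
    proof -
      have "(if i = i'' \<and> t = s + int k then 1 else 0)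
          + (\<Sum>k'\<le>p. \<Sum>i'<d. A k' $$ (i, i') * \<psi> (i', t - int k') (i'', s + int k))
          = \<psi> (i, t) (i'', s + int k)" if "i'' < d" for k i''
        using ma_coeff_rec[OF less.prems that, of t "s + int k"] by (rule sym)
      then show ?thesis
        by (intro arg_cong2[where f = "(+)", OF refl] sum.cong[OF refl] arg_cong2[where f = "(*)", OF _ refl]) auto
    qed
    finally show ?thesis .
  qed
qed

end


section \<open>Autocovariances as series over past innovations\<close>

lemma has_sum_int_below:
  fixes f :: "int \<Rightarrow> real"
  assumes zero: "\<And>s. s > c \<Longrightarrow> f s = 0" and summable: "summable (\<lambda>n. \<bar>f (c - int n)\<bar>)"
  shows "(f has_sum (\<Sum>n. f (c - int n))) UNIV"
proof -
  have "((\<lambda>n. f (c - int n)) has_sum (\<Sum>n. f (c - int n))) UNIV"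
    using summable by (intro norm_summable_imp_has_sum summable_sums[OF summable_rabs_cancel[OF summable]]) simp
  moreover have "inj (\<lambda>n. c - int n)"
    by (auto simp: inj_on_def)
  ultimately have "(f has_sum (\<Sum>n. f (c - int n))) (range (\<lambda>n. c - int n))"
    by (subst has_sum_reindex) (auto simp: o_def)
  moreover have "f s = 0" if "s \<notin> range (\<lambda>n. c - int n)" for s
  proof (rule zero, rule ccontr)
    assume "\<not> c < s"
    then have "s = c - int (nat (c - s))" by simp
    then show False using that by blast
  qed
  then have "(f has_sum (\<Sum>n. f (c - int n))) (range (\<lambda>n. c - int n))
      \<longleftrightarrow> (f has_sum (\<Sum>n. f (c - int n))) UNIV"
    by (intro has_sum_cong_neutral) auto
  ultimately show ?thesis by simp
qed

lemma has_sum_sum: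
  fixes f :: "'i \<Rightarrow> 'a \<Rightarrow> real"
  assumes "\<And>i. i \<in> I \<Longrightarrow> (f i has_sum x i) S"
  shows "((\<lambda>s. \<Sum>i\<in>I. f i s) has_sum (\<Sum>i\<in>I. x i)) S"
  using assms by (induction I rule: infinite_finite_induct) (auto intro: has_sum_add has_sum_0)

text \<open>The share of the innovations of time \<open>s\<close> in the covariance of the nodes
  \<open>u\<close> and \<open>v\<close>.\<close>

definition noise_prod :: "nat \<Rightarrow> nat \<Rightarrow> (nat \<Rightarrow> real mat) \<Rightarrow> (nat \<Rightarrow> real) \<Rightarrow> nat \<times> int \<Rightarrow> nat \<times> int \<Rightarrow> int \<Rightarrow> real" where
  "noise_prod d p A \<sigma>2 u v s = (\<Sum>j<d. \<sigma>2 j * ma_coeff d p A u (j, s) * ma_coeff d p A v (j, s))"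

text \<open>An unordered sum over all integer times, so that series belonging to different pairs of
  nodes can be added without aligning their starting times.\<close>

definition autocov :: "nat \<Rightarrow> nat \<Rightarrow> (nat \<Rightarrow> real mat) \<Rightarrow> (nat \<Rightarrow> real) \<Rightarrow> nat \<times> int \<Rightarrow> nat \<times> int \<Rightarrow> real" where
  "autocov d p A \<sigma>2 u v = infsum (noise_prod d p A \<sigma>2 u v) UNIV"

lemma autocov_sym: "autocov d p A \<sigma>2 u v = autocov d p A \<sigma>2 v u"
  unfolding autocov_def noise_prod_def by (simp add: mult_ac)

context var_coeffs
begin

text \<open>A nonzero eigenvalue \<open>\<mu>\<close> of the companion form is a root of the
  characteristic determinant: the block of lag \<open>l\<close> of an eigenvector is
  \<open>\<mu> ^ (p - l)\<close> times its oldest block \<open>x\<close>, and \<open>x\<close> lies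
  in the kernel of \<open>var_char_mat\<close> at \<open>\<mu>\<close>. The additional lag in the
  state causes a surplus factor \<open>\<mu>\<close>, which cancels.\<close>

lemma stable_imp_fpow_decay:
  assumes stable: "stable_coeffs d p A"
  obtains C r where "0 \<le> C" "0 < r" "r < 1" "\<And>k a b. a \<in> J \<Longrightarrow> b \<in> J \<Longrightarrow> \<bar>fpow J F k a b\<bar> \<le> C * r ^ k"
proof (rule fpow_decay[OF finite_states])
  fix \<mu> y a
  assume a: "a \<in> J" "y a \<noteq> 0"
    and eig: "\<And>a. a \<in> J \<Longrightarrow> (\<Sum>b\<in>J. complex_of_real (F a b) * y b) = \<mu> * y a"
  show "cmod \<mu> < 1"
  proof (cases "\<mu> = 0")
    case False
    have shift: "y (l, i) = \<mu> * y (Suc l, i)" if "Suc l \<le> p" "i < d" for l i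
    proof -
      have "(\<Sum>b\<in>J. complex_of_real (F (Suc l, i) b) * y b) = (\<Sum>b\<in>J. if b = (l, i) then y b else 0)"
        by (intro sum.cong) (auto simp: companion_def split: if_splits)
      also have "\<dots> = y (l, i)"
        using that finite_states[of d p] by (simp add: states_def)
      finally show ?thesis
        using eig[of "(Suc l, i)"] that by (simp add: states_def)
    qed
    define x where "x i = y (p, i)" for i
    have y_x: "y (p - l, i) = \<mu> ^ l * x i" if "l \<le> p" "i < d" for l i
      using that(1)
    proof (induction l)
      case (Suc l)
      then show ?case using shift[of "p - Suc l" i] that(2) by (simp add: Suc_diff_Suc mult_ac)
    qed (simp add: x_def)
    then have y_x': "y (l, i) = \<mu> ^ (p - l) * x i" if "l \<le> p" "i < d" for l i
      using y_x[of "p - l" i] that by simp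
    define AA where "AA k i j = complex_of_real (A k $$ (i, j))" for k i j
    define R where "R m = (\<Sum>k<p. \<Sum>j<d. AA (Suc k) m j * y (k, j))" for m
    have top: "\<mu> * y (0, i) = (\<Sum>m<d. complex_of_real (L i m) * R m)" if i: "i < d" for i
    proof -
      have "\<mu> * y (0, i) = (\<Sum>k\<le>p. \<Sum>j<d. complex_of_real (F (0, i) (k, j)) * y (k, j))"
        using eig[of "(0, i)"] i by (simp add: sum_states) (simp add: states_def)
      also have "\<dots> = (\<Sum>k<p. \<Sum>j<d. (\<Sum>m<d. complex_of_real (L i m) * AA (Suc k) m j) * y (k, j))"
        by (rule sum.mono_neutral_cong_right) (auto simp: companion_def AA_def)
      also have "\<dots> = (\<Sum>k<p. \<Sum>m<d. complex_of_real (L i m) * (\<Sum>j<d. AA (Suc k) m j * y (k, j)))"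
        by (simp only: sum_mult_swap)
      also have "\<dots> = (\<Sum>m<d. complex_of_real (L i m) * R m)"
        unfolding R_def sum_distrib_left by (subst sum.swap) (rule refl)
      finally show ?thesis .
    qed
    have R: "R m = (\<Sum>n<d. ((if m = n then 1 else 0) - AA 0 m n) * (\<mu> * y (0, n)))" if m: "m < d" for m
    proof -
      have "(\<Sum>n<d. ((if m = n then 1 else 0) - AA 0 m n) * (\<mu> * y (0, n)))
          = (\<Sum>n<d. ((if m = n then 1 else 0) - AA 0 m n) * (\<Sum>j<d. complex_of_real (L n j) * R j))"
        by (rule sum.cong[OF refl]) (simp only: top lessThan_iff)
      also have "\<dots> = (\<Sum>j<d. (\<Sum>n<d. ((if m = n then 1 else 0) - AA 0 m n) * complex_of_real (L n j)) * R j)"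
        by (rule sum_mult_swap)
      also have "\<dots> = (\<Sum>j<d. if m = j then R j else 0)"
      proof (rule sum.cong[OF refl])
        fix j assume j: "j \<in> {..<d}"
        have "(\<Sum>n<d. ((if m = n then 1 else 0) - AA 0 m n) * complex_of_real (L n j))
            = complex_of_real (\<Sum>n<d. ((if m = n then 1 else 0) - A 0 $$ (m, n)) * L n j)"
          unfolding of_real_sum by (rule sum.cong[OF refl]) (auto simp: AA_def)
        then show "(\<Sum>n<d. ((if m = n then 1 else 0) - AA 0 m n) * complex_of_real (L n j)) * R j
            = (if m = j then R j else 0)"
          using inst_inv_right[OF m, of j] j by (simp only: lessThan_iff) simp
      qed
      also have "\<dots> = R m" using m by simp
      finally show ?thesis by (rule sym)
    qed
    have kernel: "(\<Sum>j<d. (if i = j then 1 else 0) * \<mu> ^ p * x j - AA 0 i j * \<mu> ^ p * x j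
        - (\<Sum>k=1..p. AA k i j * \<mu> ^ (p - k)) * x j) = 0" if i: "i < d" for i
    proof -
      have "\<mu> * (\<Sum>n<d. ((if i = n then 1 else 0) - AA 0 i n) * y (0, n)) = R i"
        unfolding R[OF i] sum_distrib_left by (rule sum.cong[OF refl]) (simp only: mult_ac)
      also have "R i = (\<Sum>k<p. \<Sum>j<d. AA (Suc k) i j * y (k, j))"
        by (rule R_def)
      also have "\<dots> = (\<Sum>k<p. \<Sum>j<d. AA (Suc k) i j * (\<mu> * (\<mu> ^ (p - Suc k) * x j)))"
      proof (intro sum.cong refl)
        fix k j assume "k \<in> {..<p}" "j \<in> {..<d}"
        then show "AA (Suc k) i j * y (k, j) = AA (Suc k) i j * (\<mu> * (\<mu> ^ (p - Suc k) * x j))"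
          by (simp add: y_x' Suc_diff_Suc flip: power_Suc mult.assoc)
      qed
      also have "\<dots> = \<mu> * (\<Sum>j<d. \<Sum>k<p. AA (Suc k) i j * \<mu> ^ (p - Suc k) * x j)"
        unfolding sum_distrib_left by (subst sum.swap) (simp add: mult_ac)
      also have "(\<Sum>j<d. \<Sum>k<p. AA (Suc k) i j * \<mu> ^ (p - Suc k) * x j)
          = (\<Sum>j<d. (\<Sum>k=1..p. AA k i j * \<mu> ^ (p - k)) * x j)"
        unfolding sum_distrib_right
        by (rule sum.cong[OF refl], rule sum.reindex_bij_witness[of _ "\<lambda>k. k - 1" Suc]) auto
      finally have 1: "(\<Sum>n<d. ((if i = n then 1 else 0) - AA 0 i n) * y (0, n))
          = (\<Sum>j<d. (\<Sum>k=1..p. AA k i j * \<mu> ^ (p - k)) * x j)"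
        using False by simp
      have 2: "(\<Sum>n<d. ((if i = n then 1 else 0) - AA 0 i n) * y (0, n))
          = (\<Sum>j<d. (if i = j then 1 else 0) * \<mu> ^ p * x j - AA 0 i j * \<mu> ^ p * x j)"
        by (intro sum.cong refl) (simp add: y_x' left_diff_distrib mult.assoc)
      show ?thesis
        by (rule trans[OF sum_subtractf]) (simp only: 1[symmetric] 2[symmetric] diff_self)
    qed
    have carrier: "var_char_mat d p A \<mu> \<in> carrier_mat d d"
      by (simp add: var_char_mat_def)
    have "var_char_mat d p A \<mu> *\<^sub>v vec d x = 0\<^sub>v d"
      using kernel
      by (intro eq_vecI) (auto simp: var_char_mat_def scalar_prod_def AA_def atLeast0LessThan left_diff_distrib)
    moreover have "vec d x \<noteq> 0\<^sub>v d"
    proof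
      assume *: "vec d x = 0\<^sub>v d"
      obtain l i where li: "a = (l, i)" "l \<le> p" "i < d"
        using a(1) by (auto simp: states_def)
      have "x i = 0" using arg_cong[OF *, of "\<lambda>v. vec_index v i"] li by simp
      then show False using a(2) li y_x'[of l i] by simp
    qed
    ultimately have "Determinant.det (var_char_mat d p A \<mu>) = 0"
      using det_0_iff_vec_prod_zero[OF carrier] by (metis vec_carrier)
    then show ?thesis
      using stable by (simp add: stable_coeffs_def)
  qed simp
qed (rule that)

end

locale stable_var = var_coeffs +
  fixes \<sigma>2 :: "nat \<Rightarrow> real"
  assumes stable: "stable_coeffs d p A"
begin

abbreviation "\<Gamma> \<equiv> autocov d p A \<sigma>2"

lemma impulse_decay:
  obtains C r where "0 \<le> C" "0 < r" "r < 1" "\<And>m a j. a \<in> J \<Longrightarrow> j < d \<Longrightarrow> \<bar>H m a j\<bar> \<le> C * r ^ m"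
proof -
  obtain C r where Cr: "0 \<le> C" "0 < r" "r < 1" "\<And>k a b. a \<in> J \<Longrightarrow> b \<in> J \<Longrightarrow> \<bar>fpow J F k a b\<bar> \<le> C * r ^ k"
    using stable_imp_fpow_decay[OF stable] by blast
  define g where "g = (\<Sum>j<d. \<Sum>b\<in>J. \<bar>G b j\<bar>)"
  have "\<bar>H m a j\<bar> \<le> C * g * r ^ m" if "a \<in> J" "j < d" for m a j
  proof -
    have "\<bar>H m a j\<bar> \<le> (\<Sum>b\<in>J. \<bar>fpow J F m a b\<bar> * \<bar>G b j\<bar>)"
      unfolding impulse_def abs_mult[symmetric] by (rule sum_abs)
    also have "\<dots> \<le> (\<Sum>b\<in>J. C * r ^ m * \<bar>G b j\<bar>)"
      using Cr that by (intro sum_mono mult_right_mono) auto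
    also have "\<dots> = C * r ^ m * (\<Sum>b\<in>J. \<bar>G b j\<bar>)"
      by (simp add: sum_distrib_left)
    also have "\<dots> \<le> C * r ^ m * g"
      unfolding g_def using that Cr
      by (intro mult_left_mono member_le_sum[of j "{..<d}" "\<lambda>j. \<Sum>b\<in>J. \<bar>G b j\<bar>"]) (auto intro: sum_nonneg)
    finally show ?thesis by (simp add: mult_ac)
  qed
  moreover have "0 \<le> g" unfolding g_def by (auto intro: sum_nonneg)
  ultimately show ?thesis using Cr by (intro that[of "C * g" r]) auto
qed

text \<open>The same \<open>K\<close> and \<open>r\<close> serve all pairs of nodes, counting back
  from the earlier of the two times. This uniformity makes the autocovariances bounded, as the
  maximum principle on the infinite node set requires.\<close>

lemma noise_prod_bound:
  "\<exists>K r. 0 < r \<and> r < 1 \<and> (\<forall>u v n. fst u < d \<longrightarrow> fst v < d \<longrightarrow>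
    \<bar>noise_prod d p A \<sigma>2 u v (min (snd u) (snd v) - int n)\<bar> \<le> K * r ^ n)"
proof -
  obtain C r where Cr: "0 \<le> C" "0 < r" "r < 1" "\<And>m a j. a \<in> J \<Longrightarrow> j < d \<Longrightarrow> \<bar>H m a j\<bar> \<le> C * r ^ m"
    using impulse_decay by blast
  have \<psi>_bound: "\<bar>\<psi> u (j, c - int n)\<bar> \<le> C * r ^ n" if "fst u < d" "j < d" "c \<le> snd u" for u j n c
  proof -
    have "\<bar>\<psi> u (j, c - int n)\<bar> \<le> C * r ^ nat (snd u - (c - int n))"
      using that Cr(4)[of "(0, fst u)" j] by (simp add: ma_coeff_def states_def)
    also have "\<dots> \<le> C * r ^ n"
      using that Cr by (intro mult_left_mono power_decreasing) auto
    finally show ?thesis .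
  qed
  have "\<bar>noise_prod d p A \<sigma>2 u v (min (snd u) (snd v) - int n)\<bar> \<le> (\<Sum>j<d. \<bar>\<sigma>2 j\<bar>) * C * C * r ^ n"
    if "fst u < d" "fst v < d" for u v n
  proof -
    have "\<bar>noise_prod d p A \<sigma>2 u v (min (snd u) (snd v) - int n)\<bar> \<le> (\<Sum>j<d. \<bar>\<sigma>2 j\<bar> * (C * r ^ n) * (C * r ^ n))"
      unfolding noise_prod_def
      by (rule order_trans[OF sum_abs], intro sum_mono)
        (auto simp: abs_mult intro!: mult_mono \<psi>_bound that mult_nonneg_nonneg zero_le_power Cr less_imp_le[OF Cr(2)])
    also have "\<dots> = (\<Sum>j<d. \<bar>\<sigma>2 j\<bar>) * C * C * r ^ n * r ^ n"
      unfolding sum_distrib_right by (rule sum.cong) auto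
    also have "\<dots> \<le> (\<Sum>j<d. \<bar>\<sigma>2 j\<bar>) * C * C * r ^ n * 1"
      using Cr by (intro mult_left_mono power_le_one) (auto intro!: mult_nonneg_nonneg sum_nonneg)
    finally show ?thesis by simp
  qed
  then show ?thesis using Cr(2,3) by blast
qed

lemma noise_prod_zero: "s > min (snd u) (snd v) \<Longrightarrow> noise_prod d p A \<sigma>2 u v s = 0"
  unfolding noise_prod_def by (rule sum.neutral) (auto simp: ma_coeff_def)

text \<open>The free starting time \<open>c\<close> allows the series of finitely many pairs to be
  summed over one common range.\<close>

lemma noise_prod_sums:
  assumes uv: "fst u < d" "fst v < d" and c: "min (snd u) (snd v) \<le> c"
  shows "summable (\<lambda>n. \<bar>noise_prod d p A \<sigma>2 u v (c - int n)\<bar>)"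
    and "(noise_prod d p A \<sigma>2 u v has_sum \<Gamma> u v) UNIV"
    and "(\<lambda>n. noise_prod d p A \<sigma>2 u v (c - int n)) sums \<Gamma> u v"
proof -
  let ?f = "noise_prod d p A \<sigma>2 u v"
  obtain K r where r: "0 < r" "r < 1" and "\<And>u v n. fst u < d \<Longrightarrow> fst v < d \<Longrightarrow>
    \<bar>noise_prod d p A \<sigma>2 u v (min (snd u) (snd v) - int n)\<bar> \<le> K * r ^ n"
    using noise_prod_bound by blast
  then have Kr: "\<bar>?f (min (snd u) (snd v) - int n)\<bar> \<le> K * r ^ n" for n
    using uv by blast
  define k where "k = nat (c - min (snd u) (snd v))"
  have "summable (\<lambda>n. \<bar>?f (min (snd u) (snd v) - int n)\<bar>)"
    by (rule summable_comparison_test[of _ "\<lambda>n. K * r ^ n"])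
      (use r Kr in \<open>auto intro!: summable_mult summable_geometric\<close>)
  moreover have "?f (min (snd u) (snd v) - int n) = ?f (c - int (n + k))" for n
 using c by (simp add: k_def)
  ultimately show s: "summable (\<lambda>n. \<bar>?f (c - int n)\<bar>)"
    using summable_iff_shift[of "\<lambda>n. \<bar>?f (c - int n)\<bar>" k] by simp
  have "(?f has_sum (\<Sum>n. ?f (c - int n))) UNIV"
    by (rule has_sum_int_below[OF _ s]) (use c noise_prod_zero in auto)
  moreover from this have \<Gamma>: "\<Gamma> u v = (\<Sum>n. ?f (c - int n))"
    unfolding autocov_def by (rule infsumI)
  ultimately show "(?f has_sum \<Gamma> u v) UNIV"
    by simp
  show "(\<lambda>n. ?f (c - int n)) sums \<Gamma> u v"
    unfolding \<Gamma> by (rule summable_sums[OF summable_rabs_cancel[OF s]])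
qed

lemma autocov_bounded:
  obtains K where "\<And>u v. fst u < d \<Longrightarrow> fst v < d \<Longrightarrow> \<bar>\<Gamma> u v\<bar> \<le> K"
proof -
  obtain K r where Kr: "0 < r" "r < 1" "\<And>u v n. fst u < d \<Longrightarrow> fst v < d \<Longrightarrow>
    \<bar>noise_prod d p A \<sigma>2 u v (min (snd u) (snd v) - int n)\<bar> \<le> K * r ^ n"
    using noise_prod_bound by blast
  have "\<bar>\<Gamma> u v\<bar> \<le> (\<Sum>n. K * r ^ n)" if uv: "fst u < d" "fst v < d" for u v
  proof -
    let ?f = "\<lambda>n. noise_prod d p A \<sigma>2 u v (min (snd u) (snd v) - int n)"
    have "\<bar>\<Gamma> u v\<bar> = \<bar>\<Sum>n. ?f n\<bar>"
      using noise_prod_sums(3)[OF uv order_refl] by (simp add: sums_iff)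
    also have "\<dots> \<le> (\<Sum>n. \<bar>?f n\<bar>)"
      by (rule summable_rabs[OF noise_prod_sums(1)[OF uv order_refl]])
    also have "\<dots> \<le> (\<Sum>n. K * r ^ n)"
      using Kr uv noise_prod_sums(1)[OF uv order_refl] by (intro suminf_le summable_mult summable_geometric) auto
    finally show ?thesis .
  qed
  then show ?thesis by (rule that)
qed

text \<open>Yule-Walker equations for arbitrary pairs of nodes. The last term is the covariance of
  \<open>v\<close> with the innovation at (i, t); it vanishes if \<open>v\<close> is earlier than
  \<open>t\<close>.\<close>

lemma autocov_rec:
  assumes i: "i < d" and v: "fst v < d"
  shows "\<Gamma> (i, t) v = (\<Sum>k\<le>p. \<Sum>i'<d. A k $$ (i, i') * \<Gamma> (i', t - int k) v) + \<sigma>2 i * \<psi> v (i, t)"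
proof -
  have eq: "noise_prod d p A \<sigma>2 (i, t) v s
      = (\<Sum>k\<le>p. \<Sum>i'<d. A k $$ (i, i') * noise_prod d p A \<sigma>2 (i', t - int k) v s)
        + (if s = t then \<sigma>2 i * \<psi> v (i, t) else 0)" for s
  proof -
    define w where "w j = \<sigma>2 j * \<psi> v (j, s)" for j
    have prod_w: "noise_prod d p A \<sigma>2 u v s = (\<Sum>j<d. \<psi> u (j, s) * w j)" for u
      unfolding noise_prod_def w_def by (rule sum.cong[OF refl]) simp
    define a where "a b = A (fst b) $$ (i, snd b)" for b
    define \<psi>' where "\<psi>' b j = \<psi> (snd b, t - int (fst b)) (j, s)" for b j
    have "(\<Sum>j<d. \<psi> (i, t) (j, s) * w j)
        = (\<Sum>j<d. (if j = i then (if s = t then w j else 0) else 0) + (\<Sum>b\<in>J. a b * \<psi>' b j) * w j)"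
    proof (rule sum.cong[OF refl])
      fix j assume "j \<in> {..<d}"
      then have "\<psi> (i, t) (j, s) = (if i = j \<and> t = s then 1 else 0) + (\<Sum>b\<in>J. a b * \<psi>' b j)"
        using ma_coeff_rec[OF i, of j t s] by (simp add: sum_states a_def \<psi>'_def)
      then show "\<psi> (i, t) (j, s) * w j
          = (if j = i then (if s = t then w j else 0) else 0) + (\<Sum>b\<in>J. a b * \<psi>' b j) * w j"
        by (simp add: distrib_right)
    qed
    also have "\<dots> = (if s = t then w i else 0) + (\<Sum>b\<in>J. a b * (\<Sum>j<d. \<psi>' b j * w j))"
      using i unfolding sum_mult_swap sum.distrib by simp
    finally show ?thesis
      unfolding prod_w by (simp add: sum_states a_def \<psi>'_def) (simp add: w_def)
  qed
  have "((\<lambda>s. (\<Sum>k\<le>p. \<Sum>i'<d. A k $$ (i, i') * noise_prod d p A \<sigma>2 (i', t - int k) v s)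
        + (if s = t then \<sigma>2 i * \<psi> v (i, t) else 0)) has_sum
      ((\<Sum>k\<le>p. \<Sum>i'<d. A k $$ (i, i') * \<Gamma> (i', t - int k) v) + \<sigma>2 i * \<psi> v (i, t))) UNIV"
  proof (intro has_sum_add has_sum_sum has_sum_cmult_right)
    show "((\<lambda>s. if s = t then \<sigma>2 i * \<psi> v (i, t) else 0) has_sum \<sigma>2 i * \<psi> v (i, t)) UNIV"
      by (rule has_sum_finite_neutralI[of "{t}"]) auto
    show "(noise_prod d p A \<sigma>2 (i', t - int k) v has_sum \<Gamma> (i', t - int k) v) UNIV"
      if "i' \<in> {..<d}" for i' k
      using that v by (intro noise_prod_sums(2)) auto
  qed
  then show ?thesis
    unfolding eq[symmetric] using i v noise_prod_sums(2)[OF _ v order_refl, of "(i, t)"] has_sum_unique by fastforce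
qed

text \<open>The stationary covariance matrix of the companion state, a finite object from which all
  autocovariances are computed.\<close>

definition state_cov :: "nat \<times> nat \<Rightarrow> nat \<times> nat \<Rightarrow> real" where
  "state_cov a b = (\<Sum>m. \<Sum>j<d. \<sigma>2 j * H m a j * H m b j)"

lemma state_cov_sums:
  assumes "a \<in> J" "b \<in> J"
  shows "(\<lambda>m. \<Sum>j<d. \<sigma>2 j * H m a j * H m b j) sums state_cov a b"
proof -
  obtain C r where Cr: "0 \<le> C" "0 < r" "r < 1" "\<And>m a j. a \<in> J \<Longrightarrow> j < d \<Longrightarrow> \<bar>H m a j\<bar> \<le> C * r ^ m"
    using impulse_decay by blast
  have "summable (\<lambda>m. \<sigma>2 j * H m a j * H m b j)" if j: "j < d" for j
  proof (rule summable_comparison_test)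
    show "\<exists>N. \<forall>n\<ge>N. norm (\<sigma>2 j * H n a j * H n b j) \<le> \<bar>\<sigma>2 j\<bar> * C * C * r ^ n"
    proof (intro exI[of _ 0] allI impI)
      fix n
      have "norm (\<sigma>2 j * H n a j * H n b j) = \<bar>\<sigma>2 j\<bar> * \<bar>H n a j\<bar> * \<bar>H n b j\<bar>"
        by (simp add: abs_mult)
      also have "\<dots> \<le> \<bar>\<sigma>2 j\<bar> * (C * r ^ n) * (C * r ^ n)"
        using Cr(1,2) Cr(4)[OF assms(1) j] Cr(4)[OF assms(2) j] by (intro mult_mono) auto
      also have "\<dots> = \<bar>\<sigma>2 j\<bar> * C * C * r ^ n * r ^ n" by simp
      also have "\<dots> \<le> \<bar>\<sigma>2 j\<bar> * C * C * r ^ n * 1"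
        using Cr by (intro mult_left_mono power_le_one) auto
      finally show "norm (\<sigma>2 j * H n a j * H n b j) \<le> \<bar>\<sigma>2 j\<bar> * C * C * r ^ n" by simp
    qed
    show "summable (\<lambda>n. \<bar>\<sigma>2 j\<bar> * C * C * r ^ n)"
      using Cr by (intro summable_mult summable_geometric) auto
  qed
  then have "summable (\<lambda>m. \<Sum>j<d. \<sigma>2 j * H m a j * H m b j)"
    by (intro summable_sum) auto
  then show ?thesis unfolding state_cov_def by (rule summable_sums)
qed

text \<open>Shifting the series by one step gives the discrete Lyapunov equation, a finite linear
  system whose coefficients are polynomials in the parameters.\<close>

lemma state_cov_fixpoint:
  assumes ab: "a \<in> J" "b \<in> J"
  shows "state_cov a b = (\<Sum>c\<in>J. \<Sum>e\<in>J. F a c * F b e * state_cov c e) + (\<Sum>j<d. \<sigma>2 j * G a j * G b j)"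
proof -
  let ?f = "\<lambda>a b m. \<Sum>j<d. \<sigma>2 j * H m a j * H m b j"
  have Suc: "?f a b (Suc m) = (\<Sum>c\<in>J. \<Sum>e\<in>J. F a c * F b e * ?f c e m)" for m
  proof -
    have "?f a b (Suc m) = (\<Sum>j<d. (\<Sum>c\<in>J. F a c * H m c j) * (\<sigma>2 j * (\<Sum>e\<in>J. F b e * H m e j)))"
      using ab by (simp add: impulse_Suc mult_ac)
    also have "\<dots> = (\<Sum>c\<in>J. F a c * (\<Sum>j<d. H m c j * (\<sigma>2 j * (\<Sum>e\<in>J. F b e * H m e j))))"
      by (rule sum_mult_swap[symmetric])
    also have "\<dots> = (\<Sum>c\<in>J. \<Sum>e\<in>J. F a c * F b e * ?f c e m)"
    proof (rule sum.cong[OF refl])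
      fix c
      have "(\<Sum>j<d. H m c j * (\<sigma>2 j * (\<Sum>e\<in>J. F b e * H m e j)))
          = (\<Sum>j<d. (\<Sum>e\<in>J. F b e * H m e j) * (\<sigma>2 j * H m c j))"
        by (rule sum.cong[OF refl]) (simp only: mult_ac)
      also have "\<dots> = (\<Sum>e\<in>J. F b e * (\<Sum>j<d. H m e j * (\<sigma>2 j * H m c j)))"
        by (rule sum_mult_swap[symmetric])
      finally show "F a c * (\<Sum>j<d. H m c j * (\<sigma>2 j * (\<Sum>e\<in>J. F b e * H m e j)))
          = (\<Sum>e\<in>J. F a c * F b e * ?f c e m)"
        by (simp add: sum_distrib_left mult_ac)
    qed
    finally show ?thesis .
  qed
  have "(\<lambda>m. \<Sum>c\<in>J. \<Sum>e\<in>J. F a c * F b e * ?f c e m) sums (\<Sum>c\<in>J. \<Sum>e\<in>J. F a c * F b e * state_cov c e)"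
    by (intro sums_sum sums_mult state_cov_sums)
  then have "(\<lambda>m. ?f a b (Suc m)) sums (\<Sum>c\<in>J. \<Sum>e\<in>J. F a c * F b e * state_cov c e)"
    unfolding Suc .
  then have "?f a b sums ((\<Sum>c\<in>J. \<Sum>e\<in>J. F a c * F b e * state_cov c e) + ?f a b 0)"
    by (rule sums_Suc)
  then show ?thesis
    using state_cov_sums[OF ab] ab by (simp add: impulse_0 sums_unique2)
qed

text \<open>The two nodes share only innovations up to time \<open>t\<close>, and their effect is
  carried over the remaining \<open>k\<close> steps by the k-th power of the companion
  matrix.\<close>

lemma autocov_state_cov:
  assumes "i < d" "i' < d"
  shows "\<Gamma> (i, t + int k) (i', t) = (\<Sum>c\<in>J. fpow J F k (0, i) c * state_cov c (0, i'))"
proof -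
  have J: "(0, i) \<in> J" "(0, i') \<in> J" using assms by (auto simp: states_def)
  have "noise_prod d p A \<sigma>2 (i, t + int k) (i', t) (t - int n)
      = (\<Sum>c\<in>J. fpow J F k (0, i) c * (\<Sum>j<d. \<sigma>2 j * H n c j * H n (0, i') j))" for n
  proof -
    have "noise_prod d p A \<sigma>2 (i, t + int k) (i', t) (t - int n)
        = (\<Sum>j<d. \<sigma>2 j * H (n + k) (0, i) j * H n (0, i') j)"
      by (simp add: noise_prod_def ma_coeff_def nat_add_distrib add.commute)
    also have "\<dots> = (\<Sum>j<d. (\<Sum>c\<in>J. fpow J F k (0, i) c * H n c j) * (\<sigma>2 j * H n (0, i') j))"
      using J by (simp add: impulse_add mult_ac)
    also have "\<dots> = (\<Sum>c\<in>J. fpow J F k (0, i) c * (\<Sum>j<d. H n c j * (\<sigma>2 j * H n (0, i') j)))"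
      by (rule sum_mult_swap[symmetric])
    finally show ?thesis by (simp add: mult_ac)
  qed
  moreover have "(\<lambda>n. \<Sum>c\<in>J. fpow J F k (0, i) c * (\<Sum>j<d. \<sigma>2 j * H n c j * H n (0, i') j))
      sums (\<Sum>c\<in>J. fpow J F k (0, i) c * state_cov c (0, i'))"
    by (intro sums_sum sums_mult state_cov_sums J)
  ultimately show ?thesis
    using noise_prod_sums(3)[of "(i, t + int k)" "(i', t)" t] assms by (simp add: sums_unique2)
qed

end


section \<open>Rationality of the autocovariances\<close>

text \<open>Used for uniqueness: a vector fixed by a matrix is fixed by all its powers, so it is 0
  when these decay.\<close>

lemma fpow_fixpoint:
  assumes J: "finite J" and y: "\<And>a. a \<in> J \<Longrightarrow> y a = (\<Sum>b\<in>J. F a b * y b)" and a: "a \<in> J"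
  shows "y a = (\<Sum>b\<in>J. fpow J F k a b * y b)"
proof (induction k)
  case 0
  have "(\<Sum>b\<in>J. fpow J F 0 a b * y b) = (\<Sum>b\<in>J. if b = a then y b else 0)"
    by (intro sum.cong) auto
  then show ?case using J a by simp
next
  case (Suc k)
  have "(\<Sum>b\<in>J. fpow J F k a b * y b) = (\<Sum>b\<in>J. fpow J F k a b * (\<Sum>c\<in>J. F b c * y c))"
    by (rule sum.cong[OF refl]) (simp add: y[symmetric])
  also have "\<dots> = (\<Sum>c\<in>J. fpow J F (Suc k) a c * y c)"
    unfolding fpow.simps by (rule sum_mult_swap)
  finally show ?case using Suc by simp
qed

text \<open>Powers of the Kronecker product of \<open>F\<close> with itself, the matrix that occurs
  in the Lyapunov equation.\<close>

lemma fpow_product: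
  assumes "a \<in> J" "b \<in> J" "c \<in> J" "e \<in> J"
  shows "fpow (J \<times> J) (\<lambda>x y. F (fst x) (fst y) * F (snd x) (snd y)) k (a, b) (c, e)
    = fpow J F k a c * fpow J F k b e"
  using assms(3,4)
proof (induction k arbitrary: c e)
  case 0
  then show ?case by auto
next
  case (Suc k)
  have "fpow (J \<times> J) (\<lambda>x y. F (fst x) (fst y) * F (snd x) (snd y)) (Suc k) (a, b) (c, e)
      = (\<Sum>(x, y)\<in>J \<times> J. (fpow J F k a x * F x c) * (fpow J F k b y * F y e))"
    using Suc.IH by (auto intro!: sum.cong)
  also have "\<dots> = fpow J F (Suc k) a c * fpow J F (Suc k) b e"
    by (simp add: sum_product sum.cartesian_product)
  finally show ?case .
qed

lemma fpow_polyfuns: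
  assumes "\<And>a b. a \<in> J \<Longrightarrow> b \<in> J \<Longrightarrow> (\<lambda>\<theta>. F \<theta> a b) \<in> polyfuns" "a \<in> J" "b \<in> J"
  shows "(\<lambda>\<theta>. fpow J (F \<theta>) k a b) \<in> polyfuns"
  using assms(3)
  by (induction k arbitrary: b) (auto intro!: polyfuns_sum polyfuns_mult polyfuns_const assms(1,2))

lemma coeff_mat_lower: "i \<le> j \<Longrightarrow> j < d \<Longrightarrow> coeff_mat d \<theta> 0 $$ (i, j) = 0"
  by (simp add: coeff_mat_def)

lemma var_coeffs_coeff_mat: "var_coeffs d (coeff_mat d \<theta>)"
  by standard (rule coeff_mat_lower)

lemma coeff_mat_polyfuns: "i < d \<Longrightarrow> j < d \<Longrightarrow> (\<lambda>\<theta>. coeff_mat d \<theta> k $$ (i, j)) \<in> polyfuns"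
  by (cases "k = 0"; cases "j < i") (simp_all add: coeff_mat_def polyfuns_coord polyfuns_const)

lemma noise_var_polyfuns: "(\<lambda>\<theta>. noise_var d p \<theta> i) \<in> polyfuns"
  by (simp add: noise_var_def polyfuns_coord)

lemma inst_inv_polyfuns:
  "i < d \<Longrightarrow> j < d \<Longrightarrow> (\<lambda>\<theta>. inst_inv d (coeff_mat d \<theta>) i j) \<in> polyfuns"
  unfolding inst_inv_def inst_mat_def
  by (intro polyfuns_adj polyfuns_diff polyfuns_const coeff_mat_polyfuns)

lemma companion_polyfuns:
  assumes "a \<in> states d p" "b \<in> states d p"
  shows "(\<lambda>\<theta>. companion d p (coeff_mat d \<theta>) a b) \<in> polyfuns"
proof -
  obtain l i l' j where ab: "a = (l, i)" "b = (l', j)" "i < d" "j < d"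
    using assms by (auto simp: states_def)
  have "(\<lambda>\<theta>. \<Sum>m<d. inst_inv d (coeff_mat d \<theta>) i m * coeff_mat d \<theta> (Suc l') $$ (m, j)) \<in> polyfuns"
    using ab by (intro polyfuns_sum polyfuns_mult inst_inv_polyfuns coeff_mat_polyfuns) auto
  then show ?thesis
    unfolding ab companion_def
    by (cases "l = 0"; cases "l' < p") (auto simp: polyfuns_const)
qed

lemma noise_load_polyfuns:
  assumes "a \<in> states d p" "j < d"
  shows "(\<lambda>\<theta>. noise_load d (coeff_mat d \<theta>) a j) \<in> polyfuns"
  using assms by (cases "fst a = 0") (auto simp: noise_load_def states_def polyfuns_const inst_inv_polyfuns)

text \<open>The common denominator of all autocovariances is the determinant of the identity minus
  the Kronecker square of the companion matrix; powers of that matrix, needed for larger lags, only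
  change the numerators. Under stability the determinant is nonzero, because a kernel vector would
  be fixed by decaying powers.\<close>

lemma autocov_rational:
  "\<exists>D n. D \<in> polyfuns \<and> (\<forall>u\<in>nodes d. \<forall>v\<in>nodes d. n u v \<in> polyfuns) \<and>
    (\<forall>\<theta>. stable_coeffs d p (coeff_mat d \<theta>) \<longrightarrow> D \<theta> \<noteq> 0 \<and> (\<forall>u\<in>nodes d. \<forall>v\<in>nodes d.
      D \<theta> * autocov d p (coeff_mat d \<theta>) (noise_var d p \<theta>) u v = n u v \<theta>))"
proof -
  define J where "J = states d p"
  define F where "F \<theta> = companion d p (coeff_mat d \<theta>)" for \<theta>
  define M where "M \<theta> x y = F \<theta> (fst x) (fst y) * F \<theta> (snd x) (snd y)" for \<theta> x y
  define m where "m \<theta> x y = (if x = y then 1 else 0) - M \<theta> x y" for \<theta> and x y :: "(nat \<times> nat) \<times> (nat \<times> nat)"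
  define q where "q \<theta> x = (\<Sum>j<d. noise_var d p \<theta> j * noise_load d (coeff_mat d \<theta>) (fst x) j
      * noise_load d (coeff_mat d \<theta>) (snd x) j)" for \<theta> x
  have J: "finite J" by (simp add: J_def finite_states)
  have F_poly: "(\<lambda>\<theta>. F \<theta> a b) \<in> polyfuns" if "a \<in> J" "b \<in> J" for a b
    unfolding F_def using that by (intro companion_polyfuns) (auto simp: J_def)
  have m_poly: "(\<lambda>\<theta>. m \<theta> x y) \<in> polyfuns" if "x \<in> J \<times> J" "y \<in> J \<times> J" for x y
    unfolding m_def M_def using that by (intro polyfuns_diff polyfuns_const polyfuns_mult F_poly) auto
  have q_poly: "(\<lambda>\<theta>. q \<theta> x) \<in> polyfuns" if "x \<in> J \<times> J" for x
    unfolding q_def using that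
    by (intro polyfuns_sum polyfuns_mult noise_var_polyfuns noise_load_polyfuns) (auto simp: J_def)
  have m_apply: "(\<Sum>y\<in>J \<times> J. m \<theta> x y * z y) = z x - (\<Sum>y\<in>J \<times> J. M \<theta> x y * z y)" if "x \<in> J \<times> J" for \<theta> x z
  proof -
    have "(\<Sum>y\<in>J \<times> J. m \<theta> x y * z y) = (\<Sum>y\<in>J \<times> J. (if y = x then z y else 0) - M \<theta> x y * z y)"
      by (rule sum.cong[OF refl]) (auto simp: m_def left_diff_distrib)
    then show ?thesis using that J by (simp add: sum_subtractf)
  qed
  obtain D N where D: "D \<in> polyfuns" and N: "\<forall>x\<in>J \<times> J. N x \<in> polyfuns"
    and sol: "\<forall>\<theta> z. (\<forall>x\<in>J \<times> J. (\<Sum>y\<in>J \<times> J. m \<theta> x y * z y) = q \<theta> x) \<longrightarrow> (\<forall>x\<in>J \<times> J. D \<theta> * z x = N x \<theta>)"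
    and inj: "\<forall>\<theta>. (\<forall>z. (\<forall>x\<in>J \<times> J. (\<Sum>y\<in>J \<times> J. m \<theta> x y * z y) = 0) \<longrightarrow> (\<forall>x\<in>J \<times> J. z x = 0)) \<longrightarrow> D \<theta> \<noteq> 0"
    by (rule linear_system_polyfuns[of "J \<times> J" m q, THEN exE])
      (simp add: J, erule (1) m_poly, erule q_poly, elim exE conjE, rule that, assumption+)
  define c where "c k i i' \<theta> = (\<Sum>b\<in>J. fpow J (F \<theta>) k (0, i) b * N (b, (0, i')) \<theta>)" for k i i' \<theta>
  \<comment> \<open>The formula in \<open>c\<close> covers non-negative lags; the remaining ones
    follow by symmetry of the autocovariance.\<close>
  define n where "n u v = (if snd v \<le> snd u then c (nat (snd u - snd v)) (fst u) (fst v)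
      else c (nat (snd v - snd u)) (fst v) (fst u))" for u v :: "nat \<times> int"
  have c_poly: "c k i i' \<in> polyfuns" if "i < d" "i' < d" for k i i'
    unfolding c_def using that by (intro polyfuns_sum polyfuns_mult fpow_polyfuns F_poly N[rule_format]) (auto simp: J_def states_def)
  have n_poly: "n u v \<in> polyfuns" if "u \<in> nodes d" "v \<in> nodes d" for u v
    using that c_poly by (auto simp: n_def nodes_def)
  have D_nonzero: "D \<theta> \<noteq> 0" if stable: "stable_coeffs d p (coeff_mat d \<theta>)" for \<theta>
  proof (rule inj[THEN spec, THEN mp], intro allI impI ballI)
    fix z x' assume z: "\<forall>x\<in>J \<times> J. (\<Sum>y\<in>J \<times> J. m \<theta> x y * z y) = 0" and x': "x' \<in> J \<times> J"
    interpret var_coeffs d p "coeff_mat d \<theta>" by (rule var_coeffs_coeff_mat)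
    obtain C r where Cr: "0 \<le> C" "0 < r" "r < 1"
      "\<And>k a b. a \<in> J \<Longrightarrow> b \<in> J \<Longrightarrow> \<bar>fpow J (F \<theta>) k a b\<bar> \<le> C * r ^ k"
      using stable_imp_fpow_decay[OF stable] unfolding J_def F_def by blast
    have fix_z: "z x = (\<Sum>y\<in>J \<times> J. M \<theta> x y * z y)" if "x \<in> J \<times> J" for x
      using bspec[OF z that] m_apply[OF that, of \<theta> z] by simp
    have bound: "\<bar>z x\<bar> \<le> r ^ k * (C * C * (\<Sum>y\<in>J \<times> J. \<bar>z y\<bar>))" if x: "x \<in> J \<times> J" for x k
    proof -
      have pow: "\<bar>fpow (J \<times> J) (M \<theta>) k x y\<bar> \<le> C * r ^ k * C" if y: "y \<in> J \<times> J" for y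
      proof -
        have "fpow (J \<times> J) (M \<theta>) k x y = fpow J (F \<theta>) k (fst x) (fst y) * fpow J (F \<theta>) k (snd x) (snd y)"
          using fpow_product[of "fst x" J "snd x" "fst y" "snd y" "F \<theta>" k] x y
          unfolding M_def by (simp add: mem_Times_iff)
        also have "\<bar>\<dots>\<bar> \<le> (C * r ^ k) * (C * r ^ k)"
          unfolding abs_mult using Cr x y by (intro mult_mono) (auto simp: mem_Times_iff)
        also have "\<dots> \<le> (C * r ^ k) * (C * 1)"
          using Cr by (intro mult_left_mono power_le_one) auto
        finally show ?thesis by simp
      qed
      have "\<bar>z x\<bar> = \<bar>\<Sum>y\<in>J \<times> J. fpow (J \<times> J) (M \<theta>) k x y * z y\<bar>"
        using fpow_fixpoint[OF _ fix_z x, of k] J by simp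
      also have "\<dots> \<le> (\<Sum>y\<in>J \<times> J. \<bar>fpow (J \<times> J) (M \<theta>) k x y\<bar> * \<bar>z y\<bar>)"
        unfolding abs_mult[symmetric] by (rule sum_abs)
      also have "\<dots> \<le> (\<Sum>y\<in>J \<times> J. C * r ^ k * C * \<bar>z y\<bar>)"
        using pow by (intro sum_mono mult_right_mono) auto
      finally show ?thesis by (simp add: sum_distrib_left mult_ac)
    qed
    show "z x' = 0"
    proof -
      have "(\<lambda>k. r ^ k * (C * C * (\<Sum>y\<in>J \<times> J. \<bar>z y\<bar>))) \<longlonglongrightarrow> 0 * (C * C * (\<Sum>y\<in>J \<times> J. \<bar>z y\<bar>))"
        using Cr by (intro tendsto_intros LIMSEQ_power_zero) auto
      then have "\<bar>z x'\<bar> \<le> 0 * (C * C * (\<Sum>y\<in>J \<times> J. \<bar>z y\<bar>))"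
        by (rule LIMSEQ_le_const) (use bound[OF x'] in auto)
      then show ?thesis by simp
    qed
  qed
  have n_eq: "D \<theta> * autocov d p (coeff_mat d \<theta>) (noise_var d p \<theta>) u v = n u v \<theta>"
    if stable: "stable_coeffs d p (coeff_mat d \<theta>)" and uv: "u \<in> nodes d" "v \<in> nodes d" for \<theta> u v
  proof -
    interpret stable_var d p "coeff_mat d \<theta>" "noise_var d p \<theta>"
      by (intro stable_var.intro var_coeffs_coeff_mat stable_var_axioms.intro stable)
    have system: "(\<Sum>y\<in>J \<times> J. m \<theta> x y * (case y of (a, b) \<Rightarrow> state_cov a b)) = q \<theta> x" if x: "x \<in> J \<times> J" for x
    proof -
      obtain a b where ab: "x = (a, b)" "a \<in> J" "b \<in> J" using x by auto
      have "state_cov a b = (\<Sum>c\<in>J. \<Sum>e\<in>J. F \<theta> a c * F \<theta> b e * state_cov c e) + q \<theta> x"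
        using state_cov_fixpoint[of a b] ab by (simp add: J_def F_def q_def)
      then show ?thesis
        unfolding m_apply[OF x] by (simp add: ab M_def sum.cartesian_product case_prod_beta)
    qed
    have N_eq: "D \<theta> * state_cov a b = N (a, b) \<theta>" if "a \<in> J" "b \<in> J" for a b
      using bspec[OF sol[THEN spec, THEN spec, THEN mp, OF ballI[OF system]], of "(a, b)"] that by simp
    have lag: "D \<theta> * \<Gamma> (i, t + int k) (i', t) = c k i i' \<theta>" if "i < d" "i' < d" for i i' t k
    proof -
      have "D \<theta> * \<Gamma> (i, t + int k) (i', t) = (\<Sum>b\<in>J. fpow J (F \<theta>) k (0, i) b * (D \<theta> * state_cov b (0, i')))"
        unfolding autocov_state_cov[OF that] J_def F_def sum_distrib_left by (simp add: mult_ac)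
      also have "\<dots> = c k i i' \<theta>"
        unfolding c_def using that by (intro sum.cong refl) (simp add: N_eq J_def states_def)
      finally show ?thesis .
    qed
    obtain i t i' t' where it: "u = (i, t)" "v = (i', t')" "i < d" "i' < d"
      using uv by (auto simp: nodes_def)
    show ?thesis
    proof (cases "t' \<le> t")
      case True
      then show ?thesis using lag[OF it(3,4), of t' "nat (t - t')"] by (simp add: it n_def)
    next
      case False
      then show ?thesis using lag[OF it(4,3), of t "nat (t' - t)"] by (simp add: it n_def autocov_sym)
    qed
  qed
  show ?thesis
    by (intro exI[of _ D] exI[of _ n]) (simp add: D n_poly D_nonzero n_eq)
qed


section \<open>A parameter with faithful distribution\<close>

text \<open>Each application of the equation halves the lower bound, since the weights sum to at
  most 1/2 and the diagonal is at least 1. This replaces the evaluation at a minimiser, which need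
  not exist on an infinite \<open>V\<close>.\<close>

lemma max_principle_nonneg:
  fixes g :: "'v \<Rightarrow> real"
  assumes lower: "\<And>v. v \<in> V \<Longrightarrow> - K \<le> g v"
    and eq: "\<And>v. v \<in> V \<Longrightarrow> v \<notin> B \<Longrightarrow> D v * g v = q v + (\<Sum>u\<in>nb v. N v u * g u)"
    and D: "\<And>v. 1 \<le> D v" and q: "\<And>v. v \<in> V \<Longrightarrow> v \<notin> B \<Longrightarrow> 0 \<le> q v"
    and nb: "\<And>v. v \<in> V \<Longrightarrow> nb v \<subseteq> V"
    and N: "\<And>v u. v \<in> V \<Longrightarrow> u \<in> nb v \<Longrightarrow> 0 \<le> N v u" "\<And>v. v \<in> V \<Longrightarrow> (\<Sum>u\<in>nb v. N v u) \<le> 1 / 2"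
    and B: "\<And>v. v \<in> V \<Longrightarrow> v \<in> B \<Longrightarrow> g v = 0"
    and v: "v \<in> V"
  shows "0 \<le> g v"
proof -
  \<comment> \<open>The maximum with 0 makes the lower bound - K' hold trivially wherever
    \<open>g\<close> is non-negative, in particular on \<open>B\<close>.\<close>
  define K' where "K' = max K 0"
  have *: "- (K' * (1 / 2) ^ n) \<le> g v" if "v \<in> V" for n v
    using that
  proof (induction n arbitrary: v)
    case 0
    then show ?case using lower[of v] by (simp add: K'_def)
  next
    case (Suc n)
    let ?e = "K' * (1 / 2) ^ n"
    have e: "0 \<le> ?e" by (simp add: K'_def)
    show ?case
    proof (cases "v \<in> B \<or> 0 \<le> g v")
      case True
      then show ?thesis using B[of v] Suc.prems e by auto
    next
      case False
      have "(\<Sum>u\<in>nb v. N v u * (- ?e)) \<le> (\<Sum>u\<in>nb v. N v u * g u)"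
        using Suc.IH nb[OF Suc.prems] N(1)[OF Suc.prems] by (intro sum_mono mult_left_mono) auto
      moreover have "(\<Sum>u\<in>nb v. N v u * (- ?e)) = (\<Sum>u\<in>nb v. N v u) * (- ?e)"
        by (simp only: sum_distrib_right)
      moreover have "1 / 2 * (- ?e) \<le> (\<Sum>u\<in>nb v. N v u) * (- ?e)"
        using N(2)[OF Suc.prems] e by (intro mult_right_mono_neg) auto
      ultimately have "1 / 2 * (- ?e) \<le> D v * g v"
        using eq[OF Suc.prems] q[OF Suc.prems] False by simp
      also have "\<dots> \<le> 1 * g v"
        using False D[of v] by (intro mult_right_mono_neg) auto
      finally show ?thesis by simp
    qed
  qed
  have "(\<lambda>n. - (K' * (1 / 2) ^ n)) \<longlonglongrightarrow> - (K' * 0)"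
    by (intro tendsto_intros LIMSEQ_power_zero) simp
  then have "- (K' * 0) \<le> g v"
    by (rule LIMSEQ_le_const2) (use *[OF v] in auto)
  then show ?thesis by simp
qed

text \<open>With all terms non-negative, one positive neighbour makes a value positive; this is
  iterated along the walk, starting at the source \<open>q c\<close>.\<close>

lemma max_principle_pos:
  fixes g :: "'v \<Rightarrow> real"
  assumes nonneg: "\<And>v. v \<in> V \<Longrightarrow> 0 \<le> g v"
    and eq: "\<And>v. v \<in> V \<Longrightarrow> v \<notin> B \<Longrightarrow> D v * g v = q v + (\<Sum>u\<in>nb v. N v u * g u)"
    and D: "\<And>v. 1 \<le> D v" and q: "\<And>v. v \<in> V \<Longrightarrow> v \<notin> B \<Longrightarrow> 0 \<le> q v"
    and nb: "\<And>v. v \<in> V \<Longrightarrow> nb v \<subseteq> V" "\<And>v. finite (nb v)"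
    and N: "\<And>v u. v \<in> V \<Longrightarrow> u \<in> nb v \<Longrightarrow> 0 < N v u"
    and c: "c \<in> V" "c \<notin> B" "0 < q c"
    and walk: "(\<lambda>u v. u \<in> nb v \<and> v \<in> V \<and> v \<notin> B)\<^sup>*\<^sup>* c a"
  shows "0 < g a"
proof -
  have sum_nonneg: "0 \<le> (\<Sum>u\<in>nb v. N v u * g u)" if "v \<in> V" for v
    using that nb nonneg N by (intro sum_nonneg mult_nonneg_nonneg) (auto intro: less_imp_le)
  have pos: "0 < g v" if "0 < D v * g v" for v
    using that D[of v] by (simp add: zero_less_mult_iff)
  from walk have "0 < g a \<and> a \<in> V"
  proof induction
    case base
    have "0 < D c * g c"
      using eq[of c] sum_nonneg[of c] c by simp
    then show ?case using pos c by blast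
  next
    case (step u v)
    then have "0 < N v u * g u"
      using N by simp
    also have "\<dots> \<le> (\<Sum>u\<in>nb v. N v u * g u)"
      using step nb nonneg N by (intro member_le_sum mult_nonneg_nonneg) (auto intro: less_imp_le)
    finally have "0 < D v * g v"
      using eq[of v] q[of v] step by simp
    then show ?case using pos step by blast
  qed
  then show ?thesis by simp
qed

text \<open>With all coefficients equal to a small \<open>\<delta> > 0\<close>, the precision operator
  \<open>(I - A)\<^sup>T (I - A)\<close> of the process has off-diagonal entries \<open>-\<delta> + O(\<delta>\<^sup>2) < 0\<close> along the edges and
  \<open>0\<close> elsewhere, because there are no unshielded colliders. So a maximum principle holds for the
  conditional covariances.\<close>

locale equal_coeffs = stable_var +
  fixes \<delta> :: real
  assumes \<delta>: "0 < \<delta>" "4 * \<delta> * (real (Suc p) * real d) \<le> 1"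
    and coeff: "\<And>k i j. k \<le> p \<Longrightarrow> i < d \<Longrightarrow> j < d \<Longrightarrow> A k $$ (i, j) = (if k = 0 \<longrightarrow> j < i then \<delta> else 0)"
    and noise: "\<And>i. i < d \<Longrightarrow> \<sigma>2 i = \<delta>"
begin

abbreviation "E0 \<equiv> lag_edges d p"

definition parents :: "nat \<times> int \<Rightarrow> (nat \<times> int) set" where
  "parents v = {u. (u, v) \<in> E0}"

definition children :: "nat \<times> int \<Rightarrow> (nat \<times> int) set" where
  "children v = {w. (v, w) \<in> E0}"

definition neighbours :: "nat \<times> int \<Rightarrow> (nat \<times> int) set" where
  "neighbours v = parents v \<union> children v"

text \<open>The negated off-diagonal entry of (I - A)^T (I - A) at a neighbour \<open>u\<close> of
  \<open>v\<close>: \<delta> from the single edge joining them, minus \<delta>^2 for each common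
  child.\<close>

definition weight :: "nat \<times> int \<Rightarrow> nat \<times> int \<Rightarrow> real" where
  "weight v u = \<delta> - \<delta>\<^sup>2 * real (card {w \<in> children v. u \<in> parents w})"

lemma parents_image:
  "i < d \<Longrightarrow> parents (i, t) = (\<lambda>(k, j). (j, t - int k)) ` {(k, j) \<in> J. k = 0 \<longrightarrow> j < i}"
  by (force simp: parents_def lag_edges_def states_def)

lemma children_image:
  "i < d \<Longrightarrow> children (i, t) = (\<lambda>(k, j). (j, t + int k)) ` {(k, j) \<in> J. k = 0 \<longrightarrow> i < j}"
proof -
  assume i: "i < d"
  have "((i, t), (j, t + int k)) \<in> E0 \<longleftrightarrow> j < d \<and> k \<le> p \<and> (k = 0 \<longrightarrow> i < j)" for k j
    using i by (auto simp: lag_edges_def)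
  note edge = this
  show ?thesis
  proof (intro equalityI subsetI)
    fix w assume w: "w \<in> children (i, t)"
    obtain j s where js: "w = (j, s)" by (cases w)
    obtain k where k: "s = t + int k"
      using w js by (auto simp: children_def lag_edges_def)
    then have "(k, j) \<in> {(k, j) \<in> J. k = 0 \<longrightarrow> i < j}"
      using w js edge by (auto simp: children_def states_def)
    then show "w \<in> (\<lambda>(k, j). (j, t + int k)) ` {(k, j) \<in> J. k = 0 \<longrightarrow> i < j}"
      by (rule rev_image_eqI) (simp add: js k)
  next
    fix w assume "w \<in> (\<lambda>(k, j). (j, t + int k)) ` {(k, j) \<in> J. k = 0 \<longrightarrow> i < j}"
    then show "w \<in> children (i, t)"
      using edge by (auto simp: children_def states_def)
  qed
qed

lemma card_states: "card J = Suc p * d"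
  by (simp add: states_def)

lemma
  assumes "v \<in> nodes d"
  shows finite_parents: "finite (parents v)" and card_parents: "card (parents v) \<le> Suc p * d"
    and finite_children: "finite (children v)" and card_children: "card (children v) \<le> Suc p * d"
proof -
  obtain i t where v: "v = (i, t)" "i < d" using assms by (auto simp: nodes_def)
  have fin: "finite {(k, j) \<in> J. Q k j}" and le: "card {(k, j) \<in> J. Q k j} \<le> Suc p * d" for Q
    using finite_states[of d p] card_mono[OF finite_states, of "{(k, j) \<in> J. Q k j}" d p] card_states
    by (auto intro: finite_subset[of _ J])
  show "finite (parents v)" "finite (children v)"
    unfolding v parents_image[OF v(2)] children_image[OF v(2)] by (auto intro: fin)
  show "card (parents v) \<le> Suc p * d" "card (children v) \<le> Suc p * d"
    unfolding v parents_image[OF v(2)] children_image[OF v(2)]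
    by (rule order_trans[OF card_image_le[OF fin] le])+
qed

lemma E0_nodes: "(u, v) \<in> E0 \<Longrightarrow> u \<in> nodes d \<and> v \<in> nodes d"
  by (auto simp: lag_edges_def nodes_def)

lemma sum_parents:
  fixes g :: "nat \<times> int \<Rightarrow> real"
  assumes i: "i < d"
  shows "(\<Sum>k\<le>p. \<Sum>j<d. A k $$ (i, j) * g (j, t - int k)) = \<delta> * (\<Sum>u\<in>parents (i, t). g u)"
proof -
  have "(\<Sum>k\<le>p. \<Sum>j<d. A k $$ (i, j) * g (j, t - int k))
      = (\<Sum>b\<in>J. case b of (k, j) \<Rightarrow> if k = 0 \<longrightarrow> j < i then \<delta> * g (j, t - int k) else 0)"
    unfolding sum_states using i by (intro sum.cong refl) (auto simp: coeff)
  also have "\<dots> = (\<Sum>b\<in>{(k, j) \<in> J. k = 0 \<longrightarrow> j < i}. \<delta> * g (case b of (k, j) \<Rightarrow> (j, t - int k)))"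
    using finite_states[of d p] by (intro sum.mono_neutral_cong_right) (auto split: if_splits)
  also have "\<dots> = \<delta> * (\<Sum>u\<in>parents (i, t). g u)"
    unfolding parents_image[OF i] sum_distrib_left
    by (subst sum.reindex) (auto simp: inj_on_def o_def)
  finally show ?thesis .
qed

lemma sum_children:
  fixes g :: "nat \<times> int \<Rightarrow> real"
  assumes i: "i < d"
  shows "(\<Sum>k\<le>p. \<Sum>j<d. g (j, t + int k) * A k $$ (j, i)) = \<delta> * (\<Sum>u\<in>children (i, t). g u)"
proof -
  have "(\<Sum>k\<le>p. \<Sum>j<d. g (j, t + int k) * A k $$ (j, i))
      = (\<Sum>b\<in>J. case b of (k, j) \<Rightarrow> if k = 0 \<longrightarrow> i < j then \<delta> * g (j, t + int k) else 0)"
    unfolding sum_states using i by (intro sum.cong refl) (auto simp: coeff)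
  also have "\<dots> = (\<Sum>b\<in>{(k, j) \<in> J. k = 0 \<longrightarrow> i < j}. \<delta> * g (case b of (k, j) \<Rightarrow> (j, t + int k)))"
    using finite_states[of d p] by (intro sum.mono_neutral_cong_right) (auto split: if_splits)
  also have "\<dots> = \<delta> * (\<Sum>u\<in>children (i, t). g u)"
    unfolding children_image[OF i] sum_distrib_left
    by (subst sum.reindex) (auto simp: inj_on_def o_def)
  finally show ?thesis .
qed

text \<open>For g = \<Gamma> x, \<open>autocov_rec\<close> reads (I - A) g = e and
  \<open>ma_coeff_corec\<close> reads (I - A)^T e = \<delta> x; eliminating \<open>e\<close> yields
  the precision operator. All sums are finite, as \<open>x\<close> is supported in \<open>U\<close>
  and nodes have finitely many parents and children.\<close>

lemma precision_equation:
  fixes x :: "nat \<times> int \<Rightarrow> real"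
  assumes U: "finite U" "U \<subseteq> nodes d" and v: "v \<in> nodes d"
  defines "g \<equiv> \<lambda>v. \<Sum>u\<in>U. \<Gamma> v u * x u"
  shows "(1 + \<delta>\<^sup>2 * real (card (children v))) * g v
    = \<delta> * (if v \<in> U then x v else 0) + (\<Sum>u\<in>neighbours v. weight v u * g u)"
proof -
  define e where "e w = \<delta> * (\<Sum>u\<in>U. \<psi> u w * x u)" for w
  have g_rec: "g w = \<delta> * (\<Sum>u\<in>parents w. g u) + e w" if w: "w \<in> nodes d" for w
  proof -
    obtain i t where it: "w = (i, t)" "i < d" using w by (auto simp: nodes_def)
    have "g w = (\<Sum>u\<in>U. (\<delta> * (\<Sum>u'\<in>parents w. \<Gamma> u' u) + \<delta> * \<psi> u w) * x u)"
      unfolding g_def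
    proof (rule sum.cong[OF refl])
      fix u assume "u \<in> U"
      then have "fst u < d" using U by (auto simp: nodes_def)
      then show "\<Gamma> w u * x u = (\<delta> * (\<Sum>u'\<in>parents w. \<Gamma> u' u) + \<delta> * \<psi> u w) * x u"
        using autocov_rec[OF it(2), of u t] sum_parents[OF it(2), of "\<lambda>u'. \<Gamma> u' u" t] noise[OF it(2)]
        by (simp add: it)
    qed
    also have "\<dots> = \<delta> * (\<Sum>u\<in>U. (\<Sum>u'\<in>parents w. 1 * \<Gamma> u' u) * x u) + e w"
      by (simp only: e_def distrib_right sum.distrib mult.assoc sum_distrib_left[symmetric] mult_1)
    also have "(\<Sum>u\<in>U. (\<Sum>u'\<in>parents w. 1 * \<Gamma> u' u) * x u) = (\<Sum>u'\<in>parents w. 1 * (\<Sum>u\<in>U. \<Gamma> u' u * x u))"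
      by (rule sum_mult_swap[symmetric])
    finally show ?thesis by (simp add: g_def)
  qed
  have e_rec: "e v = \<delta> * (\<Sum>w\<in>children v. e w) + \<delta> * (if v \<in> U then x v else 0)"
  proof -
    obtain i t where it: "v = (i, t)" "i < d" using v by (auto simp: nodes_def)
    have "(\<Sum>u\<in>U. \<psi> u v * x u) = (\<Sum>u\<in>U. (if u = v then x u else 0) + (\<delta> * (\<Sum>w\<in>children v. \<psi> u w)) * x u)"
    proof (rule sum.cong[OF refl])
      fix u assume "u \<in> U"
      then obtain i' t' where u: "u = (i', t')" "i' < d" using U by (auto simp: nodes_def)
      show "\<psi> u v * x u = (if u = v then x u else 0) + (\<delta> * (\<Sum>w\<in>children v. \<psi> u w)) * x u"
        using ma_coeff_corec[OF u(2) it(2), of t' t] sum_children[OF it(2), of "\<lambda>w. \<psi> u w" t]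
        by (auto simp: it u distrib_right)
    qed
    also have "\<dots> = (if v \<in> U then x v else 0) + \<delta> * (\<Sum>u\<in>U. (\<Sum>w\<in>children v. 1 * \<psi> u w) * x u)"
      using U(1) by (simp only: sum.distrib mult.assoc sum_distrib_left[symmetric] mult_1 sum.delta)
    also have "(\<Sum>u\<in>U. (\<Sum>w\<in>children v. 1 * \<psi> u w) * x u) = (\<Sum>w\<in>children v. 1 * (\<Sum>u\<in>U. \<psi> u w * x u))"
      by (rule sum_mult_swap[symmetric])
    finally show ?thesis
      by (simp add: e_def distrib_left sum_distrib_left)
  qed
  have fin: "finite (parents v)" "finite (children v)" "finite (neighbours v)"
    using finite_parents[OF v] finite_children[OF v] by (auto simp: neighbours_def)
  have children_nodes: "w \<in> nodes d" if "w \<in> children v" for w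
    using that E0_nodes unfolding children_def by blast
  have v_notin: "v \<notin> neighbours v"
    using lag_edges_asym[of v v d p] by (auto simp: neighbours_def parents_def children_def)
  \<comment> \<open>Any other parent of a child of \<open>v\<close> is adjacent to \<open>v\<close>,
    because no collider is unshielded; so the second-order terms stay within the neighbourhood of
    \<open>v\<close>.\<close>
  have grandparents: "(\<Sum>u\<in>parents w. g u) = g v + (\<Sum>u\<in>neighbours v. if u \<in> parents w then g u else 0)"
    if w: "w \<in> children v" for w
  proof -
    have "v \<in> parents w" using w by (simp add: children_def parents_def)
    moreover have "finite (parents w)" using finite_parents[OF children_nodes[OF w]] .
    ultimately have "(\<Sum>u\<in>parents w. g u) = g v + (\<Sum>u\<in>parents w - {v}. g u)"
      by (simp add: sum.remove)
    also have "(\<Sum>u\<in>parents w - {v}. g u) = (\<Sum>u\<in>neighbours v. if u \<in> parents w then g u else 0)"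
    proof (rule sum.mono_neutral_cong_left[OF fin(3)])
      show "parents w - {v} \<subseteq> neighbours v"
        using lag_edges_shielded[of v w d p] w
        by (fastforce simp: neighbours_def parents_def children_def adjacent_def)
    qed (use v_notin in auto)
    finally show ?thesis .
  qed
  have "(\<Sum>w\<in>children v. \<Sum>u\<in>parents w. g u)
      = (\<Sum>w\<in>children v. g v + (\<Sum>u\<in>neighbours v. if u \<in> parents w then g u else 0))"
    by (rule sum.cong[OF refl grandparents])
  also have "\<dots> = real (card (children v)) * g v
      + (\<Sum>u\<in>neighbours v. \<Sum>w\<in>children v. if u \<in> parents w then g u else 0)"
    unfolding sum.distrib by (subst sum.swap) simp
  also have "(\<Sum>u\<in>neighbours v. \<Sum>w\<in>children v. if u \<in> parents w then g u else 0)
      = (\<Sum>u\<in>neighbours v. real (card {w \<in> children v. u \<in> parents w}) * g u)"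
    using fin by (intro sum.cong refl) (simp add: sum.If_cases Int_def)
  finally have common: "(\<Sum>w\<in>children v. \<Sum>u\<in>parents w. g u) = real (card (children v)) * g v
      + (\<Sum>u\<in>neighbours v. real (card {w \<in> children v. u \<in> parents w}) * g u)" .
  \<comment> \<open>By asymmetry each neighbour is joined to \<open>v\<close> by exactly one edge
    and contributes \<delta> only once.\<close>
  have "parents v \<inter> children v = {}"
    using lag_edges_asym[of _ v d p] by (auto simp: parents_def children_def simp del: split_paired_All)
  then have nb_sum: "(\<Sum>u\<in>neighbours v. g u) = (\<Sum>u\<in>parents v. g u) + (\<Sum>u\<in>children v. g u)"
    unfolding neighbours_def using fin by (intro sum.union_disjoint)
  have "(\<Sum>w\<in>children v. e w) = (\<Sum>w\<in>children v. g w - \<delta> * (\<Sum>u\<in>parents w. g u))"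
    using g_rec children_nodes by (intro sum.cong refl) simp
  also have "\<dots> = (\<Sum>w\<in>children v. g w) - \<delta> * (\<Sum>w\<in>children v. \<Sum>u\<in>parents w. g u)"
    by (simp add: sum_subtractf sum_distrib_left)
  finally have e_children: "(\<Sum>w\<in>children v. e w)
      = (\<Sum>w\<in>children v. g w) - \<delta> * (\<Sum>w\<in>children v. \<Sum>u\<in>parents w. g u)" .
  have "g v = \<delta> * (\<Sum>u\<in>neighbours v. g u) - \<delta> * (\<delta> * (\<Sum>w\<in>children v. \<Sum>u\<in>parents w. g u))
      + \<delta> * (if v \<in> U then x v else 0)"
    using g_rec[OF v] e_rec nb_sum unfolding e_children by (simp add: algebra_simps)
  moreover have "(\<Sum>u\<in>neighbours v. weight v u * g u) = \<delta> * (\<Sum>u\<in>neighbours v. g u)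
      - \<delta>\<^sup>2 * (\<Sum>u\<in>neighbours v. real (card {w \<in> children v. u \<in> parents w}) * g u)"
    by (simp add: weight_def left_diff_distrib sum_subtractf sum_distrib_left mult.assoc)
  ultimately show ?thesis
    unfolding common by (simp add: algebra_simps power2_eq_square)
qed

text \<open>At most (p+1) d children are shared, and \<delta> times this number is at most
  1/4.\<close>

lemma weight_pos:
  assumes v: "v \<in> nodes d"
  shows "0 < weight v u"
proof -
  have "card {w \<in> children v. u \<in> parents w} \<le> card (children v)"
    by (rule card_mono[OF finite_children[OF v]]) auto
  then have "card {w \<in> children v. u \<in> parents w} \<le> Suc p * d"
    using card_children[OF v] by (rule le_trans)
  then have "real (card {w \<in> children v. u \<in> parents w}) \<le> real (Suc p) * real d"
    by (simp only: of_nat_mult[symmetric] of_nat_le_iff)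
  then have "\<delta>\<^sup>2 * real (card {w \<in> children v. u \<in> parents w}) \<le> \<delta> * (\<delta> * (real (Suc p) * real d))"
    using \<delta> by (simp add: power2_eq_square mult_left_mono)
  also have "\<dots> < \<delta> * 1"
    using \<delta> by (intro mult_strict_left_mono) auto
  finally show ?thesis by (simp add: weight_def)
qed

text \<open>There are at most (p+1) d parents and equally many children, each of weight at most
  \<delta>. This is the origin of the factor 4 in the bound on \<delta>.\<close>

lemma weight_sum:
  assumes v: "v \<in> nodes d"
  shows "(\<Sum>u\<in>neighbours v. weight v u) \<le> 1 / 2"
proof -
  have "(\<Sum>u\<in>neighbours v. weight v u) \<le> (\<Sum>u\<in>neighbours v. \<delta>)"
    by (intro sum_mono) (simp add: weight_def)
  also have "\<dots> = real (card (neighbours v)) * \<delta>"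
    by simp
  also have "\<dots> \<le> (2 * (real (Suc p) * real d)) * \<delta>"
  proof (intro mult_right_mono)
    have "card (neighbours v) \<le> Suc p * d + Suc p * d"
      unfolding neighbours_def using card_Un_le[of "parents v" "children v"] card_parents[OF v] card_children[OF v]
      by linarith
    then have "real (card (neighbours v)) \<le> real (Suc p * d + Suc p * d)"
      by (simp only: of_nat_le_iff)
    then show "real (card (neighbours v)) \<le> 2 * (real (Suc p) * real d)"
      by (simp only: of_nat_add of_nat_mult)
  qed (use \<delta> in simp)
  also have "\<dots> \<le> 1 / 2" using \<delta> by (simp add: mult_ac)
  finally show ?thesis .
qed

text \<open>The maximum principle for \<Gamma> x, which is bounded because the autocovariances are.
  Since it vanishes on \<open>B\<close> already, the sign of \<open>x\<close> is prescribed only off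
  \<open>B\<close>.\<close>

lemma cov_combination_nonneg:
  assumes U: "finite U" "U \<subseteq> nodes d"
    and x: "\<And>u. u \<in> U \<Longrightarrow> u \<notin> B \<Longrightarrow> 0 \<le> x u"
    and zero: "\<And>b. b \<in> B \<Longrightarrow> (\<Sum>u\<in>U. \<Gamma> b u * x u) = 0"
    and v: "v \<in> nodes d"
  shows "0 \<le> (\<Sum>u\<in>U. \<Gamma> v u * x u)"
proof -
  obtain K where K: "\<And>u v. fst u < d \<Longrightarrow> fst v < d \<Longrightarrow> \<bar>\<Gamma> u v\<bar> \<le> K"
    using autocov_bounded by blast
  have nodes_fst: "u \<in> nodes d \<longleftrightarrow> fst u < d" for u by (cases u) (simp add: nodes_def)
  have bound: "\<bar>\<Sum>u\<in>U. \<Gamma> v u * x u\<bar> \<le> (\<Sum>u\<in>U. K * \<bar>x u\<bar>)" if "v \<in> nodes d" for v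
  proof -
    have "\<bar>\<Sum>u\<in>U. \<Gamma> v u * x u\<bar> \<le> (\<Sum>u\<in>U. \<bar>\<Gamma> v u\<bar> * \<bar>x u\<bar>)"
      unfolding abs_mult[symmetric] by (rule sum_abs)
    also have "\<dots> \<le> (\<Sum>u\<in>U. K * \<bar>x u\<bar>)"
    proof (intro sum_mono mult_right_mono)
      show "\<bar>\<Gamma> v u\<bar> \<le> K" if "u \<in> U" for u
        using K[of v u] that \<open>v \<in> nodes d\<close> U(2) nodes_fst by blast
    qed simp
    finally show ?thesis .
  qed
  have lower: "- (\<Sum>u\<in>U. K * \<bar>x u\<bar>) \<le> (\<Sum>u\<in>U. \<Gamma> v u * x u)" if "v \<in> nodes d" for v
    using bound[OF that] by linarith
  show ?thesis
  proof (rule max_principle_nonneg[where V = "nodes d" and B = B and nb = neighbours and N = weight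
        and g = "\<lambda>v. \<Sum>u\<in>U. \<Gamma> v u * x u" and D = "\<lambda>v. 1 + \<delta>\<^sup>2 * real (card (children v))"
        and q = "\<lambda>v. \<delta> * (if v \<in> U then x v else 0)"])
    show "neighbours v \<subseteq> nodes d" for v
      using E0_nodes unfolding neighbours_def parents_def children_def by (auto; blast)
  qed (use lower precision_equation[OF U] x \<delta>(1) weight_pos weight_sum zero v in \<open>auto intro: less_imp_le\<close>)
qed

text \<open>Invertibility of the covariance block on \<open>B\<close>. With the support contained in
  \<open>B\<close>, both x and -x fall under the previous lemma, so \<Gamma> x vanishes at every
  node and the precision equation at \<open>b\<close> reduces to \<delta> x b = 0.\<close>

lemma cov_kernel_trivial:
  assumes B: "finite B" "B \<subseteq> nodes d"
    and zero: "\<And>b. b \<in> B \<Longrightarrow> (\<Sum>u\<in>B. \<Gamma> b u * x u) = 0"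
    and b: "b \<in> B"
  shows "x b = 0"
proof -
  have g: "(\<Sum>u\<in>B. \<Gamma> v u * x u) = 0" if v: "v \<in> nodes d" for v
  proof (rule antisym)
    show "0 \<le> (\<Sum>u\<in>B. \<Gamma> v u * x u)"
      by (rule cov_combination_nonneg[OF B _ zero v]) auto
    have "0 \<le> (\<Sum>u\<in>B. \<Gamma> v u * - x u)"
      by (rule cov_combination_nonneg[OF B _ _ v, where B = B]) (use zero in \<open>auto simp: sum_negf\<close>)
    then show "(\<Sum>u\<in>B. \<Gamma> v u * x u) \<le> 0"
      by (simp add: sum_negf)
  qed
  have "neighbours b \<subseteq> nodes d"
    using E0_nodes unfolding neighbours_def parents_def children_def by (auto; blast)
  then have "(\<Sum>w\<in>neighbours b. weight b w * (\<Sum>u\<in>B. \<Gamma> w u * x u)) = 0"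
    using g by (intro sum.neutral) auto
  then have "\<delta> * x b = 0"
    using precision_equation[OF B, of b x] g[of b] b B by auto
  then show ?thesis using \<delta> by simp
qed

text \<open>For \<open>x\<close> equal to 1 at \<open>c\<close> and to -h on \<open>B\<close>, the
  function \<Gamma> x is the residual covariance with \<open>c\<close>. It is zero on
  \<open>B\<close> and has the source \<delta> at \<open>c\<close>, hence is positive wherever a
  walk from \<open>c\<close> avoiding \<open>B\<close> leads.\<close>

lemma residual_cov_pos:
  assumes B: "finite B" "B \<subseteq> nodes d" and c: "c \<in> nodes d" "c \<notin> B"
    and h: "\<And>b. b \<in> B \<Longrightarrow> (\<Sum>b'\<in>B. \<Gamma> b b' * h b') = \<Gamma> b c"
    and walk: "(\<lambda>u v. adjacent E0 u v \<and> v \<notin> B)\<^sup>*\<^sup>* c a"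
  shows "(\<Sum>b\<in>B. \<Gamma> a b * h b) < \<Gamma> a c"
proof -
  define x where "x u = (if u = c then 1 else - h u)" for u
  let ?U = "insert c B"
  have U: "finite ?U" "?U \<subseteq> nodes d" using B c by auto
  have g: "(\<Sum>u\<in>?U. \<Gamma> v u * x u) = \<Gamma> v c - (\<Sum>b\<in>B. \<Gamma> v b * h b)" for v
  proof -
    have "(\<Sum>u\<in>B. \<Gamma> v u * x u) = (\<Sum>u\<in>B. - (\<Gamma> v u * h u))"
      using c by (intro sum.cong refl) (auto simp: x_def)
    then show ?thesis using B c by (simp add: x_def sum_negf)
  qed
  have zero: "(\<Sum>u\<in>?U. \<Gamma> b u * x u) = 0" if "b \<in> B" for b
    using h[OF that] g by simp
  have x: "0 \<le> x u" if "u \<in> ?U" "u \<notin> B" for u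
    using that by (auto simp: x_def)
  have "0 < (\<Sum>u\<in>?U. \<Gamma> a u * x u)"
  \<comment> \<open>Neighbourhoods are set to be empty off the node set, because finiteness is
    demanded at every point of the type.\<close>
  proof (rule max_principle_pos[where V = "nodes d" and B = B and nb = "\<lambda>v. if v \<in> nodes d then neighbours v else {}"
        and N = weight and g = "\<lambda>v. \<Sum>u\<in>?U. \<Gamma> v u * x u" and D = "\<lambda>v. 1 + \<delta>\<^sup>2 * real (card (children v))"
        and q = "\<lambda>v. \<delta> * (if v \<in> ?U then x v else 0)" and c = c])
    show "0 \<le> (\<Sum>u\<in>?U. \<Gamma> v u * x u)" if "v \<in> nodes d" for v
      by (rule cov_combination_nonneg[OF U x zero that])
    show "(1 + \<delta>\<^sup>2 * real (card (children v))) * (\<Sum>u\<in>?U. \<Gamma> v u * x u) = \<delta> * (if v \<in> ?U then x v else 0)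
        + (\<Sum>u\<in>(if v \<in> nodes d then neighbours v else {}). weight v u * (\<Sum>u'\<in>?U. \<Gamma> u u' * x u'))"
      if "v \<in> nodes d" for v
      using precision_equation[OF U that, of x] that by simp
    show "(if v \<in> nodes d then neighbours v else {}) \<subseteq> nodes d" for v
      using E0_nodes unfolding neighbours_def parents_def children_def by (auto; blast)
    show "finite (if v \<in> nodes d then neighbours v else {})" for v
      using finite_parents finite_children by (auto simp: neighbours_def)
    show "(\<lambda>u v. u \<in> (if v \<in> nodes d then neighbours v else {}) \<and> v \<in> nodes d \<and> v \<notin> B)\<^sup>*\<^sup>* c a"
      using walk
    proof (rule rtranclp_mono[THEN predicate2D, rotated])
      show "(\<lambda>u v. adjacent E0 u v \<and> v \<notin> B)
          \<le> (\<lambda>u v. u \<in> (if v \<in> nodes d then neighbours v else {}) \<and> v \<in> nodes d \<and> v \<notin> B)"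
        using E0_nodes unfolding adjacent_def neighbours_def parents_def children_def by (intro predicate2I) (auto; blast)
    qed
    show "0 \<le> \<delta> * (if v \<in> ?U then x v else 0)" if "v \<notin> B" for v
      using x[of v] that \<delta> by (auto intro!: mult_nonneg_nonneg)
  qed (use c \<delta> weight_pos in \<open>auto simp: x_def\<close>)
  then show ?thesis using g by simp
qed

end


section \<open>The law of the stationary process\<close>

lemma cmod_iexp_diff_le: "cmod (iexp x - iexp y) \<le> min 2 \<bar>x - y\<bar>"
proof -
  have "iexp x - iexp y = iexp y * (iexp (x - y) - 1)"
    by (simp add: right_diff_distrib exp_add[symmetric])
  then have "cmod (iexp x - iexp y) = cmod (iexp (x - y) - 1)"
    by (simp add: norm_mult)
  also have "\<dots> \<le> \<bar>x - y\<bar>"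
    using iexp_approx1[of "x - y" 0] by simp
  finally have "cmod (iexp x - iexp y) \<le> \<bar>x - y\<bar>" .
  moreover have "cmod (iexp x - iexp y) \<le> 2"
    using norm_triangle_ineq4[of "iexp x" "iexp y"] by simp
  ultimately show ?thesis by simp
qed

lemma char_centred_normal:
  assumes "0 < \<sigma>"
  shows "(CLINT y|density lborel (\<lambda>y. ennreal (normal_density 0 \<sigma> y)). iexp (t * y))
    = complex_of_real (exp (- (t\<^sup>2 * \<sigma>\<^sup>2) / 2))"
proof -
  have "(CLINT y|density lborel (\<lambda>y. ennreal (normal_density 0 \<sigma> y)). iexp (t * y))
      = (CLBINT y. normal_density 0 \<sigma> y *\<^sub>R iexp (t * y))"
    by (subst integral_density) auto
  also have "\<dots> = \<sigma> *\<^sub>R (CLBINT y. normal_density 0 \<sigma> (0 + \<sigma> * y) *\<^sub>R iexp (t * (0 + \<sigma> * y)))"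
    using assms lborel_integral_real_affine[of \<sigma> "\<lambda>y. normal_density 0 \<sigma> y *\<^sub>R iexp (t * y)" 0] by simp
  also have "\<dots> = (CLBINT y. std_normal_density y *\<^sub>R iexp (t * \<sigma> * y))"
  proof -
    have "\<sigma> * normal_density 0 \<sigma> (\<sigma> * y) = std_normal_density y" for y
      using assms by (simp add: normal_density_def real_sqrt_mult power_mult_distrib field_simps)
    then have "\<sigma> *\<^sub>R (normal_density 0 \<sigma> (0 + \<sigma> * y) *\<^sub>R iexp (t * (0 + \<sigma> * y)))
        = std_normal_density y *\<^sub>R iexp (t * \<sigma> * y)" for y
      by (simp add: mult.assoc)
    then show ?thesis
      by (subst integral_scaleR_right[symmetric]) (rule Bochner_Integration.integral_cong[OF refl])
  qed
  also have "\<dots> = char std_normal_distribution (t * \<sigma>)"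
    unfolding char_def by (subst integral_density) auto
  also have "\<dots> = complex_of_real (exp (- (t\<^sup>2 * \<sigma>\<^sup>2) / 2))"
    by (simp add: char_std_normal_distribution power_mult_distrib)
  finally show ?thesis .
qed

lemma char_diag_normal:
  assumes "\<And>i. i < d \<Longrightarrow> 0 < \<sigma>2 i"
  shows "(CLINT x|diag_normal d \<sigma>2. iexp (\<Sum>j<d. c j * x j))
    = complex_of_real (exp (- (\<Sum>j<d. \<sigma>2 j * (c j)\<^sup>2) / 2))"
proof -
  \<comment> \<open>The standard deviation 1 at indices outside \<open>{..<d}\<close> makes every
    factor a probability measure, as the product construction asks for all indices.\<close>
  define N where "N i = density lborel (\<lambda>y. ennreal (normal_density 0 (if i < d then sqrt (\<sigma>2 i) else 1) y))" for i
  have N: "prob_space (N i)" for i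
    unfolding N_def by (rule prob_space_normal_density) (use assms in auto)
  interpret product_sigma_finite N
    unfolding product_sigma_finite_def using N prob_space_imp_sigma_finite by blast
  have N_eq: "N i = density lborel (\<lambda>y. ennreal (normal_density 0 (sqrt (\<sigma>2 i)) y))" if "i < d" for i
    using that by (simp add: N_def)
  have "diag_normal d \<sigma>2 = Pi\<^sub>M {..<d} N"
    unfolding diag_normal_def by (rule PiM_cong) (simp_all add: N_eq)
  then have "(CLINT x|diag_normal d \<sigma>2. iexp (\<Sum>j<d. c j * x j)) = (CLINT x|Pi\<^sub>M {..<d} N. \<Prod>j<d. iexp (c j * x j))"
    by (simp add: exp_sum sum_distrib_left)
  also have "\<dots> = (\<Prod>j<d. CLINT y|N j. iexp (c j * y))"
  proof (rule product_integral_prod)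
    show "integrable (N j) (\<lambda>y. iexp (c j * y))" for j
      by (intro prob_space.integrable_iexp N) (simp_all add: N_def)
  qed simp
  also have "\<dots> = (\<Prod>j<d. complex_of_real (exp (- ((c j)\<^sup>2 * \<sigma>2 j) / 2)))"
  proof (rule prod.cong[OF refl])
    fix j assume "j \<in> {..<d}"
    then have j: "j < d" by simp
    show "(CLINT y|N j. iexp (c j * y)) = complex_of_real (exp (- ((c j)\<^sup>2 * \<sigma>2 j) / 2))"
      unfolding N_eq[OF j] using assms[OF j] by (subst char_centred_normal) auto
  qed
  also have "\<dots> = complex_of_real (exp (- (\<Sum>j<d. \<sigma>2 j * (c j)\<^sup>2) / 2))"
    by (simp flip: of_real_prod exp_sum add: sum_negf sum_divide_distrib mult.commute)
  finally show ?thesis .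
qed

section \<open>Unrolling the recursion of a stationary solution\<close>

locale stationary_process = stable_var d p A \<sigma>2 + prob_space M
  for d p A \<sigma>2 and M :: "'w measure" +
  fixes S \<epsilon> :: "int \<Rightarrow> 'w \<Rightarrow> nat \<Rightarrow> real"
  assumes process: "stationary_var_process d p A \<sigma>2 M S \<epsilon>"
    and variance_pos: "\<And>i. i < d \<Longrightarrow> 0 < \<sigma>2 i"
begin

lemma S_measurable: "i < d \<Longrightarrow> (\<lambda>\<omega>. S t \<omega> i) \<in> borel_measurable M"
proof -
  assume i: "i < d"
  have "S t \<in> M \<rightarrow>\<^sub>M Pi\<^sub>M {..<d} (\<lambda>_. borel)"
    using process by (simp add: stationary_var_process_def)
  from measurable_compose[OF this measurable_component_singleton[of i]] i
  show ?thesis by simp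
qed

lemma innovations_indep: "indep_vars (\<lambda>_. Pi\<^sub>M {..<d} (\<lambda>_. borel)) \<epsilon> UNIV"
  using process by (simp add: stationary_var_process_def)

lemma innovation_measurable: "\<epsilon> t \<in> M \<rightarrow>\<^sub>M Pi\<^sub>M {..<d} (\<lambda>_. borel)"
  using innovations_indep by (simp add: indep_vars_def)

lemma innovation_component_measurable: "j < d \<Longrightarrow> (\<lambda>\<omega>. \<epsilon> t \<omega> j) \<in> borel_measurable M"
  using measurable_compose[OF innovation_measurable measurable_component_singleton[of j]] by simp

lemma char_innovations:
  assumes "finite T"
  shows "(CLINT \<omega>|M. iexp (\<Sum>s\<in>T. \<Sum>j<d. c s j * \<epsilon> s \<omega> j))
    = complex_of_real (exp (- (\<Sum>s\<in>T. \<Sum>j<d. \<sigma>2 j * (c s j)\<^sup>2) / 2))"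
proof -
  define Y where "Y s \<omega> = (\<Sum>j<d. c s j * \<epsilon> s \<omega> j)" for s \<omega>
  have comb[measurable]: "(\<lambda>x. \<Sum>j<d. c s j * x j) \<in> borel_measurable (Pi\<^sub>M {..<d} (\<lambda>_. borel))" for s
    by (intro borel_measurable_sum borel_measurable_times borel_measurable_const measurable_component_singleton) auto
  have indep: "indep_vars (\<lambda>_. borel) Y T"
    unfolding Y_def
    by (rule indep_vars_compose2[OF indep_vars_subset[OF innovations_indep], of T "\<lambda>s x. \<Sum>j<d. c s j * x j"]) auto
  have Y_meas[measurable]: "Y s \<in> borel_measurable M" for s
    unfolding Y_def by (rule measurable_compose[OF innovation_measurable comb])
  have Y_char: "char (distr M borel (Y s)) 1 = complex_of_real (exp (- (\<Sum>j<d. \<sigma>2 j * (c s j)\<^sup>2) / 2))" for s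
  proof -
    have "char (distr M borel (Y s)) 1 = (CLINT \<omega>|M. iexp (\<Sum>j<d. c s j * \<epsilon> s \<omega> j))"
      by (simp add: char_def integral_distr Y_def[symmetric])
    also have "\<dots> = (CLINT x|distr M (Pi\<^sub>M {..<d} (\<lambda>_. borel)) (\<epsilon> s). iexp (\<Sum>j<d. c s j * x j))"
      by (rule integral_distr[symmetric, OF innovation_measurable]) measurable
    also have "distr M (Pi\<^sub>M {..<d} (\<lambda>_. borel)) (\<epsilon> s) = diag_normal d \<sigma>2"
      using process by (simp add: stationary_var_process_def)
    finally show ?thesis
      using char_diag_normal[OF variance_pos] by simp
  qed
  have "(CLINT \<omega>|M. iexp (\<Sum>s\<in>T. Y s \<omega>)) = char (distr M borel (\<lambda>\<omega>. \<Sum>s\<in>T. Y s \<omega>)) 1"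
    by (simp add: char_def integral_distr)
  also have "\<dots> = (\<Prod>s\<in>T. char (distr M borel (Y s)) 1)"
    by (rule char_distr_sum[OF indep])
  also have "\<dots> = complex_of_real (exp (- (\<Sum>s\<in>T. \<Sum>j<d. \<sigma>2 j * (c s j)\<^sup>2) / 2))"
    unfolding Y_char of_real_prod[symmetric] exp_sum[OF assms, symmetric]
    by (simp add: sum_negf sum_divide_distrib)
  finally show ?thesis by (simp add: Y_def)
qed

definition state :: "int \<Rightarrow> nat \<times> nat \<Rightarrow> 'w \<Rightarrow> real" where
  "state t a \<omega> = S (t - int (fst a)) \<omega> (snd a)"

lemma state_measurable: "a \<in> J \<Longrightarrow> state t a \<in> borel_measurable M"
  unfolding state_def by (rule S_measurable) (auto simp: states_def)

text \<open>One null set serves all times, by countability of the integers, so that the unrolling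
  can be done path by path.\<close>

lemma state_rec:
  "AE \<omega> in M. \<forall>t. \<forall>a\<in>J. state t a \<omega> = (\<Sum>b\<in>J. F a b * state (t - 1) b \<omega>) + (\<Sum>j<d. G a j * \<epsilon> t \<omega> j)"
proof -
  have "AE \<omega> in M. \<forall>t. \<forall>i<d. S t \<omega> i = (\<Sum>k\<le>p. \<Sum>j<d. A k $$ (i, j) * S (t - int k) \<omega> j) + \<epsilon> t \<omega> i"
    using process by (subst AE_all_countable) (simp add: stationary_var_process_def)
  then show ?thesis
  proof eventually_elim
    case (elim \<omega>)
    show ?case
    proof (intro allI ballI)
      fix t a assume a: "a \<in> J"
      obtain l i where li: "a = (l, i)" "l \<le> p" "i < d" using a by (auto simp: states_def)
      show "state t a \<omega> = (\<Sum>b\<in>J. F a b * state (t - 1) b \<omega>) + (\<Sum>j<d. G a j * \<epsilon> t \<omega> j)"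
      proof (cases l)
        case 0
        define R where "R m = (\<Sum>k<p. \<Sum>j<d. A (Suc k) $$ (m, j) * state (t - 1) (k, j) \<omega>)" for m
        have "S t \<omega> m = (\<Sum>j<d. A 0 $$ (m, j) * S t \<omega> j) + (R m + \<epsilon> t \<omega> m)" if "m < d" for m
        proof -
          have "t - 1 - int k = t - int (Suc k)" for k by simp
          then have "R m = (\<Sum>k<p. \<Sum>j<d. A (Suc k) $$ (m, j) * S (t - int (Suc k)) \<omega> j)"
            by (simp only: R_def state_def fst_conv snd_conv)
          moreover have "S t \<omega> m = (\<Sum>k\<le>p. \<Sum>j<d. A k $$ (m, j) * S (t - int k) \<omega> j) + \<epsilon> t \<omega> m"
            using elim that by blast
          ultimately show ?thesis
            by (simp only: sum.atMost_shift add.assoc of_nat_0 diff_zero)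
        qed
        from inst_inv_solve[OF this li(3)]
        have "S t \<omega> i = (\<Sum>m<d. L i m * R m) + (\<Sum>m<d. L i m * \<epsilon> t \<omega> m)"
          by (simp add: distrib_left sum.distrib)
        also have "(\<Sum>m<d. L i m * R m)
            = (\<Sum>k<p. \<Sum>m<d. L i m * (\<Sum>j<d. A (Suc k) $$ (m, j) * state (t - 1) (k, j) \<omega>))"
          unfolding R_def sum_distrib_left[of _ _ "{..<p}"] by (rule sum.swap)
        also have "\<dots> = (\<Sum>k<p. \<Sum>j<d. (\<Sum>m<d. L i m * A (Suc k) $$ (m, j)) * state (t - 1) (k, j) \<omega>)"
          by (simp only: sum_mult_swap)
        also have "\<dots> = (\<Sum>b\<in>J. F a b * state (t - 1) b \<omega>)"
          using companion_apply[of 0 i "\<lambda>b. state (t - 1) b \<omega>"] li 0 by simp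
        finally show ?thesis
          using li 0 by (simp add: state_def noise_load_def)
      next
        case (Suc l')
        have "(\<Sum>b\<in>J. F a b * state (t - 1) b \<omega>) = state (t - 1) (l', i) \<omega>"
          using companion_apply[of l i "\<lambda>b. state (t - 1) b \<omega>"] li Suc by simp
        then show ?thesis
          using li Suc by (simp add: state_def noise_load_def diff_diff_eq)
      qed
    qed
  qed
qed

lemma state_unroll:
  assumes rec: "\<And>t a. a \<in> J \<Longrightarrow> state t a \<omega> = (\<Sum>b\<in>J. F a b * state (t - 1) b \<omega>) + (\<Sum>j<d. G a j * \<epsilon> t \<omega> j)"
    and a: "a \<in> J"
  shows "state t a \<omega> = (\<Sum>b\<in>J. fpow J F n a b * state (t - int n) b \<omega>) + (\<Sum>m<n. \<Sum>j<d. H m a j * \<epsilon> (t - int m) \<omega> j)"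
proof (induction n)
  case 0
  have "(\<Sum>b\<in>J. fpow J F 0 a b * state t b \<omega>) = (\<Sum>b\<in>J. if b = a then state t b \<omega> else 0)"
    by (intro sum.cong) auto
  then show ?case using a finite_states[of d p] by simp
next
  case (Suc n)
  let ?s = "\<lambda>b. state (t - int (Suc n)) b \<omega>"
  have "(\<Sum>b\<in>J. fpow J F n a b * state (t - int n) b \<omega>)
      = (\<Sum>b\<in>J. fpow J F n a b * (\<Sum>c\<in>J. F b c * ?s c) + fpow J F n a b * (\<Sum>j<d. G b j * \<epsilon> (t - int n) \<omega> j))"
  proof (rule sum.cong[OF refl])
    fix b assume "b \<in> J"
    have "t - int n - 1 = t - int (Suc n)" by simp
    then show "fpow J F n a b * state (t - int n) b \<omega>
        = fpow J F n a b * (\<Sum>c\<in>J. F b c * ?s c) + fpow J F n a b * (\<Sum>j<d. G b j * \<epsilon> (t - int n) \<omega> j)"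
      using rec[OF \<open>b \<in> J\<close>, of "t - int n"] by (simp only: distrib_left)
  qed
  also have "\<dots> = (\<Sum>c\<in>J. fpow J F (Suc n) a c * ?s c) + (\<Sum>j<d. H n a j * \<epsilon> (t - int n) \<omega> j)"
    unfolding sum.distrib sum_mult_swap impulse_def fpow.simps ..
  finally show ?case
    using Suc by simp
qed

text \<open>Different nodes are unrolled back to one common time \<open>T\<close> and over one
  common range ending at \<open>c\<close>. The range may exceed the time of the node, since later
  innovations have coefficient 0.\<close>

lemma node_unroll:
  assumes rec: "\<And>t a. a \<in> J \<Longrightarrow> state t a \<omega> = (\<Sum>b\<in>J. F a b * state (t - 1) b \<omega>) + (\<Sum>j<d. G a j * \<epsilon> t \<omega> j)"
    and v: "v \<in> nodes d" and T: "T \<le> snd v" "snd v \<le> c"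
  shows "S (snd v) \<omega> (fst v) = (\<Sum>b\<in>J. fpow J F (nat (snd v - T)) (0, fst v) b * state T b \<omega>)
    + (\<Sum>s\<in>{T<..c}. \<Sum>j<d. \<psi> v (j, s) * \<epsilon> s \<omega> j)"
proof -
  obtain i t where it: "v = (i, t)" "i < d" using v by (auto simp: nodes_def)
  define n where "n = nat (t - T)"
  have t: "t = T + int n" using T it by (simp add: n_def)
  have "S t \<omega> i = state t (0, i) \<omega>" by (simp add: state_def)
  also have "\<dots> = (\<Sum>b\<in>J. fpow J F n (0, i) b * state (t - int n) b \<omega>)
      + (\<Sum>m<n. \<Sum>j<d. H m (0, i) j * \<epsilon> (t - int m) \<omega> j)"
    by (rule state_unroll[OF rec]) (use it in \<open>auto simp: states_def\<close>)
  also have "(\<Sum>m<n. \<Sum>j<d. H m (0, i) j * \<epsilon> (t - int m) \<omega> j) = (\<Sum>s\<in>{T<..t}. \<Sum>j<d. \<psi> v (j, s) * \<epsilon> s \<omega> j)"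
    by (rule sum.reindex_bij_witness[of _ "\<lambda>s. nat (t - s)" "\<lambda>m. t - int m"])
      (auto simp: t it ma_coeff_def)
  also have "\<dots> = (\<Sum>s\<in>{T<..c}. \<Sum>j<d. \<psi> v (j, s) * \<epsilon> s \<omega> j)"
  proof (rule sum.mono_neutral_left)
    show "\<forall>s\<in>{T<..c} - {T<..t}. (\<Sum>j<d. \<psi> v (j, s) * \<epsilon> s \<omega> j) = 0"
      by (intro ballI sum.neutral) (auto simp: ma_coeff_def it)
  qed (use T it in auto)
  also have "t - int n = T" using t by simp
  finally show ?thesis
    by (simp only: it(1) fst_conv snd_conv n_def)
qed

lemma process_law_map_measurable:
  "(\<lambda>\<omega>. \<lambda>v\<in>nodes d. S (snd v + h) \<omega> (fst v)) \<in> M \<rightarrow>\<^sub>M Pi\<^sub>M (nodes d) (\<lambda>_. borel)"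
  by (intro measurable_restrict S_measurable) (auto simp: nodes_def)

text \<open>This is how stationarity enters: the distribution of a single coordinate does not change
  with time.\<close>

lemma stationary_integral:
  fixes f :: "real \<Rightarrow> real"
  assumes f: "f \<in> borel_measurable borel" and i: "i < d"
  shows "(\<integral>\<omega>. f (S t \<omega> i) \<partial>M) = (\<integral>\<omega>. f (S 0 \<omega> i) \<partial>M)"
proof -
  have v: "(i, 0) \<in> nodes d" using i by (simp add: nodes_def)
  have f': "(\<lambda>x. f (x (i, 0))) \<in> borel_measurable (Pi\<^sub>M (nodes d) (\<lambda>_. borel))"
    by (rule measurable_compose[OF measurable_component_singleton[OF v] f])
  have "(\<integral>x. f (x (i, 0)) \<partial>process_law d M (\<lambda>t. S (t + h))) = (\<integral>\<omega>. f (S h \<omega> i) \<partial>M)" for h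
    unfolding process_law_def using v
    by (subst integral_distr[OF process_law_map_measurable f']) simp
  moreover have "process_law d M (\<lambda>t. S (t + h)) = process_law d M S" for h
    using process by (simp add: stationary_var_process_def)
  ultimately show ?thesis by metis
qed

text \<open>A combination of finitely many nodes is a finite combination of innovations plus a
  remainder whose coefficients tend to 0 while its random factors keep their distributions. The
  remainder disappears in the limit, and the characteristic function of the finite part is
  explicit.\<close>

lemma char_process:
  assumes U: "finite U" "U \<subseteq> nodes d"
  shows "(CLINT \<omega>|M. iexp (\<Sum>v\<in>U. x v * S (snd v) \<omega> (fst v)))
    = complex_of_real (exp (- (\<Sum>u\<in>U. \<Sum>v\<in>U. x u * x v * \<Gamma> u v) / 2))"
proof -
  define W where "W \<omega> = (\<Sum>v\<in>U. x v * S (snd v) \<omega> (fst v))" for \<omega>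
  have SU[measurable]: "v \<in> U \<Longrightarrow> (\<lambda>\<omega>. S (snd v) \<omega> (fst v)) \<in> borel_measurable M" for v
    using U by (intro S_measurable) (auto simp: nodes_def)
  have W_meas[measurable]: "W \<in> borel_measurable M"
    unfolding W_def by measurable
  define c where "c = (\<Sum>v\<in>U. \<bar>snd v\<bar>)"
  have c: "- c \<le> snd v" "snd v \<le> c" if "v \<in> U" for v
    using member_le_sum[of v U "\<lambda>v. \<bar>snd v\<bar>"] that U unfolding c_def by auto
  have c0: "0 \<le> c" unfolding c_def by (rule sum_nonneg) simp
  \<comment> \<open>The times of \<open>U\<close> lie between - c and c, so \<open>T n\<close>
    precedes all of them; the range from \<open>T n\<close> (excluded) to \<open>c\<close> has n + 2
    c elements.\<close>
  define T where "T n = - c - int n" for n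
  define \<kappa> where "\<kappa> s j = (\<Sum>v\<in>U. x v * \<psi> v (j, s))" for s j
  define \<rho> where "\<rho> n b = (\<Sum>v\<in>U. x v * fpow J F (nat (snd v - T n)) (0, fst v) b)" for n b
  define Y where "Y n \<omega> = (\<Sum>s\<in>{T n<..c}. \<Sum>j<d. \<kappa> s j * \<epsilon> s \<omega> j)" for n \<omega>
  have [measurable]: "Y n \<in> borel_measurable M" for n
    unfolding Y_def by (intro borel_measurable_sum borel_measurable_times borel_measurable_const
        innovation_component_measurable) auto
  have decomp: "AE \<omega> in M. \<forall>n. W \<omega> = (\<Sum>b\<in>J. \<rho> n b * state (T n) b \<omega>) + Y n \<omega>"
    using state_rec
  proof eventually_elim
    case (elim \<omega>)
    show ?case
    proof
      fix n
      have "W \<omega> = (\<Sum>v\<in>U. x v * (\<Sum>b\<in>J. fpow J F (nat (snd v - T n)) (0, fst v) b * state (T n) b \<omega>)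
          + x v * (\<Sum>s\<in>{T n<..c}. \<Sum>j<d. \<psi> v (j, s) * \<epsilon> s \<omega> j))"
        unfolding W_def
      proof (rule sum.cong[OF refl])
        fix v assume v: "v \<in> U"
        have "S (snd v) \<omega> (fst v) = (\<Sum>b\<in>J. fpow J F (nat (snd v - T n)) (0, fst v) b * state (T n) b \<omega>)
            + (\<Sum>s\<in>{T n<..c}. \<Sum>j<d. \<psi> v (j, s) * \<epsilon> s \<omega> j)"
        proof (rule node_unroll)
          show "state t a \<omega> = (\<Sum>b\<in>J. F a b * state (t - 1) b \<omega>) + (\<Sum>j<d. G a j * \<epsilon> t \<omega> j)"
            if "a \<in> J" for t a
            using elim that by blast
          show "v \<in> nodes d" using v U(2) by blast
          show "T n \<le> snd v" using c(1)[OF v] by (simp add: T_def)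
          show "snd v \<le> c" by (rule c(2)[OF v])
        qed
        then show "x v * S (snd v) \<omega> (fst v) = x v * (\<Sum>b\<in>J. fpow J F (nat (snd v - T n)) (0, fst v) b * state (T n) b \<omega>)
          + x v * (\<Sum>s\<in>{T n<..c}. \<Sum>j<d. \<psi> v (j, s) * \<epsilon> s \<omega> j)"
          by (simp only: distrib_left)
      qed
      also have "\<dots> = (\<Sum>b\<in>J. \<rho> n b * state (T n) b \<omega>)
          + (\<Sum>v\<in>U. x v * (\<Sum>s\<in>{T n<..c}. \<Sum>j<d. \<psi> v (j, s) * \<epsilon> s \<omega> j))"
        unfolding sum.distrib sum_mult_swap \<rho>_def ..
      also have "(\<Sum>v\<in>U. x v * (\<Sum>s\<in>{T n<..c}. \<Sum>j<d. \<psi> v (j, s) * \<epsilon> s \<omega> j))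
          = (\<Sum>s\<in>{T n<..c}. \<Sum>v\<in>U. x v * (\<Sum>j<d. \<psi> v (j, s) * \<epsilon> s \<omega> j))"
        unfolding sum_distrib_left[of _ _ "{T n<..c}"] by (rule sum.swap)
      also have "\<dots> = Y n \<omega>"
        unfolding Y_def \<kappa>_def sum_mult_swap ..
      finally show "W \<omega> = (\<Sum>b\<in>J. \<rho> n b * state (T n) b \<omega>) + Y n \<omega>" .
    qed
  qed
  obtain C r where Cr: "0 \<le> C" "0 < r" "r < 1" "\<And>k a b. a \<in> J \<Longrightarrow> b \<in> J \<Longrightarrow> \<bar>fpow J F k a b\<bar> \<le> C * r ^ k"
    using stable_imp_fpow_decay[OF stable] by blast
  have \<rho>_lim: "(\<lambda>n. \<rho> n b) \<longlonglongrightarrow> 0" if b: "b \<in> J" for b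
  proof (rule Lim_null_comparison)
    show "\<forall>\<^sub>F n in sequentially. norm (\<rho> n b) \<le> (\<Sum>v\<in>U. \<bar>x v\<bar>) * C * r ^ n"
    proof (rule always_eventually, rule allI)
      fix n
      have "\<bar>\<rho> n b\<bar> \<le> (\<Sum>v\<in>U. \<bar>x v\<bar> * \<bar>fpow J F (nat (snd v - T n)) (0, fst v) b\<bar>)"
        unfolding \<rho>_def abs_mult[symmetric] by (rule sum_abs)
      also have "\<dots> \<le> (\<Sum>v\<in>U. \<bar>x v\<bar> * (C * r ^ n))"
      proof (intro sum_mono mult_left_mono)
        fix v assume v: "v \<in> U"
        have "(0, fst v) \<in> J" using v U by (auto simp: nodes_def states_def)
        then have "\<bar>fpow J F (nat (snd v - T n)) (0, fst v) b\<bar> \<le> C * r ^ nat (snd v - T n)"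
          by (rule Cr(4)[OF _ b])
        also have "\<dots> \<le> C * r ^ n"
          using Cr c(1)[OF v] by (intro mult_left_mono power_decreasing) (auto simp: T_def)
        finally show "\<bar>fpow J F (nat (snd v - T n)) (0, fst v) b\<bar> \<le> C * r ^ n" .
      qed simp
      finally show "norm (\<rho> n b) \<le> (\<Sum>v\<in>U. \<bar>x v\<bar>) * C * r ^ n"
        by (simp add: sum_distrib_right mult.assoc)
    qed
    have "(\<lambda>n. (\<Sum>v\<in>U. \<bar>x v\<bar>) * C * r ^ n) \<longlonglongrightarrow> (\<Sum>v\<in>U. \<bar>x v\<bar>) * C * 0"
      using Cr by (intro tendsto_intros LIMSEQ_power_zero) auto
    then show "(\<lambda>n. (\<Sum>v\<in>U. \<bar>x v\<bar>) * C * r ^ n) \<longlonglongrightarrow> 0" by simp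
  qed
  \<comment> \<open>Truncation at 2 makes the remainder integrable without moments of
    \<open>S\<close> and matches \<open>cmod_iexp_diff_le\<close>. By stationarity the state at time
    \<open>T n\<close> may be replaced by \<open>S\<close> at time 0, so dominated convergence
    applies.\<close>
  define E where "E n b = (\<integral>\<omega>. min 2 \<bar>\<rho> n b * S 0 \<omega> (snd b)\<bar> \<partial>M)" for n b
  have E_lim: "(\<lambda>n. E n b) \<longlonglongrightarrow> 0" if b: "b \<in> J" for b
  proof -
    have [measurable]: "(\<lambda>\<omega>. S 0 \<omega> (snd b)) \<in> borel_measurable M"
      using b by (intro S_measurable) (auto simp: states_def)
    have "(\<lambda>n. E n b) \<longlonglongrightarrow> (\<integral>\<omega>. 0 \<partial>M)"
      unfolding E_def
    proof (rule integral_dominated_convergence[of _ _ _ "\<lambda>_. 2"])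
      show "AE \<omega> in M. (\<lambda>n. min 2 \<bar>\<rho> n b * S 0 \<omega> (snd b)\<bar>) \<longlonglongrightarrow> 0"
      proof (rule AE_I2)
        fix \<omega>
        have "(\<lambda>n. min 2 \<bar>\<rho> n b * S 0 \<omega> (snd b)\<bar>) \<longlonglongrightarrow> min 2 \<bar>0 * S 0 \<omega> (snd b)\<bar>"
          by (intro tendsto_intros \<rho>_lim b)
        then show "(\<lambda>n. min 2 \<bar>\<rho> n b * S 0 \<omega> (snd b)\<bar>) \<longlonglongrightarrow> 0" by simp
      qed
    qed auto
    then show ?thesis by simp
  qed
  have int_iexp: "integrable M (\<lambda>\<omega>. iexp (f \<omega>))" if "f \<in> borel_measurable M" for f :: "'w \<Rightarrow> real"
    using that by (intro integrable_iexp) auto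
  have diff: "cmod ((CLINT \<omega>|M. iexp (W \<omega>)) - (CLINT \<omega>|M. iexp (Y n \<omega>))) \<le> (\<Sum>b\<in>J. E n b)" for n
  proof -
    have int_min: "integrable M (\<lambda>\<omega>. min 2 \<bar>\<rho> n b * state (T n) b \<omega>\<bar>)" if "b \<in> J" for b
    proof (rule integrable_const_bound[of _ 2])
      show "(\<lambda>\<omega>. min 2 \<bar>\<rho> n b * state (T n) b \<omega>\<bar>) \<in> borel_measurable M"
        using state_measurable[OF that] by measurable
    qed auto
    have "cmod ((CLINT \<omega>|M. iexp (W \<omega>)) - (CLINT \<omega>|M. iexp (Y n \<omega>))) = cmod (CLINT \<omega>|M. iexp (W \<omega>) - iexp (Y n \<omega>))"
      by (subst Bochner_Integration.integral_diff) (auto intro!: int_iexp)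
    also have "\<dots> \<le> (\<integral>\<omega>. cmod (iexp (W \<omega>) - iexp (Y n \<omega>)) \<partial>M)"
      by (rule integral_norm_bound)
    also have "\<dots> \<le> (\<integral>\<omega>. (\<Sum>b\<in>J. min 2 \<bar>\<rho> n b * state (T n) b \<omega>\<bar>) \<partial>M)"
    proof (rule integral_mono_AE)
      show "integrable M (\<lambda>\<omega>. cmod (iexp (W \<omega>) - iexp (Y n \<omega>)))"
        by (intro integrable_norm Bochner_Integration.integrable_diff int_iexp) auto
      show "integrable M (\<lambda>\<omega>. \<Sum>b\<in>J. min 2 \<bar>\<rho> n b * state (T n) b \<omega>\<bar>)"
        by (intro Bochner_Integration.integrable_sum int_min)
      show "AE \<omega> in M. cmod (iexp (W \<omega>) - iexp (Y n \<omega>)) \<le> (\<Sum>b\<in>J. min 2 \<bar>\<rho> n b * state (T n) b \<omega>\<bar>)"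
        using decomp
      proof eventually_elim
        case (elim \<omega>)
        have sub: "min 2 \<bar>\<Sum>b\<in>I. f b\<bar> \<le> (\<Sum>b\<in>I. min 2 \<bar>f b\<bar>)" if "finite I" for I and f :: "nat \<times> nat \<Rightarrow> real"
          using that
        proof (induction I rule: finite_induct)
          case (insert b I)
          have "min 2 \<bar>f b + (\<Sum>b\<in>I. f b)\<bar> \<le> min 2 \<bar>f b\<bar> + min 2 \<bar>\<Sum>b\<in>I. f b\<bar>"
            by (auto simp: min_def)
          then show ?case using insert by simp
        qed simp
        have "cmod (iexp (W \<omega>) - iexp (Y n \<omega>)) \<le> min 2 \<bar>W \<omega> - Y n \<omega>\<bar>"
          by (rule cmod_iexp_diff_le)
        also have "W \<omega> - Y n \<omega> = (\<Sum>b\<in>J. \<rho> n b * state (T n) b \<omega>)"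
          using spec[OF elim, of n] by linarith
        also have "min 2 \<bar>\<dots>\<bar> \<le> (\<Sum>b\<in>J. min 2 \<bar>\<rho> n b * state (T n) b \<omega>\<bar>)"
          by (rule sub[OF finite_states])
        finally show ?case .
      qed
    qed
    also have "\<dots> = (\<Sum>b\<in>J. \<integral>\<omega>. min 2 \<bar>\<rho> n b * state (T n) b \<omega>\<bar> \<partial>M)"
      by (rule Bochner_Integration.integral_sum[OF int_min])
    also have "\<dots> = (\<Sum>b\<in>J. E n b)"
      unfolding E_def state_def
      by (intro sum.cong refl stationary_integral[where f = "\<lambda>y. min 2 \<bar>\<rho> n _ * y\<bar>"]) (auto simp: states_def)
    finally show ?thesis .
  qed
  have "(\<lambda>n. \<Sum>b\<in>J. E n b) \<longlonglongrightarrow> (\<Sum>b\<in>J. 0)"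
    by (intro tendsto_sum E_lim)
  then have E_sum_lim: "(\<lambda>n. \<Sum>b\<in>J. E n b) \<longlonglongrightarrow> 0"
    by (simp only: sum.neutral_const)
  have "(\<lambda>n. (CLINT \<omega>|M. iexp (W \<omega>)) - (CLINT \<omega>|M. iexp (Y n \<omega>))) \<longlonglongrightarrow> 0"
    by (rule Lim_null_comparison[OF always_eventually[OF allI[OF diff]] E_sum_lim])
  from tendsto_diff[OF tendsto_const[of "CLINT \<omega>|M. iexp (W \<omega>)"] this]
  have lim1: "(\<lambda>n. CLINT \<omega>|M. iexp (Y n \<omega>)) \<longlonglongrightarrow> (CLINT \<omega>|M. iexp (W \<omega>))"
    by (simp only: diff_diff_eq2 add_diff_cancel_left' diff_zero)
  define q where "q n = (\<Sum>s\<in>{T n<..c}. \<Sum>j<d. \<sigma>2 j * (\<kappa> s j)\<^sup>2)" for n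
  have "(CLINT \<omega>|M. iexp (Y n \<omega>)) = complex_of_real (exp (- q n / 2))" for n
    unfolding Y_def q_def by (rule char_innovations) simp
  moreover have "q \<longlonglongrightarrow> (\<Sum>u\<in>U. \<Sum>v\<in>U. x u * x v * \<Gamma> u v)"
  proof -
    \<comment> \<open>Expanding the square turns the variance of the finite part into partial sums
      of the autocovariance series; the fixed offset 2 c is harmless in the limit.\<close>
    have q_eq: "q n = (\<Sum>u\<in>U. \<Sum>v\<in>U. x u * x v * (\<Sum>m<n + nat (2 * c). noise_prod d p A \<sigma>2 u v (c - int m)))" for n
    proof -
      have quad: "(\<Sum>j<d. \<sigma>2 j * (\<kappa> s j)\<^sup>2) = (\<Sum>u\<in>U. \<Sum>v\<in>U. x u * x v * noise_prod d p A \<sigma>2 u v s)" for s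
      proof -
        have "\<sigma>2 j * (\<kappa> s j)\<^sup>2 = (\<Sum>u\<in>U. \<Sum>v\<in>U. x u * x v * (\<sigma>2 j * \<psi> u (j, s) * \<psi> v (j, s)))" for j
        proof -
          have "(\<kappa> s j)\<^sup>2 = (\<Sum>u\<in>U. \<Sum>v\<in>U. (x u * \<psi> u (j, s)) * (x v * \<psi> v (j, s)))"
            by (simp only: \<kappa>_def power2_eq_square sum_product)
          then show ?thesis
            by (simp only: sum_distrib_left mult_ac)
        qed
        then have "(\<Sum>j<d. \<sigma>2 j * (\<kappa> s j)\<^sup>2)
            = (\<Sum>j<d. \<Sum>u\<in>U. \<Sum>v\<in>U. x u * x v * (\<sigma>2 j * \<psi> u (j, s) * \<psi> v (j, s)))"
          by simp
        also have "\<dots> = (\<Sum>u\<in>U. \<Sum>v\<in>U. x u * x v * noise_prod d p A \<sigma>2 u v s)"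
          unfolding noise_prod_def sum_distrib_left
          by (subst sum.swap, rule sum.cong[OF refl], subst sum.swap) (rule refl)
        finally show ?thesis .
      qed
      have "q n = (\<Sum>m<n + nat (2 * c). \<Sum>u\<in>U. \<Sum>v\<in>U. x u * x v * noise_prod d p A \<sigma>2 u v (c - int m))"
        unfolding q_def quad
        by (rule sum.reindex_bij_witness[of _ "\<lambda>m. c - int m" "\<lambda>s. nat (c - s)"]) (use c0 in \<open>auto simp: T_def\<close>)
      also have "\<dots> = (\<Sum>u\<in>U. \<Sum>v\<in>U. x u * x v * (\<Sum>m<n + nat (2 * c). noise_prod d p A \<sigma>2 u v (c - int m)))"
        unfolding sum_distrib_left
        by (subst sum.swap, rule sum.cong[OF refl], subst sum.swap) (rule refl)
      finally show ?thesis .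
    qed
    have "(\<lambda>n. \<Sum>m<n + nat (2 * c). noise_prod d p A \<sigma>2 u v (c - int m)) \<longlonglongrightarrow> \<Gamma> u v"
      if "u \<in> U" "v \<in> U" for u v
    proof -
      have "(\<lambda>n. noise_prod d p A \<sigma>2 u v (c - int n)) sums \<Gamma> u v"
        using that U c(2)[OF that(1)] by (intro noise_prod_sums(3)) (auto simp: nodes_def)
      then show ?thesis
        unfolding sums_def by (rule LIMSEQ_ignore_initial_segment)
    qed
    then show ?thesis
      unfolding q_eq by (intro tendsto_intros) auto
  qed
  then have "(\<lambda>n. complex_of_real (exp (- q n / 2)))
      \<longlonglongrightarrow> complex_of_real (exp (- (\<Sum>u\<in>U. \<Sum>v\<in>U. x u * x v * \<Gamma> u v) / 2))"
    by (intro tendsto_intros) auto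
  ultimately show ?thesis
    using lim1 LIMSEQ_unique by (simp add: W_def)
qed

lemma gaussian_coords_process_law: "gaussian_coords (process_law d M S) (nodes d) \<Gamma>"
proof -
  let ?\<Phi> = "\<lambda>\<omega>. \<lambda>v\<in>nodes d. S (snd v) \<omega> (fst v)"
  have \<Phi>: "?\<Phi> \<in> M \<rightarrow>\<^sub>M Pi\<^sub>M (nodes d) (\<lambda>_. borel)"
    using process_law_map_measurable[of 0] by simp
  have sets_law: "sets (process_law d M S) = sets (Pi\<^sub>M (nodes d) (\<lambda>_. borel))"
    by (simp add: process_law_def)
  have coord: "(\<lambda>x. x v) \<in> borel_measurable (Pi\<^sub>M (nodes d) (\<lambda>_. borel :: real measure))" if "v \<in> nodes d" for v
    by (rule measurable_component_singleton[OF that])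
  have char: "(CLINT x|process_law d M S. iexp (\<Sum>v\<in>U. s v * x v))
      = complex_of_real (exp (- (\<Sum>u\<in>U. \<Sum>v\<in>U. s u * s v * \<Gamma> u v) / 2))"
    and meas: "(\<lambda>x. \<Sum>v\<in>U. s v * x v) \<in> borel_measurable (Pi\<^sub>M (nodes d) (\<lambda>_. borel))"
    if U: "finite U" "U \<subseteq> nodes d" for U s
  proof -
    show m[measurable]: "(\<lambda>x. \<Sum>v\<in>U. s v * x v) \<in> borel_measurable (Pi\<^sub>M (nodes d) (\<lambda>_. borel))"
      using U by (intro borel_measurable_sum borel_measurable_times borel_measurable_const coord) auto
    have "(CLINT x|process_law d M S. iexp (\<Sum>v\<in>U. s v * x v)) = (CLINT \<omega>|M. iexp (\<Sum>v\<in>U. s v * ?\<Phi> \<omega> v))"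
      unfolding process_law_def by (rule integral_distr[OF \<Phi>]) measurable
    also have "(\<lambda>\<omega>. \<Sum>v\<in>U. s v * ?\<Phi> \<omega> v) = (\<lambda>\<omega>. \<Sum>v\<in>U. s v * S (snd v) \<omega> (fst v))"
      using U by (intro ext sum.cong) auto
    finally show "(CLINT x|process_law d M S. iexp (\<Sum>v\<in>U. s v * x v))
      = complex_of_real (exp (- (\<Sum>u\<in>U. \<Sum>v\<in>U. s u * s v * \<Gamma> u v) / 2))"
      using char_process[OF U, of s] by (simp add: fun_eq_iff)
  qed
  interpret law: prob_space "process_law d M S"
    unfolding process_law_def by (rule prob_space_distr[OF \<Phi>])
  have cos_sin: "(\<integral>x. cos (\<Sum>v\<in>U. s v * x v) \<partial>process_law d M S) = exp (- (\<Sum>u\<in>U. \<Sum>v\<in>U. s u * s v * \<Gamma> u v) / 2)"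
    "(\<integral>x. sin (\<Sum>v\<in>U. s v * x v) \<partial>process_law d M S) = 0"
    if U: "finite U" "U \<subseteq> nodes d" for U s
  proof -
    have m[measurable]: "(\<lambda>x. \<Sum>v\<in>U. s v * x v) \<in> borel_measurable (process_law d M S)"
      using meas[OF U] sets_law by (simp cong: measurable_cong_sets)
    have int: "integrable (process_law d M S) (\<lambda>x. cos (\<Sum>v\<in>U. s v * x v))"
      "integrable (process_law d M S) (\<lambda>x. sin (\<Sum>v\<in>U. s v * x v))"
      by (auto intro!: law.integrable_const_bound[of _ 1])
    have "complex_of_real (\<integral>x. cos (\<Sum>v\<in>U. s v * x v) \<partial>process_law d M S)
        + \<i> * complex_of_real (\<integral>x. sin (\<Sum>v\<in>U. s v * x v) \<partial>process_law d M S)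
        = (CLINT x|process_law d M S. iexp (\<Sum>v\<in>U. s v * x v))"
      using integral_Euler[OF int] Euler_scaleR[of 1] by (simp only: scaleR_one mult_1)
    also have "\<dots> = complex_of_real (exp (- (\<Sum>u\<in>U. \<Sum>v\<in>U. s u * s v * \<Gamma> u v) / 2))"
      by (rule char[OF U])
    finally show "(\<integral>x. cos (\<Sum>v\<in>U. s v * x v) \<partial>process_law d M S) = exp (- (\<Sum>u\<in>U. \<Sum>v\<in>U. s u * s v * \<Gamma> u v) / 2)"
      "(\<integral>x. sin (\<Sum>v\<in>U. s v * x v) \<partial>process_law d M S) = 0"
      by (simp_all add: complex_eq_iff)
  qed
  show ?thesis
  proof (intro gaussian_coords.intro gaussian_family.intro gaussian_family_axioms.intro)
    show "(\<lambda>x. x v) \<in> borel_measurable (process_law d M S)" if "v \<in> nodes d" for v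
      using coord[OF that] sets_law by (simp cong: measurable_cong_sets)
  qed (use autocov_sym cos_sin law.prob_space_axioms in auto)
qed

end


section \<open>Almost sure faithfulness\<close>

lemma coeff_index_less:
  assumes "i < d" "j < d" "k \<le> p"
  shows "k = 0 \<Longrightarrow> j < i \<Longrightarrow> (\<Sum>l<j. d - Suc l) + (i - Suc j) < n_coeffs d p"
    and "k \<noteq> 0 \<Longrightarrow> d * (d - 1) div 2 + ((k - 1) * d + j) * d + i < n_coeffs d p"
proof -
  assume "k = 0" "j < i"
  then have "(\<Sum>l<j. d - Suc l) + (i - Suc j) < (\<Sum>l<Suc j. d - Suc l)"
    using assms by simp
  also have "\<dots> \<le> (\<Sum>l<d. d - Suc l)"
    using assms by (intro sum_mono2) auto
  also have "\<dots> \<le> n_coeffs d p"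
    by (simp add: sum_diff_Suc n_coeffs_def)
  finally show "(\<Sum>l<j. d - Suc l) + (i - Suc j) < n_coeffs d p" .
next
  assume k: "k \<noteq> 0"
  have "(k - 1) * d + j < (k - 1) * d + d" using assms by simp
  also have "\<dots> = k * d" using k by (cases k) auto
  also have "\<dots> \<le> p * d" using assms by simp
  finally have "Suc ((k - 1) * d + j) * d \<le> p * d * d"
    by (intro mult_le_mono1) simp
  moreover have "((k - 1) * d + j) * d + i < Suc ((k - 1) * d + j) * d"
    using assms by simp
  ultimately have "((k - 1) * d + j) * d + i < p * d * d" by linarith
  then show "d * (d - 1) div 2 + ((k - 1) * d + j) * d + i < n_coeffs d p"
    by (simp add: n_coeffs_def power2_eq_square mult.assoc)
qed

lemma coeff_mat_restrict:
  assumes "i < d" "j < d" "k \<le> p" "n_coeffs d p \<le> n"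
  shows "coeff_mat d (restrict \<theta> {..<n}) k $$ (i, j) = coeff_mat d \<theta> k $$ (i, j)"
  using coeff_index_less[OF assms(1-3)] assms by (auto simp: coeff_mat_def)

lemma param_dom_stable:
  assumes "\<theta> \<in> param_dom d p"
  shows "stable_coeffs d p (coeff_mat d \<theta>)"
proof -
  have "restrict \<theta> {..<n_coeffs d p} \<in> powertop_real {..<n_coeffs d p} interior_of coeff_dom d p"
    using assms unfolding param_dom_def by blast
  then have "restrict \<theta> {..<n_coeffs d p} \<in> coeff_dom d p"
    by (rule subsetD[OF interior_of_subset])
  moreover have "var_char_mat d p (coeff_mat d (restrict \<theta> {..<n_coeffs d p})) z = var_char_mat d p (coeff_mat d \<theta>) z" for z
  proof -
    note entry = coeff_mat_restrict[OF _ _ _ order_refl, of _ d _ _ p \<theta>]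
    have "(\<Sum>k=1..p. complex_of_real (coeff_mat d (restrict \<theta> {..<n_coeffs d p}) k $$ (i, j)) * z ^ (p - k))
        = (\<Sum>k=1..p. complex_of_real (coeff_mat d \<theta> k $$ (i, j)) * z ^ (p - k))" if "i < d" "j < d" for i j
      using that by (intro sum.cong refl) (simp add: entry)
    then show ?thesis
      unfolding var_char_mat_def by (intro eq_matI) (simp_all add: entry)
  qed
  ultimately show ?thesis
    by (simp add: coeff_dom_def stable_coeffs_def)
qed

text \<open>Consider the row in which a kernel vector has its largest modulus K. For |z| \<ge> 1 the
  lower powers of z are dominated by the p-th one, so this row gives |z|^p K \<le> (p+1) d \<delta>
  |z|^p K, which is impossible.\<close>

lemma small_coeffs_stable:
  assumes small: "\<And>k i j. k \<le> p \<Longrightarrow> i < d \<Longrightarrow> j < d \<Longrightarrow> \<bar>A k $$ (i, j)\<bar> \<le> \<delta>"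
    and \<delta>: "real (Suc p) * real d * \<delta> < 1"
  shows "stable_coeffs d p A"
  unfolding stable_coeffs_def
proof (intro allI impI, rule ccontr)
  fix z assume det: "Determinant.det (var_char_mat d p A z) = 0" and "\<not> cmod z < 1"
  then have z: "1 \<le> cmod z" by simp
  have carrier: "var_char_mat d p A z \<in> carrier_mat d d"
    by (simp add: var_char_mat_def)
  obtain v where v: "v \<in> carrier_vec d" "v \<noteq> 0\<^sub>v d" "var_char_mat d p A z *\<^sub>v v = 0\<^sub>v d"
    using det det_0_iff_vec_prod_zero[OF carrier] by blast
  define x where "x i = vec_index v i" for i
  define K where "K = Max ((\<lambda>i. cmod (x i)) ` {..<d})"
  obtain i0 where i0: "i0 < d" "x i0 \<noteq> 0"
    using v(1,2) unfolding x_def by (metis carrier_vecD eq_vecI index_zero_vec)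
  have K: "cmod (x i) \<le> K" if "i < d" for i
    unfolding K_def using that by (intro Max_ge) auto
  have "0 < cmod (x i0)" using i0 by simp
  then have K_pos: "0 < K" using K[OF i0(1)] by linarith
  have "K \<in> (\<lambda>i. cmod (x i)) ` {..<d}"
    unfolding K_def using i0 by (intro Max_in) auto
  then obtain i where i: "i < d" "cmod (x i) = K" by auto
  have \<delta>0: "0 \<le> \<delta>" using small[of 0 i i] i by fastforce
  define a where "a k j = complex_of_real (A k $$ (i, j)) * z ^ (p - k) * x j" for k j
  have "0 = vec_index (var_char_mat d p A z *\<^sub>v v) i" using v(3) i by simp
  also have "\<dots> = (\<Sum>j<d. (((if i = j then 1 else 0) - complex_of_real (A 0 $$ (i, j))) * z ^ p -
     (\<Sum>k=1..p. complex_of_real (A k $$ (i, j)) * z ^ (p - k))) * x j)"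
    using v(1) i by (simp add: var_char_mat_def scalar_prod_def x_def atLeast0LessThan)
  also have "\<dots> = (\<Sum>j<d. (if j = i then z ^ p * x j else 0) - (\<Sum>k\<le>p. a k j))"
  proof (rule sum.cong[OF refl])
    fix j
    have "(\<Sum>k\<le>p. a k j) = a 0 j + (\<Sum>k=1..p. a k j)"
      by (simp add: atMost_atLeast0 sum.atLeast_Suc_atMost)
    then show "(((if i = j then 1 else 0) - complex_of_real (A 0 $$ (i, j))) * z ^ p -
     (\<Sum>k=1..p. complex_of_real (A k $$ (i, j)) * z ^ (p - k))) * x j = (if j = i then z ^ p * x j else 0) - (\<Sum>k\<le>p. a k j)"
      by (auto simp: a_def left_diff_distrib sum_distrib_right)
  qed
  finally have "z ^ p * x i = (\<Sum>j<d. \<Sum>k\<le>p. a k j)"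
    using i by (simp add: sum_subtractf)
  then have "cmod z ^ p * K = cmod (\<Sum>j<d. \<Sum>k\<le>p. a k j)"
    using i by (metis norm_mult norm_power)
  also have "\<dots> \<le> (\<Sum>j<d. \<Sum>k\<le>p. cmod (a k j))"
    by (rule order_trans[OF norm_sum], intro sum_mono norm_sum)
  also have "\<dots> \<le> (\<Sum>j<d. \<Sum>k\<le>p. \<delta> * cmod z ^ p * K)"
  proof (intro sum_mono)
    fix j k assume "j \<in> {..<d}" "k \<in> {..p}"
    then show "cmod (a k j) \<le> \<delta> * cmod z ^ p * K"
      unfolding a_def norm_mult norm_power norm_of_real
      using small i K z \<delta>0 by (intro mult_mono power_increasing mult_nonneg_nonneg zero_le_power) auto
  qed
  also have "\<dots> = (real (Suc p) * real d * \<delta>) * (cmod z ^ p * K)"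
    by simp
  also have "\<dots> < 1 * (cmod z ^ p * K)"
    using \<delta> K_pos z by (intro mult_strict_right_mono mult_pos_pos zero_less_power) auto
  finally show False by simp
qed

section \<open>Non-vanishing at the point with equal coordinates\<close>

definition small_params :: "nat \<Rightarrow> nat \<Rightarrow> nat \<Rightarrow> real" where
  "small_params d p = (\<lambda>i\<in>{..<n_coeffs d p + d}. 1 / (4 * (real (Suc p) * real d)))"

text \<open>The bound 4 \<delta> (p+1) d \<le> 1 holds with equality, and the variances share the
  value of the coefficients, so the witness is a constant vector. For \<open>d = 0\<close> the
  quotient would be 0, whereas \<delta> has to be positive.\<close>

lemma equal_coeffs_small_params:
  assumes d: "0 < d"
  shows "equal_coeffs d p (coeff_mat d (small_params d p)) (noise_var d p (small_params d p))
    (1 / (4 * (real (Suc p) * real d)))"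
proof -
  let ?\<delta> = "1 / (4 * (real (Suc p) * real d))"
  have pos: "0 < real (Suc p) * real d" using d by simp
  have coeff: "coeff_mat d (small_params d p) k $$ (i, j) = (if k = 0 \<longrightarrow> j < i then ?\<delta> else 0)"
    if "k \<le> p" "i < d" "j < d" for k i j
    using coeff_index_less[OF that(2,3,1)] that
    by (auto simp: coeff_mat_def small_params_def trans_less_add1)
  have stable: "stable_coeffs d p (coeff_mat d (small_params d p))"
  proof (rule small_coeffs_stable)
    show "\<bar>coeff_mat d (small_params d p) k $$ (i, j)\<bar> \<le> ?\<delta>" if "k \<le> p" "i < d" "j < d" for k i j
      using coeff[OF that] pos by simp
    show "real (Suc p) * real d * ?\<delta> < 1" using pos by (simp add: field_simps)
  qed
  show ?thesis
  proof (intro equal_coeffs.intro stable_var.intro var_coeffs_coeff_mat stable_var_axioms.intro stable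
      equal_coeffs_axioms.intro)
    show "0 < ?\<delta>" "4 * ?\<delta> * (real (Suc p) * real d) \<le> 1" using pos by (auto simp: field_simps)
    show "noise_var d p (small_params d p) i = ?\<delta>" if "i < d" for i
      using that by (simp add: noise_var_def small_params_def)
  qed (use coeff in auto)
qed

text \<open>The polynomial is the product of \<open>D'\<close>, the determinant of the rescaled
  covariance block on \<open>B\<close>, and \<open>g\<close>, the residual covariance with
  denominators cleared. If \<open>D'\<close> is nonzero, the normal equations are solved by
  \<open>N / D'\<close>; if \<open>g\<close> is nonzero too, so is the residual covariance. At the
  equal-coordinate point this is ensured by \<open>cov_kernel_trivial\<close> and
  \<open>residual_cov_pos\<close>.\<close>

lemma generic_dependence:
  assumes d: "0 < d" and B: "finite B" "B \<subseteq> nodes d" and a: "a \<in> nodes d" and c: "c \<in> nodes d" "c \<notin> B"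
    and walk: "(\<lambda>u v. adjacent (lag_edges d p) u v \<and> v \<notin> B)\<^sup>*\<^sup>* c a"
  shows "\<exists>f\<in>polyfuns. f (small_params d p) \<noteq> 0 \<and>
    (\<forall>\<theta>. stable_coeffs d p (coeff_mat d \<theta>) \<and> f \<theta> \<noteq> 0 \<longrightarrow>
      (\<exists>h. (\<forall>b\<in>B. (\<Sum>b'\<in>B. autocov d p (coeff_mat d \<theta>) (noise_var d p \<theta>) b b' * h b')
            = autocov d p (coeff_mat d \<theta>) (noise_var d p \<theta>) b c) \<and>
        (\<Sum>b\<in>B. autocov d p (coeff_mat d \<theta>) (noise_var d p \<theta>) a b * h b)
            \<noteq> autocov d p (coeff_mat d \<theta>) (noise_var d p \<theta>) a c))"
proof -
  define \<gamma> where "\<gamma> \<theta> = autocov d p (coeff_mat d \<theta>) (noise_var d p \<theta>)" for \<theta>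
  define st where "st \<theta> \<longleftrightarrow> stable_coeffs d p (coeff_mat d \<theta>)" for \<theta>
  obtain D n where D: "D \<in> polyfuns" and n: "\<forall>u\<in>nodes d. \<forall>v\<in>nodes d. n u v \<in> polyfuns"
    and rational: "\<forall>\<theta>. st \<theta> \<longrightarrow> D \<theta> \<noteq> 0 \<and> (\<forall>u\<in>nodes d. \<forall>v\<in>nodes d. D \<theta> * \<gamma> \<theta> u v = n u v \<theta>)"
    using autocov_rational[of d p, folded \<gamma>_def st_def] by (elim exE conjE)
  have D0: "D \<theta> \<noteq> 0" if "st \<theta>" for \<theta>
    using rational that by blast
  have Bn: "b \<in> nodes d" if "b \<in> B" for b using B that by blast
  have n_eq': "n u v \<theta> = D \<theta> * \<gamma> \<theta> u v" if "st \<theta>" "u \<in> nodes d" "v \<in> nodes d" for \<theta> u v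
    using rational that by simp
  have m_poly: "(\<lambda>\<theta>. n b b' \<theta>) \<in> polyfuns" if "b \<in> B" "b' \<in> B" for b b'
    using n Bn that by simp
  have q_poly: "(\<lambda>\<theta>. n b c \<theta>) \<in> polyfuns" if "b \<in> B" for b
    using n Bn that c(1) by simp
  \<comment> \<open>Cramer's rule is applied to the covariances multiplied by their common
    denominator \<open>D\<close>; this scale cancels in the solution \<open>N / D'\<close>.\<close>
  obtain D' N where D': "D' \<in> polyfuns" and N: "\<forall>b\<in>B. N b \<in> polyfuns"
    and sol: "\<forall>\<theta>. \<forall>b\<in>B. (\<Sum>b'\<in>B. n b b' \<theta> * N b' \<theta>) = D' \<theta> * n b c \<theta>"
    and inj: "\<forall>\<theta>. (\<forall>z. (\<forall>b\<in>B. (\<Sum>b'\<in>B. n b b' \<theta> * z b') = 0) \<longrightarrow> (\<forall>b\<in>B. z b = 0)) \<longrightarrow> D' \<theta> \<noteq> 0"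
    by (rule linear_system_polyfuns[of B "\<lambda>\<theta> b b'. n b b' \<theta>" "\<lambda>\<theta> b. n b c \<theta>", THEN exE])
      (rule B(1), erule (1) m_poly, erule q_poly, elim exE conjE, rule that, assumption+)
  define g where "g \<theta> = D' \<theta> * n a c \<theta> - (\<Sum>b\<in>B. n a b \<theta> * N b \<theta>)" for \<theta>
  define h where "h \<theta> b = N b \<theta> / D' \<theta>" for \<theta> b
  have g_poly: "g \<in> polyfuns"
    unfolding g_def using N n a c(1) Bn
    by (intro polyfuns_diff polyfuns_mult polyfuns_sum D') auto
  have h_sol: "(\<Sum>b'\<in>B. \<gamma> \<theta> b b' * h \<theta> b') = \<gamma> \<theta> b c"
    if \<theta>: "st \<theta>" "D' \<theta> \<noteq> 0" and b: "b \<in> B" for \<theta> b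
  proof -
    have "D \<theta> * (\<Sum>b'\<in>B. \<gamma> \<theta> b b' * h \<theta> b') = (\<Sum>b'\<in>B. n b b' \<theta> * N b' \<theta>) / D' \<theta>"
      unfolding sum_distrib_left sum_divide_distrib
      by (intro sum.cong refl) (simp add: n_eq'[OF \<theta>(1) Bn[OF b] Bn] h_def)
    also have "\<dots> = D \<theta> * \<gamma> \<theta> b c"
      using sol b \<theta> n_eq'[OF \<theta>(1) Bn[OF b] c(1)] by simp
    finally show ?thesis using D0[OF \<theta>(1)] by simp
  qed
  have h_a: "D' \<theta> * D \<theta> * (\<gamma> \<theta> a c - (\<Sum>b\<in>B. \<gamma> \<theta> a b * h \<theta> b)) = g \<theta>"
    if \<theta>: "st \<theta>" "D' \<theta> \<noteq> 0" for \<theta>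
  proof -
    have "D' \<theta> * D \<theta> * (\<Sum>b\<in>B. \<gamma> \<theta> a b * h \<theta> b) = (\<Sum>b\<in>B. n a b \<theta> * N b \<theta>)"
      unfolding sum_distrib_left
      by (intro sum.cong refl) (use \<theta> in \<open>simp add: n_eq'[OF \<theta>(1) a Bn] h_def\<close>)
    then show ?thesis
      unfolding g_def right_diff_distrib n_eq'[OF \<theta>(1) a c(1)] by (simp add: mult.assoc)
  qed
  interpret \<theta>0: equal_coeffs d p "coeff_mat d (small_params d p)" "noise_var d p (small_params d p)"
    "1 / (4 * (real (Suc p) * real d))"
    by (rule equal_coeffs_small_params[OF d])
  let ?\<theta>0 = "small_params d p"
  have st0: "st ?\<theta>0" unfolding st_def by (rule \<theta>0.stable)
  have D'0: "D' ?\<theta>0 \<noteq> 0"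
  proof (rule inj[THEN spec, THEN mp], intro allI impI ballI)
    fix z b assume z: "\<forall>b\<in>B. (\<Sum>b'\<in>B. n b b' ?\<theta>0 * z b') = 0" and b: "b \<in> B"
    have "(\<Sum>b'\<in>B. \<gamma> ?\<theta>0 b b' * z b') = 0" if b: "b \<in> B" for b
    proof -
      have "D ?\<theta>0 * (\<Sum>b'\<in>B. \<gamma> ?\<theta>0 b b' * z b') = (\<Sum>b'\<in>B. n b b' ?\<theta>0 * z b')"
        unfolding sum_distrib_left
        by (intro sum.cong refl) (simp add: n_eq'[OF st0 Bn[OF b] Bn])
      then show ?thesis using z b D0[OF st0] by simp
    qed
    then show "z b = 0"
      using \<theta>0.cov_kernel_trivial[OF B _ b, of z] unfolding \<gamma>_def by blast
  qed
  have "(\<Sum>b\<in>B. \<gamma> ?\<theta>0 a b * h ?\<theta>0 b) < \<gamma> ?\<theta>0 a c"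
    using \<theta>0.residual_cov_pos[OF B c _ walk, of "h ?\<theta>0"] h_sol[OF st0 D'0] unfolding \<gamma>_def by blast
  then have "D' ?\<theta>0 * D ?\<theta>0 * (\<gamma> ?\<theta>0 a c - (\<Sum>b\<in>B. \<gamma> ?\<theta>0 a b * h ?\<theta>0 b)) \<noteq> 0"
    using D'0 D0[OF st0] by simp
  then have g0: "g ?\<theta>0 \<noteq> 0"
    unfolding h_a[OF st0 D'0] .
  show ?thesis
    unfolding \<gamma>_def[symmetric] st_def[symmetric]
  proof (intro bexI[of _ "\<lambda>\<theta>. D' \<theta> * g \<theta>"] conjI allI impI)
    show "D' ?\<theta>0 * g ?\<theta>0 \<noteq> 0" using D'0 g0 by simp
    show "(\<lambda>\<theta>. D' \<theta> * g \<theta>) \<in> polyfuns" by (intro polyfuns_mult D' g_poly)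
    fix \<theta> assume \<theta>: "st \<theta> \<and> D' \<theta> * g \<theta> \<noteq> 0"
    then have "st \<theta>" "D' \<theta> \<noteq> 0" "g \<theta> \<noteq> 0" by auto
    then show "\<exists>h. (\<forall>b\<in>B. (\<Sum>b'\<in>B. \<gamma> \<theta> b b' * h b') = \<gamma> \<theta> b c) \<and> (\<Sum>b\<in>B. \<gamma> \<theta> a b * h b) \<noteq> \<gamma> \<theta> a c"
      using h_sol[of \<theta>] h_a[of \<theta>] by (intro exI[of _ "h \<theta>"]) auto
  qed
qed

text \<open>The relation tests only the endpoint of each step against \<open>B\<close>, so the start
  has to be known to lie outside \<open>B\<close> before the walk is reversed.\<close>

lemma skeleton_walk_sym:
  assumes "(\<lambda>u v. adjacent E u v \<and> v \<notin> B)\<^sup>*\<^sup>* a c" "a \<notin> B"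
  shows "(\<lambda>u v. adjacent E u v \<and> v \<notin> B)\<^sup>*\<^sup>* c a"
proof -
  have "c \<notin> B \<and> (\<lambda>u v. adjacent E u v \<and> v \<notin> B)\<^sup>*\<^sup>* c a"
    using assms(1)
  proof induction
    case (step u v)
    then have "adjacent E v u \<and> u \<notin> B" by (auto simp: adjacent_def)
    with step show ?case by (auto intro: converse_rtranclp_into_rtranclp)
  qed (use assms(2) in simp)
  then show ?thesis by simp
qed

theorem theorem4:
  fixes d p :: nat and P :: "(nat \<Rightarrow> real) measure"
  assumes "prob_space P"
    and "sets P = sets (lebesgue_on_params d p)"
    and "AE \<theta> in P. \<theta> \<in> param_dom d p"
    and "absolutely_continuous (lebesgue_on_params d p) P"
  shows "AE \<theta> in P. \<forall>(M :: 'w measure) S \<epsilon>.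
           stationary_var_process d p (coeff_mat d \<theta>) (noise_var d p \<theta>) M S \<epsilon> \<longrightarrow>
           faithful (nodes d) (full_time_edges d p (coeff_mat d \<theta>)) (process_law d M S)"
proof (cases "d = 0")
  case True
  then show ?thesis by (simp add: faithful_def nodes_def d_separated_def)
next
  case False
  then have d: "0 < d" by simp
  define \<gamma> where "\<gamma> \<theta> = autocov d p (coeff_mat d \<theta>) (noise_var d p \<theta>)" for \<theta>
  define walk where "walk B = (\<lambda>u v. adjacent (lag_edges d p) u v \<and> v \<notin> B)\<^sup>*\<^sup>*" for B
  \<comment> \<open>The index set mentions neither the parameters nor the sampled graph. Its
    exceptional null sets concern the parameters only, so their union also serves all realisations
    \<open>M\<close>, \<open>S\<close>, \<open>\<epsilon>\<close> at once.\<close>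
  define I where "I = {(B, a, c). finite B \<and> B \<subseteq> nodes d \<and> a \<in> nodes d \<and> c \<in> nodes d \<and> c \<notin> B \<and> walk B c a}"
  define dependent where "dependent \<theta> = (\<lambda>(B, a, c). \<exists>h. (\<forall>b\<in>B. (\<Sum>b'\<in>B. \<gamma> \<theta> b b' * h b') = \<gamma> \<theta> b c) \<and>
      (\<Sum>b\<in>B. \<gamma> \<theta> a b * h b) \<noteq> \<gamma> \<theta> a c)" for \<theta>
  have "I \<subseteq> {B. finite B} \<times> UNIV"
    by (auto simp: I_def)
  then have "countable I"
    by (rule countable_subset) (intro countable_SIGMA countable_Collect_finite countableI_type)
  moreover have "AE \<theta> in P. stable_coeffs d p (coeff_mat d \<theta>) \<longrightarrow> dependent \<theta> x" if x: "x \<in> I" for x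
  proof -
    obtain B a c where Bac: "x = (B, a, c)" "finite B" "B \<subseteq> nodes d" "a \<in> nodes d" "c \<in> nodes d" "c \<notin> B"
      "walk B c a"
      using x by (auto simp: I_def)
    obtain f where f: "f \<in> polyfuns" "f (small_params d p) \<noteq> 0"
      "\<forall>\<theta>. stable_coeffs d p (coeff_mat d \<theta>) \<and> f \<theta> \<noteq> 0 \<longrightarrow> dependent \<theta> x"
      using generic_dependence[OF d Bac(2-6) Bac(7)[unfolded walk_def]]
      unfolding \<gamma>_def[symmetric] dependent_def Bac(1) prod.case by blast
    have "AE \<theta> in lebesgue_on_params d p. f \<theta> \<noteq> 0"
      unfolding lebesgue_on_params_def
      by (rule polyfuns_AE_nonzero[OF finite_lessThan f(1,2)])
        (unfold small_params_def, rule restrict_extensional)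
    then have "AE \<theta> in P. f \<theta> \<noteq> 0"
      by (rule absolutely_continuous_AE[OF assms(2,4)])
    then show ?thesis
      using f(3) by (auto elim!: eventually_mono)
  qed
  ultimately have "AE \<theta> in P. \<forall>x\<in>I. stable_coeffs d p (coeff_mat d \<theta>) \<longrightarrow> dependent \<theta> x"
    by (subst AE_ball_countable) auto
  with assms(3) show ?thesis
  proof eventually_elim
    case (elim \<theta>)
    have stable: "stable_coeffs d p (coeff_mat d \<theta>)"
      by (rule param_dom_stable[OF elim(1)])
    have variance: "0 < noise_var d p \<theta> i" if "i < d" for i
      using elim(1) that by (simp add: param_dom_def)
    show ?case
    proof (intro allI impI)
      fix M :: "'w measure" and S \<epsilon>
      assume process: "stationary_var_process d p (coeff_mat d \<theta>) (noise_var d p \<theta>) M S \<epsilon>"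
      interpret stationary_process d p "coeff_mat d \<theta>" "noise_var d p \<theta>" M S \<epsilon>
      proof (intro stationary_process.intro stable_var.intro var_coeffs_coeff_mat stable_var_axioms.intro
          stationary_process_axioms.intro stable process variance)
        show "prob_space M" using process by (simp add: stationary_var_process_def)
      qed
      interpret law: gaussian_coords "process_law d M S" "nodes d" "\<gamma> \<theta>"
        unfolding \<gamma>_def by (rule gaussian_coords_process_law)
      show "faithful (nodes d) (full_time_edges d p (coeff_mat d \<theta>)) (process_law d M S)"
        unfolding faithful_def d_separated_def
      proof (intro allI impI ballI, rule ccontr)
        fix A' B C a c vs
        assume sets: "A' \<subseteq> nodes d \<and> B \<subseteq> nodes d \<and> C \<subseteq> nodes d \<and> finite A' \<and> finite B \<and> finite C \<and>
            A' \<inter> B = {} \<and> A' \<inter> C = {} \<and> B \<inter> C = {} \<and> cond_indep (process_law d M S) A' C B"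
          and a: "a \<in> A'" and c: "c \<in> C"
          and path: "path_between (full_time_edges d p (coeff_mat d \<theta>)) a vs c"
          and unblocked: "\<not> blocked (full_time_edges d p (coeff_mat d \<theta>)) B vs"
        have notB: "a \<notin> B" "c \<notin> B" using sets a c by auto
        \<comment> \<open>A path of the sampled graph that is not blocked is traded for a walk in
          the fixed skeleton, which puts the triple into \<open>I\<close>.\<close>
        have "walk B a c"
          unfolding walk_def
          using full_time_edges_subset_lag_edges lag_edges_asym lag_edges_shielded path unblocked notB
          by (rule unblocked_path_imp_skeleton_walk)
        then have "walk B c a"
          unfolding walk_def using notB(1) by (rule skeleton_walk_sym)
        then have "(B, a, c) \<in> I"
          using sets a c notB by (auto simp: I_def)
        then have "dependent \<theta> (B, a, c)" using elim(2) stable by blast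
        then obtain h where h: "\<forall>b\<in>B. (\<Sum>b'\<in>B. \<gamma> \<theta> b b' * h b') = \<gamma> \<theta> b c"
          and neq: "(\<Sum>b\<in>B. \<gamma> \<theta> a b * h b) \<noteq> \<gamma> \<theta> a c"
          unfolding dependent_def prod.case by blast
        have "(\<Sum>b\<in>B. \<gamma> \<theta> a b * h b) = \<gamma> \<theta> a c"
          by (rule law.cond_indep_imp_residual_uncorrelated[of B A' a C c h]) (use sets a c notB h in auto)
        with neq show False ..
      qed
    qed
  qed
qed

end
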